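(* Let $F$ be a field, $R=F[z]$, let $C>1$ be a constant, and set $|r|=C^{\deg_z(r)}$ for nonzero $r\in R$ and $|0|=0$. Let $m\ge 1$ and let $|\cdot|$ be a norm on $R^m$ such that: (1) for all $v\in R^m$, $|v|\ge 0$, and $|v|=0$ if and only if $v=0$; (2) for all $v,w\in R^m$, $|v+w|\le\max(|v|,|w|)$; (3) for all $v\in R^m$ and $r\in R$, $|rv|=|r||v|$. Let $M\subseteq R^m$ be a submodule of rank $m$ and let $d=\dim_F(R^m/M)$. Let $b_1,\dots,b_m$ be any $R$-basis of $R^m$. Then, given an $R$-basis of $M$, a nonzero vector $v\in M$ satisfying \[ |v|\le\sqrt[m]{|b_1|\cdots|b_m|}\;|z|^{d/m} \] can be found in polynomial time.
   Context: Since $M$ has rank $m$, the $F$-vector space $R^m/M$ is finite-dimensional. Note $|z|=C$. "Polynomial time" means a number of operations polynomial in the input size, with operations in $F$ assumed efficient; the input consists of the basis $b_1,\dots,b_m$ of $R^m$, the values $|b_1|,\dots,|b_m|$, and an $R$-basis of $M$. *)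

theory Defs
  imports Complex_Main "HOL-Algebra.AbelCoset" "Jordan_Normal_Form.VS_Connect"
begin

section \<open>Submodules of \<open>F[z]^m\<close>\<close>

text \<open>Throughout, \<open>F\<close> is a type \<open>'a\<close> of class \<open>field\<close>, \<open>R = F[z]\<close> is \<open>'a poly\<close>, and
  \<open>R^m\<close> is \<open>carrier_vec m\<close> with the module structure \<open>module_vec\<close>. The dimension is a
  natural number rather than a type because one algorithm has to serve all \<open>m\<close>.\<close>

abbreviation free_mod :: "nat \<Rightarrow> ('a::field poly, 'a poly vec) module" where
  "free_mod m \<equiv> module_vec TYPE('a poly) m"

definition is_submodule :: "nat \<Rightarrow> 'a::field poly vec set \<Rightarrow> bool" where
  "is_submodule m M \<longleftrightarrow> Module.submodule M class_ring (free_mod m)"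

definition has_rank :: "nat \<Rightarrow> 'a::field poly vec set \<Rightarrow> nat \<Rightarrow> bool" where
  "has_rank m M r \<longleftrightarrow>
     (\<exists>S\<subseteq>M. finite S \<and> card S = r \<and> \<not> LinearCombinations.module.lin_dep class_ring (free_mod m) S) \<and>
     (\<forall>S\<subseteq>M. finite S \<longrightarrow> \<not> LinearCombinations.module.lin_dep class_ring (free_mod m) S \<longrightarrow> card S \<le> r)"

definition is_basis :: "nat \<Rightarrow> 'a::field poly vec set \<Rightarrow> 'a poly vec list \<Rightarrow> bool" where
  "is_basis m M xs \<longleftrightarrow>
     distinct xs \<and> set xs \<subseteq> M \<and>
     \<not> LinearCombinations.module.lin_dep class_ring (free_mod m) (set xs) \<and>
     LinearCombinations.module.span class_ring (free_mod m) (set xs) = M"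

text \<open>The quotient \<open>R^m / M\<close> as an \<open>F\<close>-vector space: its elements are the cosets of \<open>M\<close>, and
  \<open>c \<in> F\<close> acts as the constant polynomial \<open>[:c:]\<close>. Adding \<open>M\<close> in the scalar multiplication
  only matters for \<open>c = 0\<close>, where the image of a coset is not a coset.\<close>

definition quot_space :: "nat \<Rightarrow> 'a::field poly vec set \<Rightarrow> ('a, 'a poly vec set) module" where
  "quot_space m M =
     \<lparr>carrier = A_RCOSETS (free_mod m) M,
      mult = undefined,
      one = undefined,
      zero = M,
      add = set_add (free_mod m),
      smult = (\<lambda>c X. set_add (free_mod m) M ((\<lambda>x. [:c:] \<cdot>\<^sub>v x) ` X))\<rparr>"

lemma quot_space_vectorspace:
  fixes M :: "'a::field poly vec set"
  assumes "is_submodule m M"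
  shows "vectorspace class_ring (quot_space m M)"
proof -
  let ?V = "free_mod m :: ('a poly, 'a poly vec) module"
  interpret V: vec_module "TYPE('a poly)" m .
  have sm: "Module.submodule M class_ring ?V" using assms by (simp add: is_submodule_def)
  have sub: "subgroup M (add_monoid ?V)" using sm by (rule Module.submodule.axioms(1))
  have add: "additive_subgroup M ?V" by (rule additive_subgroupI[OF sub])
  have abg: "abelian_group ?V" by (rule V.abelian_group_axioms)
  interpret S: abelian_subgroup M ?V
    by (rule abelian_subgroupI3[OF add abg])
  have Mc: "M \<subseteq> carrier_vec m" using S.a_subset by (simp add: module_vec_simps)
  have Msm: "x \<in> M \<Longrightarrow> r \<cdot>\<^sub>v x \<in> M" for r x
    using Module.submodule.smult_closed[OF sm, of r x] by (simp add: module_vec_simps)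
  have Madd: "x \<in> M \<Longrightarrow> y \<in> M \<Longrightarrow> x + y \<in> M" for x y
    using S.a_closed[of x y] by (simp add: module_vec_simps)
  have M0: "0\<^sub>v m \<in> M" using S.zero_closed by (simp add: module_vec_simps)
  define q where "q x = (\<lambda>h. h + x) ` M" for x
  have q: "a_r_coset ?V M x = q x" for x
    by (auto simp: a_r_coset_def r_coset_def q_def module_vec_simps)
  have car: "carrier (quot_space m M) = q ` carrier_vec m"
    by (auto simp: quot_space_def A_RCOSETS_def RCOSETS_def module_vec_simps q_def r_coset_def)
  have qa: "add (quot_space m M) (q x) (q y) = q (x + y)"
    if "x \<in> carrier_vec m" "y \<in> carrier_vec m" for x y
    using S.a_rcos_sum[of x y] that by (simp add: quot_space_def q module_vec_simps)
  have z: "zero (quot_space m M) = q (0\<^sub>v m)"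
    using Mc by (force simp: quot_space_def q_def)
  have qs: "smult (quot_space m M) c (q x) = q ([:c:] \<cdot>\<^sub>v x)"
    if x: "x \<in> carrier_vec m" for c x
  proof -
    have "set_add ?V M ((\<lambda>x. [:c:] \<cdot>\<^sub>v x) ` q x) = {h + [:c:] \<cdot>\<^sub>v (k + x) | h k. h \<in> M \<and> k \<in> M}"
      by (auto simp: set_add_def set_mult_def module_vec_simps q_def)
    also have "\<dots> = {(h + [:c:] \<cdot>\<^sub>v k) + [:c:] \<cdot>\<^sub>v x | h k. h \<in> M \<and> k \<in> M}"
    proof -
      have "h + [:c:] \<cdot>\<^sub>v (k + x) = (h + [:c:] \<cdot>\<^sub>v k) + [:c:] \<cdot>\<^sub>v x" if "h \<in> M" "k \<in> M" for h k
      proof -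
        have "h \<in> carrier_vec m" "k \<in> carrier_vec m" using that Mc by auto
        then show ?thesis using x
          by (simp add: smult_add_distrib_vec[of k m x] assoc_add_vec[of h m])
      qed
      then show ?thesis by (intro Collect_cong ex_cong1) metis
    qed
    also have "\<dots> = q ([:c:] \<cdot>\<^sub>v x)"
    proof -
      have "\<exists>h' k. h + y = h' + [:c:] \<cdot>\<^sub>v k + y \<and> h' \<in> M \<and> k \<in> M" if "h \<in> M" for h y
      proof -
        have "h = h + [:c:] \<cdot>\<^sub>v 0\<^sub>v m" using that Mc by auto
        then show ?thesis using that M0 by metis
      qed
      moreover have "h + [:c:] \<cdot>\<^sub>v k \<in> M" if "h \<in> M" "k \<in> M" for h k
        using that Madd Msm by blast
      ultimately show ?thesis unfolding q_def image_def by blast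
    qed
    finally show ?thesis by (simp add: quot_space_def)
  qed
  have ab: "[:a + b:] \<cdot>\<^sub>v x = [:a:] \<cdot>\<^sub>v x + [:b:] \<cdot>\<^sub>v x"
    if "x \<in> carrier_vec m" for a b and x :: "'a poly vec"
    using add_smult_distrib_vec[of "[:a:]" "[:b:]" x] by simp
  have "Module.module class_ring (quot_space m M)"
  proof (rule moduleI)
    show "cring (class_ring :: 'a ring)" by (rule class_cring.cring_axioms)
    show "abelian_group (quot_space m M)"
    proof (rule abelian_groupI)
      fix X assume "X \<in> carrier (quot_space m M)"
      then obtain x where x: "x \<in> carrier_vec m" "X = q x" by (auto simp: car)
      show "\<exists>Y\<in>carrier (quot_space m M). Y \<oplus>\<^bsub>quot_space m M\<^esub> X = \<zero>\<^bsub>quot_space m M\<^esub>"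
        using x by (intro bexI[of _ "q (- x)"]) (auto simp: car qa z)
    next
      fix X Y assume "X \<in> carrier (quot_space m M)" "Y \<in> carrier (quot_space m M)"
      then obtain x y where "x \<in> carrier_vec m" "X = q x" "y \<in> carrier_vec m" "Y = q y"
        by (auto simp: car)
      then show "X \<oplus>\<^bsub>quot_space m M\<^esub> Y = Y \<oplus>\<^bsub>quot_space m M\<^esub> X"
        by (simp add: qa comm_add_vec[of x m y])
    qed (auto simp: car qa z assoc_add_vec[of _ m])
  qed (auto simp: car qa qs smult_add_distrib_vec[of _ m] add_smult_distrib_vec[of _ m]
      smult_smult_assoc ab one_pCons[symmetric] mult.commute)
  then show ?thesis
    by (simp add: vectorspace_def class_field)
qed

definition quot_dim :: "nat \<Rightarrow> 'a::field poly vec set \<Rightarrow> nat" where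
  "quot_dim m M = vectorspace.dim class_ring (quot_space m M)"

definition pabs :: "real \<Rightarrow> 'a::field poly \<Rightarrow> real" where
  "pabs C r = (if r = 0 then 0 else C ^ degree r)"

definition is_norm :: "real \<Rightarrow> nat \<Rightarrow> ('a::field poly vec \<Rightarrow> real) \<Rightarrow> bool" where
  "is_norm C m N \<longleftrightarrow>
     (\<forall>v \<in> carrier_vec m. N v \<ge> 0 \<and> (N v = 0 \<longleftrightarrow> v = 0\<^sub>v m)) \<and>
     (\<forall>v \<in> carrier_vec m. \<forall>w \<in> carrier_vec m. N (v + w) \<le> max (N v) (N w)) \<and>
     (\<forall>v \<in> carrier_vec m. \<forall>r. N (r \<cdot>\<^sub>v v) = pabs C r * N v)"


section \<open>Algorithms\<close>

text \<open>A while language over three sorts of data: natural numbers (for indices and control),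
  elements of \<open>F\<close>, and real numbers (for values of the norm). A memory cell is addressed by a
  name and a list of indices, so that names denote multidimensional arrays. Every operation
  costs one step. The operations are chosen so that this unit cost is adequate:

  \<^item> on natural numbers only constants, addition, truncated subtraction and comparison
    (with unit-cost multiplication numbers of exponential length could be built);
  \<^item> in \<open>F\<close> the field operations and the equality test;
  \<^item> on reals only multiplication and comparison.

  A program contains no constants from \<open>F\<close> or from the reals except \<open>0\<close> and \<open>1\<close>.\<close>

type_synonym loc = "string \<times> nat list"

record 'a memory =
  nmem :: "loc \<Rightarrow> nat"
  fmem :: "loc \<Rightarrow> 'a"
  rmem :: "loc \<Rightarrow> real"

datatype nexp = NConst nat | NRef string "nexp list" | NAdd nexp nexp | NSub nexp nexp

datatype fexp = FZero | FOne | FRef string "nexp list"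
  | FAdd fexp fexp | FSub fexp fexp | FMul fexp fexp | FDiv fexp fexp

datatype rexp = ROne | RRef string "nexp list" | RMul rexp rexp

datatype bexp = NLess nexp nexp | FEq fexp fexp | RLe rexp rexp | BNot bexp | BAnd bexp bexp

datatype com = Skip
  | NAssign string "nexp list" nexp
  | FAssign string "nexp list" fexp
  | RAssign string "nexp list" rexp
  | Seq com com
  | IfThen bexp com com
  | While bexp com

fun nval :: "nexp \<Rightarrow> 'a memory \<Rightarrow> nat" where
  "nval (NConst n) s = n"
| "nval (NRef x is) s = nmem s (x, map (\<lambda>e. nval e s) is)"
| "nval (NAdd e f) s = nval e s + nval f s"
| "nval (NSub e f) s = nval e s - nval f s"

fun fval :: "fexp \<Rightarrow> 'a::field memory \<Rightarrow> 'a" where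
  "fval FZero s = 0"
| "fval FOne s = 1"
| "fval (FRef x is) s = fmem s (x, map (\<lambda>e. nval e s) is)"
| "fval (FAdd e f) s = fval e s + fval f s"
| "fval (FSub e f) s = fval e s - fval f s"
| "fval (FMul e f) s = fval e s * fval f s"
| "fval (FDiv e f) s = fval e s / fval f s"

fun rval :: "rexp \<Rightarrow> 'a memory \<Rightarrow> real" where
  "rval ROne s = 1"
| "rval (RRef x is) s = rmem s (x, map (\<lambda>e. nval e s) is)"
| "rval (RMul e f) s = rval e s * rval f s"

fun bval :: "bexp \<Rightarrow> 'a::field memory \<Rightarrow> bool" where
  "bval (NLess e f) s \<longleftrightarrow> nval e s < nval f s"
| "bval (FEq e f) s \<longleftrightarrow> fval e s = fval f s"
| "bval (RLe e f) s \<longleftrightarrow> rval e s \<le> rval f s"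
| "bval (BNot b) s \<longleftrightarrow> \<not> bval b s"
| "bval (BAnd b c) s \<longleftrightarrow> bval b s \<and> bval c s"

fun ncost :: "nexp \<Rightarrow> nat" where
  "ncost (NConst n) = 1"
| "ncost (NRef x is) = 1 + sum_list (map ncost is)"
| "ncost (NAdd e f) = 1 + ncost e + ncost f"
| "ncost (NSub e f) = 1 + ncost e + ncost f"

fun fcost :: "fexp \<Rightarrow> nat" where
  "fcost FZero = 1"
| "fcost FOne = 1"
| "fcost (FRef x is) = 1 + sum_list (map ncost is)"
| "fcost (FAdd e f) = 1 + fcost e + fcost f"
| "fcost (FSub e f) = 1 + fcost e + fcost f"
| "fcost (FMul e f) = 1 + fcost e + fcost f"
| "fcost (FDiv e f) = 1 + fcost e + fcost f"

fun rcost :: "rexp \<Rightarrow> nat" where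
  "rcost ROne = 1"
| "rcost (RRef x is) = 1 + sum_list (map ncost is)"
| "rcost (RMul e f) = 1 + rcost e + rcost f"

fun bcost :: "bexp \<Rightarrow> nat" where
  "bcost (NLess e f) = 1 + ncost e + ncost f"
| "bcost (FEq e f) = 1 + fcost e + fcost f"
| "bcost (RLe e f) = 1 + rcost e + rcost f"
| "bcost (BNot b) = 1 + bcost b"
| "bcost (BAnd b c) = 1 + bcost b + bcost c"

text \<open>\<open>big_step c s t s'\<close>: started in memory \<open>s\<close>, program \<open>c\<close> terminates in memory \<open>s'\<close> after
  \<open>t\<close> operations.\<close>

inductive big_step :: "com \<Rightarrow> 'a::field memory \<Rightarrow> nat \<Rightarrow> 'a memory \<Rightarrow> bool" where
  Skip: "big_step Skip s 1 s"
| NAssign: "big_step (NAssign x is e) s (1 + sum_list (map ncost is) + ncost e)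
    (s\<lparr>nmem := (nmem s)((x, map (\<lambda>i. nval i s) is) := nval e s)\<rparr>)"
| FAssign: "big_step (FAssign x is e') s (1 + sum_list (map ncost is) + fcost e')
    (s\<lparr>fmem := (fmem s)((x, map (\<lambda>i. nval i s) is) := fval e' s)\<rparr>)"
| RAssign: "big_step (RAssign x is e'') s (1 + sum_list (map ncost is) + rcost e'')
    (s\<lparr>rmem := (rmem s)((x, map (\<lambda>i. nval i s) is) := rval e'' s)\<rparr>)"
| Seq: "big_step c\<^sub>1 s t\<^sub>1 s' \<Longrightarrow> big_step c\<^sub>2 s' t\<^sub>2 s'' \<Longrightarrow>
    big_step (Seq c\<^sub>1 c\<^sub>2) s (t\<^sub>1 + t\<^sub>2) s''"
| IfTrue: "bval b s \<Longrightarrow> big_step c\<^sub>1 s t s' \<Longrightarrow> big_step (IfThen b c\<^sub>1 c\<^sub>2) s (bcost b + t) s'"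
| IfFalse: "\<not> bval b s \<Longrightarrow> big_step c\<^sub>2 s t s' \<Longrightarrow> big_step (IfThen b c\<^sub>1 c\<^sub>2) s (bcost b + t) s'"
| WhileFalse: "\<not> bval b s \<Longrightarrow> big_step (While b c) s (bcost b) s"
| WhileTrue: "bval b s \<Longrightarrow> big_step c s t\<^sub>1 s' \<Longrightarrow> big_step (While b c) s' t\<^sub>2 s'' \<Longrightarrow>
    big_step (While b c) s (bcost b + t\<^sub>1 + t\<^sub>2) s''"


section \<open>Input and output\<close>

text \<open>The input consists of the basis \<open>bs\<close> of \<open>R^m\<close>, the values of the norm on \<open>bs\<close> (the
  algorithm has no other access to the norm), the basis \<open>as\<close> of \<open>M\<close>, and the constant \<open>C\<close>.
  Polynomials are given densely, by their coefficients up to the maximal degree \<open>max_deg\<close> of all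
  entries. All remaining cells are initially \<open>0\<close>.\<close>

definition max_deg :: "nat \<Rightarrow> 'a::field poly vec list \<Rightarrow> 'a poly vec list \<Rightarrow> nat" where
  "max_deg m bs as = Max {degree (x $ j) | x j. x \<in> set bs \<union> set as \<and> j < m}"

definition init_memory ::
  "real \<Rightarrow> nat \<Rightarrow> ('a::field poly vec \<Rightarrow> real) \<Rightarrow> 'a poly vec list \<Rightarrow> 'a poly vec list \<Rightarrow> 'a memory"
where
  "init_memory C m N bs as =
     \<lparr>nmem = (\<lambda>l. if l = (''m'', []) then m
                  else if l = (''D'', []) then max_deg m bs as
                  else 0),
      fmem = (\<lambda>(x, is). case is of
           [i, j, k] \<Rightarrow>
             if i < m \<and> j < m \<and> x = ''b'' then coeff (bs ! i $ j) k
             else if i < m \<and> j < m \<and> x = ''a'' then coeff (as ! i $ j) k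
             else 0
         | _ \<Rightarrow> 0),
      rmem = (\<lambda>(x, is). case is of
           [] \<Rightarrow> if x = ''C'' then C else 0
         | [i] \<Rightarrow> if i < m \<and> x = ''norm'' then N (bs ! i) else 0
         | _ \<Rightarrow> 0)\<rparr>"

text \<open>The number of coefficients in the two bases plus the number of norm values.\<close>

definition input_size :: "nat \<Rightarrow> 'a::field poly vec list \<Rightarrow> 'a poly vec list \<Rightarrow> nat" where
  "input_size m bs as = 2 * m * m * (max_deg m bs as + 1) + m"

text \<open>The output vector is stored densely in the array \<open>v\<close>, with a degree bound in \<open>e\<close>.\<close>

definition output_vec :: "nat \<Rightarrow> 'a::field memory \<Rightarrow> 'a poly vec" where
  "output_vec m s = vec m (\<lambda>j. \<Sum>k\<le>nmem s (''e'', []). monom (fmem s (''v'', [j, k])) k)"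

definition output_size :: "nat \<Rightarrow> 'a::field memory \<Rightarrow> nat" where
  "output_size m s = m * (nmem s (''e'', []) + 1)"

end

theory Submission
  imports Defs
begin

text \<open>
  A vector \<open>\<Sum>\<^sub>i x\<^sub>i b\<^sub>i\<close> is bounded by the largest norm \<open>C\<^sup>k |b\<^sub>i|\<close> of a monomial \<open>z\<^sup>k b\<^sub>i\<close> occurring in
  it, so one looks for an \<open>F\<close>-linear combination of small monomials that lies in \<open>M\<close>. The algorithm
  runs through the monomials greedily, in order of increasing norm, and stops at the first one that
  is \<open>F\<close>-linearly dependent on the previous ones modulo \<open>M\<close>; the dependency is the output. If at that
  point \<open>K\<^sub>i\<close> powers of \<open>z\<close> have been used with \<open>b\<^sub>i\<close>, then \<open>\<Sum>\<^sub>i K\<^sub>i \<le> d\<close> because the used monomials are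
  independent in \<open>R\<^sup>m/M\<close>, and the norm \<open>t\<close> of the last monomial satisfies
  \<open>t \<le> C^K\<^sub>i |b\<^sub>i|\<close> for every \<open>i\<close> by greediness. Multiplying over \<open>i\<close> gives \<open>t\<^sup>m \<le> C\<^sup>d \<Prod>\<^sub>i |b\<^sub>i|\<close>.

  Dependence modulo \<open>M\<close> is tested by Gaussian elimination over \<open>F\<close> against the finitely many vectors
  \<open>z\<^sup>k a\<^sub>i\<close> with \<open>k < q\<close>, where \<open>a\<^sub>1, \<dots>, a\<^sub>m\<close> is the given basis of \<open>M\<close>: by Cramer's rule an element of
  \<open>M\<close> of small degree has coordinates of small degree with respect to this basis.
\<close>

section \<open>Linear combinations over the polynomial ring\<close>

text \<open>The two directions of the dependence test need different invariants. That a reported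
  relation is genuine is carried by \<open>good\<close>: each stored pair satisfies w = u modulo M.
  That an unreported monomial really is independent in R^m/M requires the span of the stored rows to
  contain every element of M that could occur in a relation. Only here does the degree bound enter,
  and it must be fixed before the exponents \<open>K i\<close> are known. This is possible because
  they never exceed d during the search, and d is at most m^2 D, where D is the maximal degree of
  the input: the determinant of the basis matrix of M maps R^m into M, so only residues modulo this
  determinant matter in the quotient. The same estimate makes the number of rounds, at most d + 1,
  polynomial in the input size. The program never computes d; it occurs only in the analysis, as a
  bound on the sum of the \<open>K i\<close>.\<close>

definition comb :: "nat \<Rightarrow> 'a::field poly vec list \<Rightarrow> (nat \<Rightarrow> 'a poly) \<Rightarrow> 'a poly vec" where
  "comb m xs c = vec m (\<lambda>j. \<Sum>i<m. c i * xs ! i $ j)"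

lemma comb_carrier [simp]: "comb m xs c \<in> carrier_vec m"
  by (simp add: comb_def)

lemma comb_index [simp]: "j < m \<Longrightarrow> comb m xs c $ j = (\<Sum>i<m. c i * xs ! i $ j)"
  by (simp add: comb_def)

lemma comb_add: "comb m xs (\<lambda>i. c i + d i) = comb m xs c + comb m xs d"
  by (rule eq_vecI) (simp_all add: sum.distrib algebra_simps comb_def)

lemma comb_diff: "comb m xs (\<lambda>i. c i - d i) = comb m xs c - comb m xs d"
  by (rule eq_vecI) (simp_all add: sum_subtractf algebra_simps comb_def)

lemma comb_smult: "comb m xs (\<lambda>i. r * c i) = r \<cdot>\<^sub>v comb m xs c"
  by (rule eq_vecI) (simp_all add: sum_distrib_left algebra_simps comb_def)

lemma comb_zero: "comb m xs (\<lambda>i. 0) = 0\<^sub>v m"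
  by (rule eq_vecI) (simp_all add: comb_def)

lemma lincomb_poly_vec_index:
  assumes "S \<subseteq> carrier_vec m" "finite S" "j < m"
  shows "LinearCombinations.module.lincomb (free_mod m) a S $ j = (\<Sum>x\<in>S. a x * x $ j)"
proof -
  interpret V: vec_module "TYPE('a poly)" m .
  have "V.lincomb a S $ j = (\<Sum>x\<in>S. (a x \<cdot>\<^sub>v x) $ j)"
    unfolding V.lincomb_def by (rule V.finsum_index) (use assms in auto)
  also have "\<dots> = (\<Sum>x\<in>S. a x * x $ j)"
    using assms by (intro sum.cong) auto
  finally show ?thesis .
qed

text \<open>Passes from coefficients indexed by vectors to coefficients indexed by positions, the
  form that matrices and arrays use. Distinctness makes \<open>nth\<close> a bijection onto the
  set.\<close>

lemma lincomb_set_eq_comb: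
  assumes xs: "set xs \<subseteq> carrier_vec m" "distinct xs" "length xs = m"
  shows "LinearCombinations.module.lincomb (free_mod m) a (set xs) = comb m xs (\<lambda>i. a (xs ! i))"
proof (rule eq_vecI)
  interpret V: vec_module "TYPE('a poly)" m .
  have "V.lincomb a (set xs) \<in> carrier_vec m" using xs by (intro V.lincomb_closed) auto
  then show "dim_vec (V.lincomb a (set xs)) = dim_vec (comb m xs (\<lambda>i. a (xs ! i)))" by (auto simp: comb_def)
  fix j assume "j < dim_vec (comb m xs (\<lambda>i. a (xs ! i)))"
  then have j: "j < m" by (simp add: comb_def)
  have "bij_betw (\<lambda>i. xs ! i) {..<m} (set xs)" using xs by (intro bij_betw_nth) auto
  from sum.reindex_bij_betw[OF this, of "\<lambda>x. a x * x $ j"]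
  show "V.lincomb a (set xs) $ j = comb m xs (\<lambda>i. a (xs ! i)) $ j"
    using j xs by (simp add: lincomb_poly_vec_index)
qed

lemma submodule_closed:
  fixes M :: "'a::field poly vec set"
  assumes "is_submodule m M"
  shows "M \<subseteq> carrier_vec m" "0\<^sub>v m \<in> M"
    "\<And>x y. x \<in> M \<Longrightarrow> y \<in> M \<Longrightarrow> x + y \<in> M" "\<And>r x. x \<in> M \<Longrightarrow> r \<cdot>\<^sub>v x \<in> M"
proof -
  have sm: "Module.submodule M class_ring (free_mod m :: ('a poly, 'a poly vec) module)"
    using assms by (simp add: is_submodule_def)
  have sub: "subgroup M (add_monoid (free_mod m :: ('a poly, 'a poly vec) module))"
    using sm by (rule Module.submodule.axioms(1))
  show "M \<subseteq> carrier_vec m" using subgroup.subset[OF sub] by (simp add: module_vec_simps)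
  show "0\<^sub>v m \<in> M" using subgroup.one_closed[OF sub] by (simp add: module_vec_simps)
  show "x + y \<in> M" if "x \<in> M" "y \<in> M" for x y
    using subgroup.m_closed[OF sub that] by (simp add: module_vec_simps)
  show "r \<cdot>\<^sub>v x \<in> M" if "x \<in> M" for r x
    using Module.submodule.smult_closed[OF sm, of r x] that by (simp add: module_vec_simps)
qed

lemma basis_comb:
  fixes xs :: "'a::field poly vec list"
  assumes M: "M \<subseteq> carrier_vec m" and b: "is_basis m M xs" and l: "length xs = m"
  shows "M = range (comb m xs)"
    and "\<And>c. comb m xs c = 0\<^sub>v m \<Longrightarrow> \<forall>i<m. c i = 0"
proof -
  interpret V: vec_module "TYPE('a poly)" m .
  have d: "distinct xs" and s: "set xs \<subseteq> carrier_vec m" and li: "\<not> V.lin_dep (set xs)"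
    and sp: "V.span (set xs) = M"
    using b M by (auto simp: is_basis_def)
  \<comment> \<open>The converse passage: the coefficient of a vector is looked up at its position,
    which is unique since \<open>xs\<close> is distinct.\<close>
  have pick: "comb m xs c = V.lincomb (\<lambda>x. c (THE i. i < m \<and> xs ! i = x)) (set xs)" for c
  proof -
    have "(THE i'. i' < m \<and> xs ! i' = xs ! i) = i" if "i < m" for i
      using that d l by (auto simp: nth_eq_iff_index_eq)
    then have "comb m xs (\<lambda>i. c (THE i'. i' < m \<and> xs ! i' = xs ! i)) = comb m xs c"
      by (intro eq_vecI) (simp_all add: comb_def)
    then show ?thesis using lincomb_set_eq_comb[OF s d l] by simp
  qed
  have fs: "V.span (set xs) = {V.lincomb a (set xs) | a. True}"
    using V.finite_span[of "set xs"] s by auto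
  show "M = range (comb m xs)"
  proof
    show "M \<subseteq> range (comb m xs)"
      unfolding sp[symmetric] fs using lincomb_set_eq_comb[OF s d l] by auto
    show "range (comb m xs) \<subseteq> M"
      unfolding sp[symmetric] fs using pick by auto
  qed
  fix c assume 0: "comb m xs c = 0\<^sub>v m"
  show "\<forall>i<m. c i = 0"
  proof (intro allI impI, rule ccontr)
    fix i assume i: "i < m" and ci: "c i \<noteq> 0"
    have "(THE i'. i' < m \<and> xs ! i' = xs ! i) = i"
      using i d l by (auto simp: nth_eq_iff_index_eq)
    then have "V.lin_dep (set xs)"
      using V.lin_dep_crit[of "set xs" "set xs" "xs ! i" "\<lambda>x. c (THE i. i < m \<and> xs ! i = x)"]
        0 ci pick[of c] i l by auto
    then show False using li by simp
  qed
qed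

section \<open>Cramer's rule and degree bounds\<close>

lemma smult_one_mat_mult_vec:
  fixes v :: "'a::comm_ring_1 vec"
  assumes "v \<in> carrier_vec m" shows "(k \<cdot>\<^sub>m 1\<^sub>m m) *\<^sub>v v = k \<cdot>\<^sub>v v"
  using assms by (intro eq_vecI) auto

lemma comb_eq_mat_mult:
  "comb m xs c = mat m m (\<lambda>(j, i). xs ! i $ j) *\<^sub>v vec m c"
  by (rule eq_vecI) (simp_all add: comb_def scalar_prod_def lessThan_atLeast0 mult.commute)

lemma degree_cofactor_le:
  fixes A :: "'a::field poly mat"
  assumes A: "A \<in> carrier_mat m m" and deg: "\<And>i j. i < m \<Longrightarrow> j < m \<Longrightarrow> degree (A $$ (i, j)) \<le> D"
    and ij: "i < m" "j < m"
  shows "degree (cofactor A i j) \<le> m * D"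
proof -
  have "degree (det (mat_delete A i j)) \<le> D * (m - 1)"
  proof (rule degree_det_le)
    show "mat_delete A i j \<in> carrier_mat (m - 1) (m - 1)" using A by (rule mat_delete_carrier)
    fix a b assume "a < m - 1" "b < m - 1"
    then show "degree (mat_delete A i j $$ (a, b)) \<le> D"
      using A ij deg by (auto simp: mat_delete_def)
  qed
  also have "\<dots> \<le> m * D" by simp
  finally have "degree (det (mat_delete A i j)) \<le> m * D" .
  moreover have "degree ((- 1) ^ (i + j) * det (mat_delete A i j)) = degree (det (mat_delete A i j))"
    by (cases "even (i + j)") (simp_all add: minus_one_power_iff)
  ultimately show ?thesis by (simp add: cofactor_def)
qed

text \<open>Both parts come from the adjugate of the matrix A whose columns are the given vectors. A
  * adj A = (det A) I exhibits det A * v as a combination of the columns, so p = det A serves in the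
  first part; adj A * A = (det A) I expresses det A * y_i through cofactors of degree at most
  \<open>m * D\<close>.\<close>

lemma full_rank_degree_bounds:
  fixes as :: "'a::field poly vec list"
  assumes inj: "\<And>c. comb m as c = 0\<^sub>v m \<Longrightarrow> \<forall>i<m. c i = 0"
    and deg: "\<And>i j. i < m \<Longrightarrow> j < m \<Longrightarrow> degree (as ! i $ j) \<le> D"
  shows "\<exists>p. p \<noteq> 0 \<and> degree p \<le> m * D \<and> (\<forall>v\<in>carrier_vec m. p \<cdot>\<^sub>v v \<in> range (comb m as))"
    and "\<And>y i t. i < m \<Longrightarrow> (\<And>j. j < m \<Longrightarrow> degree (comb m as y $ j) \<le> t) \<Longrightarrow> degree (y i) \<le> m * D + t"
proof -
  define A where "A = mat m m (\<lambda>(j, i). as ! i $ j)"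
  have A: "A \<in> carrier_mat m m" by (simp add: A_def)
  have comb: "comb m as c = A *\<^sub>v vec m c" for c by (simp add: comb_eq_mat_mult A_def)
  have dA: "degree (A $$ (i, j)) \<le> D" if "i < m" "j < m" for i j
    using that deg by (simp add: A_def)
  \<comment> \<open>A singular matrix over an integral domain has a nonzero kernel vector over the
    same ring, so the argument stays within F[z].\<close>
  have det: "det A \<noteq> 0"
  proof
    assume "det A = 0"
    then obtain v where v: "v \<in> carrier_vec m" "v \<noteq> 0\<^sub>v m" "A *\<^sub>v v = 0\<^sub>v m"
      using det_0_iff_vec_prod_zero[OF A] by auto
    have "vec m (\<lambda>i. v $ i) = v" using v by auto
    then have "comb m as (\<lambda>i. v $ i) = 0\<^sub>v m" using v by (simp add: comb)
    then have "v $ i = 0" if "i < m" for i using inj that by blast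
    then have "v = 0\<^sub>v m" using v by (intro eq_vecI) auto
    then show False using v by simp
  qed
  show "\<exists>p. p \<noteq> 0 \<and> degree p \<le> m * D \<and> (\<forall>v\<in>carrier_vec m. p \<cdot>\<^sub>v v \<in> range (comb m as))"
  proof (intro exI conjI ballI)
    show "det A \<noteq> 0" by (rule det)
    show "degree (det A) \<le> m * D"
      using degree_det_le[of m A D] dA A by (simp add: mult.commute)
    fix v :: "'a poly vec" assume v: "v \<in> carrier_vec m"
    define y where "y = adj_mat A *\<^sub>v v"
    have y: "y \<in> carrier_vec m" using adj_mat(1)[OF A] v by (simp add: y_def)
    have "A *\<^sub>v y = (A * adj_mat A) *\<^sub>v v"
      using assoc_mult_mat_vec[OF A adj_mat(1)[OF A] v] by (simp add: y_def)
    also have "\<dots> = det A \<cdot>\<^sub>v v"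
      using v by (simp add: adj_mat(2)[OF A] smult_one_mat_mult_vec)
    finally have "comb m as (\<lambda>i. y $ i) = det A \<cdot>\<^sub>v v"
      using y by (simp add: comb) (metis carrier_vecD eq_vecI dim_vec index_vec)
    then show "det A \<cdot>\<^sub>v v \<in> range (comb m as)" by (metis rangeI)
  qed
  fix y i t assume i: "i < m" and t: "\<And>j. j < m \<Longrightarrow> degree (comb m as y $ j) \<le> t"
  have "adj_mat A *\<^sub>v comb m as y = (adj_mat A * A) *\<^sub>v vec m y"
    by (simp add: comb assoc_mult_mat_vec[OF adj_mat(1)[OF A] A])
  also have "\<dots> = det A \<cdot>\<^sub>v vec m y"
    by (simp add: adj_mat(3)[OF A] smult_one_mat_mult_vec)
  finally have "(adj_mat A *\<^sub>v comb m as y) $ i = det A * y i" using i by simp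
  moreover have "(adj_mat A *\<^sub>v comb m as y) $ i = (\<Sum>j<m. cofactor A j i * comb m as y $ j)"
    using i A by (simp add: adj_mat_def scalar_prod_def lessThan_atLeast0 comb_def)
  moreover have "degree (\<Sum>j<m. cofactor A j i * comb m as y $ j) \<le> m * D + t"
  proof (rule degree_sum_le)
    fix j assume "j \<in> {..<m}"
    then have "degree (cofactor A j i) \<le> m * D" "degree (comb m as y $ j) \<le> t"
      using degree_cofactor_le[OF A dA] i t by auto
    then show "degree (cofactor A j i * comb m as y $ j) \<le> m * D + t"
      by (meson add_mono degree_mult_le le_trans)
  qed simp
  ultimately have "degree (det A * y i) \<le> m * D + t" by simp
  \<comment> \<open>Degrees of nonzero factors add, so dropping the factor det A cannot raise the
    degree.\<close>
  then show "degree (y i) \<le> m * D + t"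
    using det by (cases "y i = 0") (auto simp: degree_mult_eq)
qed

section \<open>The dimension of the quotient\<close>

text \<open>This is \<open>a_r_coset\<close> of the free module, in a form that does not mention
  \<open>m\<close>.\<close>

definition coset :: "'a::field poly vec set \<Rightarrow> 'a poly vec \<Rightarrow> 'a poly vec set" where
  "coset M x = (\<lambda>h. h + x) ` M"

context
  fixes m :: nat and M :: "'a::field poly vec set"
  assumes M: "is_submodule m M"
begin

text \<open>Computes in the quotient on representatives; afterwards \<open>quot_space\<close> is
  never unfolded again.\<close>

lemma quot_space_simps:
  "carrier (quot_space m M) = coset M ` carrier_vec m"
  "zero (quot_space m M) = coset M (0\<^sub>v m)"
  "\<And>x y. x \<in> carrier_vec m \<Longrightarrow> y \<in> carrier_vec m \<Longrightarrow>
     add (quot_space m M) (coset M x) (coset M y) = coset M (x + y)"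
  "\<And>c x. x \<in> carrier_vec m \<Longrightarrow> smult (quot_space m M) c (coset M x) = coset M ([:c:] \<cdot>\<^sub>v x)"
proof -
  note cl = submodule_closed[OF M]
  let ?V = "free_mod m :: ('a poly, 'a poly vec) module"
  have sa: "set_add ?V X Y = {x + y | x y. x \<in> X \<and> y \<in> Y}" for X Y
    by (auto simp: set_add_def set_mult_def module_vec_simps)
  have mid: "h + [:c:] \<cdot>\<^sub>v (k + x) = (h + [:c:] \<cdot>\<^sub>v k) + [:c:] \<cdot>\<^sub>v x"
    if "h \<in> carrier_vec m" "k \<in> carrier_vec m" "x \<in> carrier_vec m" for h k x and c :: 'a
    using that by (simp add: smult_add_distrib_vec[of k m x] assoc_add_vec[of h m])
  show "carrier (quot_space m M) = coset M ` carrier_vec m"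
    by (auto simp: quot_space_def A_RCOSETS_def RCOSETS_def module_vec_simps coset_def r_coset_def)
  show "zero (quot_space m M) = coset M (0\<^sub>v m)"
    using cl(1) by (force simp: quot_space_def coset_def)
  fix x :: "'a poly vec" assume x: "x \<in> carrier_vec m"
  show "add (quot_space m M) (coset M x) (coset M y) = coset M (x + y)"
    if y: "y \<in> carrier_vec m" for y
  proof -
    have swap: "(h + x) + (k + y) = (h + k) + (x + y)" if "h \<in> M" "k \<in> M" for h k
    proof -
      have "h \<in> carrier_vec m" "k \<in> carrier_vec m" using that cl(1) by auto
      then show ?thesis using x y by (intro eq_vecI) auto
    qed
    show ?thesis
    proof
      show "add (quot_space m M) (coset M x) (coset M y) \<subseteq> coset M (x + y)"
        using swap cl(3) by (auto simp: quot_space_def coset_def sa)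
      show "coset M (x + y) \<subseteq> add (quot_space m M) (coset M x) (coset M y)"
      proof
        fix z assume "z \<in> coset M (x + y)"
        then obtain h where h: "h \<in> M" "z = h + (x + y)" by (auto simp: coset_def)
        then have "z = (h + x) + (0\<^sub>v m + y)" using swap[of h "0\<^sub>v m"] cl(1,2) by auto
        then show "z \<in> add (quot_space m M) (coset M x) (coset M y)"
          using h cl(2) by (auto simp: quot_space_def coset_def sa)
      qed
    qed
  qed
  show "smult (quot_space m M) c (coset M x) = coset M ([:c:] \<cdot>\<^sub>v x)" for c
  proof
    show "smult (quot_space m M) c (coset M x) \<subseteq> coset M ([:c:] \<cdot>\<^sub>v x)"
    proof
      fix z assume "z \<in> smult (quot_space m M) c (coset M x)"
      then obtain h k where hk: "h \<in> M" "k \<in> M" "z = h + [:c:] \<cdot>\<^sub>v (k + x)"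
        by (auto simp: quot_space_def coset_def sa)
      then have "z = (h + [:c:] \<cdot>\<^sub>v k) + [:c:] \<cdot>\<^sub>v x" using mid x cl(1) by blast
      then show "z \<in> coset M ([:c:] \<cdot>\<^sub>v x)" using hk cl(3,4) by (auto simp: coset_def)
    qed
    show "coset M ([:c:] \<cdot>\<^sub>v x) \<subseteq> smult (quot_space m M) c (coset M x)"
    proof
      fix z assume "z \<in> coset M ([:c:] \<cdot>\<^sub>v x)"
      then obtain h where h: "h \<in> M" "z = h + [:c:] \<cdot>\<^sub>v x" by (auto simp: coset_def)
      then have "z = h + [:c:] \<cdot>\<^sub>v (0\<^sub>v m + x)" using x by simp
      then show "z \<in> smult (quot_space m M) c (coset M x)"
        using h cl(2) by (auto simp: quot_space_def coset_def sa)
    qed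
  qed
qed

lemma coset_subset:
  assumes "x \<in> carrier_vec m" "y \<in> carrier_vec m" "x - y \<in> M"
  shows "coset M x \<subseteq> coset M y"
proof
  note cl = submodule_closed[OF M]
  fix z assume "z \<in> coset M x"
  then obtain h where h: "h \<in> M" "z = h + x" by (auto simp: coset_def)
  have "z = (h + (x - y)) + y"
    using assms carrier_vecD[of h m] subsetD[OF cl(1) h(1)] h(2) by (intro eq_vecI) auto
  then show "z \<in> coset M y" using h assms cl(3) by (auto simp: coset_def)
qed

lemma coset_eq_iff:
  assumes x: "x \<in> carrier_vec m" and y: "y \<in> carrier_vec m"
  shows "coset M x = coset M y \<longleftrightarrow> x - y \<in> M"
proof
  note cl = submodule_closed[OF M]
  show "x - y \<in> M" if "coset M x = coset M y"
  proof -
    have "0\<^sub>v m + x \<in> coset M x" using cl(2) unfolding coset_def by blast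
    then have "x \<in> coset M y" using that x by simp
    then obtain h where h: "h \<in> M" "x = h + y" by (auto simp: coset_def)
    then have "x - y = h" using y carrier_vecD[of h m] subsetD[OF cl(1) h(1)] by (intro eq_vecI) auto
    then show ?thesis using h by simp
  qed
  show "coset M x = coset M y" if xy: "x - y \<in> M"
  proof -
    have "y - x = (-1) \<cdot>\<^sub>v (x - y)" using x y by (intro eq_vecI) auto
    then have "y - x \<in> M" using cl(4)[OF xy] by simp
    then show ?thesis using coset_subset x y xy by blast
  qed
qed

text \<open>Translates F-linear relations between cosets into membership of polynomial vectors in
  \<open>M\<close>; scalars of F act as constant polynomials.\<close>

lemma finsum_coset:
  assumes "finite I" "\<And>i. i \<in> I \<Longrightarrow> x i \<in> carrier_vec m"
  shows "finsum (quot_space m M) (\<lambda>i. smult (quot_space m M) (c i) (coset M (x i))) I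
    = coset M (vec m (\<lambda>j. \<Sum>i\<in>I. [:c i:] * x i $ j))"
proof -
  interpret Q: vectorspace class_ring "quot_space m M" by (rule quot_space_vectorspace[OF M])
  show ?thesis using assms
  proof (induction I rule: finite_induct)
    case empty
    have "vec m (\<lambda>j. 0) = (0\<^sub>v m :: 'a poly vec)" by auto
    then show ?case by (simp add: quot_space_simps)
  next
    case (insert i I)
    have c: "(\<lambda>i. smult (quot_space m M) (c i) (coset M (x i))) \<in> insert i I \<rightarrow> carrier (quot_space m M)"
      using insert.prems by (auto simp: quot_space_simps)
    have "finsum (quot_space m M) (\<lambda>i. smult (quot_space m M) (c i) (coset M (x i))) (insert i I)
      = add (quot_space m M) (smult (quot_space m M) (c i) (coset M (x i)))
         (finsum (quot_space m M) (\<lambda>i. smult (quot_space m M) (c i) (coset M (x i))) I)"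
      using insert.hyps c by (intro Q.finsum_insert) auto
    also have "\<dots> = coset M ([:c i:] \<cdot>\<^sub>v x i + vec m (\<lambda>j. \<Sum>i\<in>I. [:c i:] * x i $ j))"
      using insert.prems insert.IH by (simp add: quot_space_simps)
    also have "[:c i:] \<cdot>\<^sub>v x i + vec m (\<lambda>j. \<Sum>i\<in>I. [:c i:] * x i $ j)
      = vec m (\<lambda>j. \<Sum>i\<in>insert i I. [:c i:] * x i $ j)"
      using insert.hyps carrier_vecD[OF insert.prems[of i]] by (intro eq_vecI) auto
    finally show ?case .
  qed
qed

text \<open>The family is indexed, so different indices may give the same coset; counting indices
  can only overestimate the generating set.\<close>

lemma quot_dim_le:
  assumes "finite I" "\<And>i. i \<in> I \<Longrightarrow> x i \<in> carrier_vec m"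
    and gen: "\<And>v. v \<in> carrier_vec m \<Longrightarrow>
      \<exists>c. coset M v = coset M (vec m (\<lambda>j. \<Sum>i\<in>I. [:c i:] * x i $ j))"
  shows "vectorspace.fin_dim class_ring (quot_space m M)" "quot_dim m M \<le> card I"
proof -
  interpret Q: vectorspace class_ring "quot_space m M" by (rule quot_space_vectorspace[OF M])
  let ?G = "(\<lambda>i. coset M (x i)) ` I"
  have G: "finite ?G" "?G \<subseteq> carrier (quot_space m M)" using assms by (auto simp: quot_space_simps)
  have sub: "LinearCombinations.submodule class_ring (Q.span ?G) (quot_space m M)"
    by (rule Q.span_is_submodule[OF G(2)])
  have own: "?G \<subseteq> Q.span ?G" by (rule Q.in_own_span[OF G(2)])
  have fin: "finsum (quot_space m M) (\<lambda>i. smult (quot_space m M) (c i) (coset M (x i))) J \<in> Q.span ?G"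
    if "J \<subseteq> I" for c J
    using finite_subset[OF that assms(1)] that
  proof (induction J rule: finite_induct)
    case empty
    show ?case using LinearCombinations.submodule.zero_closed[OF sub] by simp
  next
    case (insert i J)
    have c: "(\<lambda>i. smult (quot_space m M) (c i) (coset M (x i))) \<in> insert i J \<rightarrow> carrier (quot_space m M)"
      using insert.prems assms(2) by (auto simp: quot_space_simps)
    have "finsum (quot_space m M) (\<lambda>i. smult (quot_space m M) (c i) (coset M (x i))) (insert i J)
      = add (quot_space m M) (smult (quot_space m M) (c i) (coset M (x i)))
         (finsum (quot_space m M) (\<lambda>i. smult (quot_space m M) (c i) (coset M (x i))) J)"
      using insert.hyps c by (intro Q.finsum_insert) auto
    moreover have "coset M (x i) \<in> Q.span ?G" using own insert.prems by auto
    ultimately show ?case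
      using insert LinearCombinations.submodule.m_closed[OF sub]
        LinearCombinations.submodule.smult_closed[OF sub] by (auto simp: class_ring_simps)
  qed
  have sp: "coset M (vec m (\<lambda>j. \<Sum>i\<in>I. [:c i:] * x i $ j)) \<in> Q.span ?G" for c
    using fin[OF order_refl, of c] finsum_coset[OF assms(1,2), where c = c] by simp
  have "carrier (quot_space m M) \<subseteq> Q.span ?G"
  proof
    fix X assume "X \<in> carrier (quot_space m M)"
    then obtain v where "v \<in> carrier_vec m" "X = coset M v" by (auto simp: quot_space_simps)
    then obtain c where "X = coset M (vec m (\<lambda>j. \<Sum>i\<in>I. [:c i:] * x i $ j))" using gen by blast
    then show "X \<in> Q.span ?G" using sp by simp
  qed
  then have gs: "Q.gen_set ?G" using Q.span_is_subset2[OF G(2)] by auto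
  show "Q.fin_dim" unfolding Q.fin_dim_def using G gs by blast
  have "Q.dim \<le> card ?G" by (rule Q.gen_ge_dim[OF G gs])
  also have "\<dots> \<le> card I" by (rule card_image_le[OF assms(1)])
  finally show "quot_dim m M \<le> card I" by (simp add: quot_dim_def)
qed

text \<open>Here coinciding cosets have to be excluded first, since a collision would make the set
  of cosets smaller than \<open>I\<close>.\<close>

lemma card_le_quot_dim:
  assumes fd: "vectorspace.fin_dim class_ring (quot_space m M)"
    and I: "finite I" "\<And>i. i \<in> I \<Longrightarrow> x i \<in> carrier_vec m"
    and indep: "\<And>c i. vec m (\<lambda>j. \<Sum>i\<in>I. [:c i:] * x i $ j) \<in> M \<Longrightarrow> i \<in> I \<Longrightarrow> c i = 0"
  shows "card I \<le> quot_dim m M"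
proof -
  interpret Q: vectorspace class_ring "quot_space m M" by (rule quot_space_vectorspace[OF M])
  let ?h = "\<lambda>i. coset M (x i)"
  note cl = submodule_closed[OF M]
  have inj: "inj_on ?h I"
  proof (rule inj_onI, rule ccontr)
    fix i i' assume ii: "i \<in> I" "i' \<in> I" "?h i = ?h i'" "i \<noteq> i'"
    define h where "h = x i - x i'"
    have xi: "x i \<in> carrier_vec m" "x i' \<in> carrier_vec m" using I(2) ii by blast+
    have h: "h \<in> M" using ii(3) coset_eq_iff[OF xi] by (simp add: h_def)
    \<comment> \<open>If two indices gave the same coset, the coefficients 1 and -1 would be a
      nontrivial relation modulo \<open>M\<close>.\<close>
    define c :: "_ \<Rightarrow> 'a" where "c = (\<lambda>k. if k = i then 1 else if k = i' then -1 else 0)"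
    have "vec m (\<lambda>j. \<Sum>k\<in>I. [:c k:] * x k $ j) = h"
    proof (rule eq_vecI)
      fix j assume "j < dim_vec h"
      then have j: "j < m" using h cl(1) by auto
      have "(\<Sum>k\<in>I. [:c k:] * x k $ j) = (\<Sum>k\<in>{i, i'}. [:c k:] * x k $ j)"
        using ii I by (intro sum.mono_neutral_right) (auto simp: c_def)
      also have "\<dots> = x i $ j - x i' $ j" using ii by (simp add: c_def)
      also have "\<dots> = h $ j" using j xi by (simp add: h_def)
      finally show "vec m (\<lambda>j. \<Sum>k\<in>I. [:c k:] * x k $ j) $ j = h $ j" using j by simp
    qed (use h cl(1) in auto)
    then have "c i = 0" using indep h ii by auto
    then show False by (simp add: c_def)
  qed
  have "Q.lin_indpt (?h ` I)"
  proof (rule Q.finite_lin_indpt2)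
    show "finite (?h ` I)" using I by simp
    show "?h ` I \<subseteq> carrier (quot_space m M)" using I by (auto simp: quot_space_simps)
    fix a assume a: "a \<in> ?h ` I \<rightarrow> carrier (class_ring :: 'a ring)"
      and 0: "Q.lincomb a (?h ` I) = \<zero>\<^bsub>quot_space m M\<^esub>"
    have "Q.lincomb a (?h ` I)
      = finsum (quot_space m M) (\<lambda>i. smult (quot_space m M) (a (?h i)) (?h i)) I"
      unfolding Q.lincomb_def using inj I
      by (subst Q.finsum_reindex) (auto simp: quot_space_simps)
    then have "coset M (vec m (\<lambda>j. \<Sum>i\<in>I. [:a (?h i):] * x i $ j)) = coset M (0\<^sub>v m)"
      using 0 finsum_coset[OF I, where c = "\<lambda>i. a (?h i)"] by (simp add: quot_space_simps)
    then have "vec m (\<lambda>j. \<Sum>i\<in>I. [:a (?h i):] * x i $ j) \<in> M"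
      by (subst (asm) coset_eq_iff) auto
    from indep[OF this] show "\<forall>v\<in>?h ` I. a v = \<zero>\<^bsub>class_ring\<^esub>" by (simp add: class_ring_simps)
  qed
  moreover have "?h ` I \<subseteq> carrier (quot_space m M)" using I by (auto simp: quot_space_simps)
  ultimately have "card (?h ` I) \<le> Q.dim" using Q.li_le_dim(2)[OF fd] by blast
  then show ?thesis using card_image[OF inj] by (simp add: quot_dim_def)
qed

end

section \<open>Degree and norm bounds\<close>

text \<open>Stated by coefficients because \<open>K i = 0\<close> has to force
  \<open>x i = 0\<close>, which a condition on \<open>degree\<close> cannot express: the zero
  polynomial has degree 0 like every constant.\<close>

definition degs_below :: "nat \<Rightarrow> (nat \<Rightarrow> nat) \<Rightarrow> (nat \<Rightarrow> 'a::field poly) \<Rightarrow> bool" where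
  "degs_below m K x \<longleftrightarrow> (\<forall>i<m. \<forall>k\<ge>K i. coeff (x i) k = 0)"

lemma degs_below_degree:
  assumes "degs_below m K x" "i < m" shows "degree (x i) \<le> K i - 1"
  using assms by (intro degree_le) (auto simp: degs_below_def)

locale lattice =
  fixes C :: real and m :: nat and N :: "'a::field poly vec \<Rightarrow> real"
    and M :: "'a poly vec set" and bs as :: "'a poly vec list"
  assumes C: "C > 1" and m: "m \<ge> 1" and norm: "is_norm C m N" and M: "is_submodule m M"
    and len_bs: "length bs = m" and bs: "is_basis m (carrier_vec m) bs"
    and len_as: "length as = m" and as: "is_basis m M as"
begin

abbreviation "D \<equiv> max_deg m bs as"

lemmas closed = submodule_closed[OF M]
lemmas M_eq = basis_comb(1)[OF closed(1) as len_as]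
lemmas as_indep = basis_comb(2)[OF closed(1) as len_as]
lemmas bs_indep = basis_comb(2)[OF order_refl bs len_bs]

lemma bs_carrier: "i < m \<Longrightarrow> bs ! i \<in> carrier_vec m"
  using bs len_bs by (auto simp: is_basis_def)

lemma degree_le_D:
  assumes "i < m" "j < m"
  shows "degree (bs ! i $ j) \<le> D" "degree (as ! i $ j) \<le> D"
proof -
  have "{degree (x $ j) | x j. x \<in> set bs \<union> set as \<and> j < m}
    = (\<lambda>(x, j). degree (x $ j)) ` ((set bs \<union> set as) \<times> {..<m})" by auto
  then have f: "finite {degree (x $ j) | x j. x \<in> set bs \<union> set as \<and> j < m}" by simp
  have "bs ! i \<in> set bs" "as ! i \<in> set as" using assms len_bs len_as by auto
  then show "degree (bs ! i $ j) \<le> D" "degree (as ! i $ j) \<le> D"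
    unfolding max_deg_def using f assms by (auto intro!: Max_ge)
qed

text \<open>The input does not contain d, so the time analysis needs a bound in terms of
  \<open>m\<close> and \<open>D\<close>. Multiplication by \<open>p\<close> sends all of R^m into
  \<open>M\<close>, hence the monomials z^k e_i with k < \<open>degree p\<close> generate the
  quotient.\<close>

lemma quot_dim_bounds:
  "vectorspace.fin_dim class_ring (quot_space m M)" "quot_dim m M \<le> m * (m * D)"
proof -
  obtain p where p: "p \<noteq> 0" "degree p \<le> m * D" "\<And>v. v \<in> carrier_vec m \<Longrightarrow> p \<cdot>\<^sub>v v \<in> M"
    using full_rank_degree_bounds(1)[of m as D, OF as_indep degree_le_D(2)] unfolding M_eq by blast
  define I where "I = {..<m} \<times> {..<degree p}"
  define x :: "nat \<times> nat \<Rightarrow> 'a poly vec" where "x = (\<lambda>(i, k). monom 1 k \<cdot>\<^sub>v unit_vec m i)"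
  have gen: "\<exists>c. coset M v = coset M (vec m (\<lambda>j. \<Sum>i\<in>I. [:c i:] * x i $ j))"
    if v: "v \<in> carrier_vec m" for v
  proof
    \<comment> \<open>Coordinatewise remainder modulo \<open>p\<close>: the difference to
      \<open>v\<close> is \<open>p\<close> times a vector and so lies in \<open>M\<close>.\<close>
    define r where "r j = v $ j mod p" for j
    have r: "(\<Sum>k<degree p. monom (coeff (r j) k) k) = r j" for j
    proof (rule poly_eqI)
      fix k
      have "coeff (r j) k = 0" if "k \<ge> degree p"
        using that p(1) by (metis coeff_0 coeff_eq_0 degree_mod_less' le_trans not_le r_def)
      then show "coeff (\<Sum>k<degree p. monom (coeff (r j) k) k) k = coeff (r j) k"
        by (auto simp: coeff_sum coeff_monom)
    qed
    have eq: "vec m (\<lambda>j. \<Sum>i\<in>I. [:case i of (i, k) \<Rightarrow> coeff (r i) k:] * x i $ j) = vec m r"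
    proof (rule eq_vecI)
      fix j assume "j < dim_vec (vec m r)"
      then have j: "j < m" by simp
      have "(\<Sum>i\<in>I. [:case i of (i, k) \<Rightarrow> coeff (r i) k:] * x i $ j)
        = (\<Sum>i<m. \<Sum>k<degree p. if i = j then monom (coeff (r i) k) k else 0)"
        unfolding I_def sum.cartesian_product using j
        by (intro sum.cong refl) (auto simp: x_def smult_monom)
      also have "\<dots> = (\<Sum>i<m. if i = j then r i else 0)"
        by (intro sum.cong refl) (auto simp: r)
      also have "\<dots> = r j" using j by simp
      finally show "vec m (\<lambda>j. \<Sum>i\<in>I. [:case i of (i, k) \<Rightarrow> coeff (r i) k:] * x i $ j) $ j = vec m r $ j"
        using j by simp
    qed simp
    have "v - vec m r = p \<cdot>\<^sub>v vec m (\<lambda>j. v $ j div p)"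
      using v by (intro eq_vecI) (auto simp: r_def minus_mod_eq_mult_div)
    then have "v - vec m r \<in> M" using p(3) by simp
    then show "coset M v = coset M (vec m (\<lambda>j. \<Sum>i\<in>I. [:case i of (i, k) \<Rightarrow> coeff (r i) k:] * x i $ j))"
      unfolding eq using coset_eq_iff[OF M v] by simp
  qed
  have I: "finite I" "\<And>i. i \<in> I \<Longrightarrow> x i \<in> carrier_vec m" by (auto simp: I_def x_def)
  show "vectorspace.fin_dim class_ring (quot_space m M)" using quot_dim_le(1)[OF M I gen] .
  have "card I \<le> m * (m * D)" using p(2) by (simp add: I_def)
  then show "quot_dim m M \<le> m * (m * D)" using quot_dim_le(2)[OF M I gen] by simp
qed

text \<open>The sum counts the monomials z^k b_i with k < \<open>K i\<close>; the assumption says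
  that they are linearly independent over F modulo \<open>M\<close>.\<close>

lemma sum_le_quot_dim:
  assumes K: "\<And>x i. degs_below m K x \<Longrightarrow> comb m bs x \<in> M \<Longrightarrow> i < m \<Longrightarrow> x i = 0"
  shows "(\<Sum>i<m. K i) \<le> quot_dim m M"
proof -
  define I where "I = Sigma {..<m} (\<lambda>i. {..<K i})"
  define x where "x = (\<lambda>(i, k). monom 1 k \<cdot>\<^sub>v bs ! i)"
  have "card I \<le> quot_dim m M"
  proof (rule card_le_quot_dim[OF M quot_dim_bounds(1)])
    show "finite I" by (simp add: I_def)
    show "x i \<in> carrier_vec m" if "i \<in> I" for i using that bs_carrier by (auto simp: I_def x_def)
    fix c and ik assume in_M: "vec m (\<lambda>j. \<Sum>i\<in>I. [:c i:] * x i $ j) \<in> M" and ik: "ik \<in> I"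
    \<comment> \<open>Collecting the scalars that belong to one b_i into a polynomial turns a
      relation over F into one over F[z].\<close>
    define y where "y i = (\<Sum>k<K i. monom (c (i, k)) k)" for i
    have co: "coeff (y i) k = (if k < K i then c (i, k) else 0)" for i k
      by (simp add: y_def coeff_sum coeff_monom)
    have "vec m (\<lambda>j. \<Sum>i\<in>I. [:c i:] * x i $ j) = comb m bs y"
    proof (rule eq_vecI)
      fix j assume "j < dim_vec (comb m bs y)"
      then have j: "j < m" by (simp add: comb_def)
      have "(\<Sum>i\<in>I. [:c i:] * x i $ j) = (\<Sum>i<m. \<Sum>k<K i. [:c (i, k):] * x (i, k) $ j)"
        unfolding I_def by (subst sum.Sigma) (auto intro!: sum.cong)
      also have "\<dots> = (\<Sum>i<m. y i * bs ! i $ j)"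
        unfolding y_def sum_distrib_right
      proof (intro sum.cong refl)
        fix i k assume "i \<in> {..<m}"
        then have "dim_vec (bs ! i) = m" using bs_carrier by auto
        then show "[:c (i, k):] * x (i, k) $ j = monom (c (i, k)) k * bs ! i $ j"
          using j by (simp add: x_def smult_monom flip: mult_smult_left)
      qed
      finally show "vec m (\<lambda>j. \<Sum>i\<in>I. [:c i:] * x i $ j) $ j = comb m bs y $ j" using j by simp
    qed (simp add: comb_def)
    then have "comb m bs y \<in> M" using in_M by simp
    moreover have "degs_below m K y" by (simp add: degs_below_def co)
    ultimately have "y (fst ik) = 0" using K ik by (auto simp: I_def)
    then show "c ik = 0" using co[of "fst ik" "snd ik"] ik by (auto simp: I_def)
  qed
  then show ?thesis by (simp add: I_def)
qed

section \<open>Estimates for norms and coordinates\<close>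

lemma norm_nonneg: "v \<in> carrier_vec m \<Longrightarrow> N v \<ge> 0"
  and norm_zero: "N (0\<^sub>v m) = 0"
  and norm_add: "v \<in> carrier_vec m \<Longrightarrow> w \<in> carrier_vec m \<Longrightarrow> N (v + w) \<le> max (N v) (N w)"
  and norm_smult: "v \<in> carrier_vec m \<Longrightarrow> N (r \<cdot>\<^sub>v v) = pabs C r * N v"
  using norm by (auto simp: is_norm_def)

text \<open>The ultrametric inequality gives a maximum over the terms instead of a sum. For
  \<open>K i = 0\<close> the term vanishes; the guard \<open>K i > 0\<close> leaves this case out
  because \<open>K i - 1\<close> would truncate.\<close>

lemma norm_comb_le:
  assumes x: "degs_below m K x" and t: "t \<ge> 0"
    and K: "\<And>i. i < m \<Longrightarrow> K i > 0 \<Longrightarrow> C ^ (K i - 1) * N (bs ! i) \<le> t"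
  shows "N (comb m bs x) \<le> t"
proof -
  define S where "S n = vec m (\<lambda>j. \<Sum>i<n. x i * bs ! i $ j)" for n
  have "N (S n) \<le> t" if "n \<le> m" for n
    using that
  proof (induction n)
    case 0
    have "S 0 = 0\<^sub>v m" by (auto simp: S_def)
    then show ?case using t norm_zero by simp
  next
    case (Suc n)
    have bc: "bs ! n \<in> carrier_vec m" using bs_carrier Suc.prems by simp
    have "S (Suc n) = S n + x n \<cdot>\<^sub>v bs ! n"
      using bc by (intro eq_vecI) (auto simp: S_def)
    then have "N (S (Suc n)) \<le> max (N (S n)) (N (x n \<cdot>\<^sub>v bs ! n))"
      using bc norm_add[of "S n"] by (simp add: S_def)
    moreover have "N (x n \<cdot>\<^sub>v bs ! n) \<le> t"
    proof (cases "x n = 0")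
      case True
      then show ?thesis using t bc norm_smult[OF bc] by (simp add: pabs_def)
    next
      case False
      then have "K n > 0" using x Suc.prems leading_coeff_neq_0[OF False]
        by (cases "K n") (auto simp: degs_below_def)
      have "C ^ degree (x n) \<le> C ^ (K n - 1)"
        using degs_below_degree[OF x] Suc.prems C by (intro power_increasing) auto
      then have "N (x n \<cdot>\<^sub>v bs ! n) \<le> C ^ (K n - 1) * N (bs ! n)"
        using norm_smult[OF bc] False norm_nonneg[OF bc] by (simp add: pabs_def mult_right_mono)
      also have "\<dots> \<le> t" using K \<open>K n > 0\<close> Suc.prems by simp
      finally show ?thesis .
    qed
    ultimately show ?case using Suc by simp
  qed
  then show ?thesis by (simp add: S_def comb_def)
qed

lemma degree_comb_le:
  assumes "\<And>i. i < m \<Longrightarrow> degree (x i) \<le> t" "j < m"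
  shows "degree (comb m bs x $ j) \<le> t + D"
  unfolding comb_index[OF assms(2)]
proof (rule degree_sum_le)
  fix i assume "i \<in> {..<m}"
  then show "degree (x i * bs ! i $ j) \<le> t + D"
    using assms degree_le_D(1) by (meson add_mono degree_mult_le le_trans lessThan_iff)
qed simp

text \<open>Origin of the number of shifts of the basis of \<open>M\<close> that must be inserted:
  exponents up to \<open>t\<close> give entries of degree at most \<open>t + D\<close>, Cramer's
  rule adds \<open>m * D\<close>, and the final 1 makes the bound strict.\<close>

lemma comb_eq_degs_below:
  assumes "degs_below m K x" "\<And>i. i < m \<Longrightarrow> K i \<le> t + 1" "comb m as y = comb m bs x"
  shows "degs_below m (\<lambda>_. m * D + t + D + 1) y"
proof -
  have d: "degree (x i) \<le> t" if "i < m" for i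
    using degs_below_degree[OF assms(1) that] assms(2)[OF that] by simp
  have "degree (comb m as y $ j) \<le> t + D" if "j < m" for j
    unfolding assms(3) using d that by (rule degree_comb_le)
  then have "degree (y i) \<le> m * D + (t + D)" if "i < m" for i
    using full_rank_degree_bounds(2)[of m as D, OF as_indep degree_le_D(2) that] by blast
  then show ?thesis unfolding degs_below_def by (fastforce intro!: coeff_eq_0)
qed

lemma threshold_le:
  assumes t: "t \<ge> 0" and K: "\<And>i. i < m \<Longrightarrow> t \<le> C ^ K i * N (bs ! i)"
    and d: "(\<Sum>i<m. K i) \<le> d"
  shows "t \<le> root m (\<Prod>i<m. N (bs ! i)) * C powr (real d / real m)"
proof -
  have nn: "(\<Prod>i<m. N (bs ! i)) \<ge> 0" using bs_carrier norm_nonneg by (intro prod_nonneg) auto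
  have "t ^ m = (\<Prod>i<m. t)" by simp
  also have "\<dots> \<le> (\<Prod>i<m. C ^ K i * N (bs ! i))" using t K by (intro prod_mono) auto
  also have "\<dots> = C ^ (\<Sum>i<m. K i) * (\<Prod>i<m. N (bs ! i))" by (simp add: prod.distrib power_sum)
  also have "\<dots> \<le> C ^ d * (\<Prod>i<m. N (bs ! i))"
    using C d nn by (intro mult_right_mono power_increasing) auto
  finally have "root m (t ^ m) \<le> root m (C ^ d * (\<Prod>i<m. N (bs ! i)))"
    using m by (intro real_root_le_mono) auto
  moreover have "root m (t ^ m) = t" using m t by (simp add: real_root_power_cancel)
  moreover have "root m (C ^ d) = C powr (real d / real m)"
    using m C by (simp add: root_powr_inverse powr_powr flip: powr_realpow)
  ultimately show ?thesis by (simp add: real_root_mult mult.commute)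
qed

end

section \<open>Total correctness with time bounds\<close>

text \<open>Time is only bounded from above, so costs can be rounded up to convenient constants
  throughout.\<close>

definition runs :: "com \<Rightarrow> 'a::field memory \<Rightarrow> nat \<Rightarrow> ('a memory \<Rightarrow> bool) \<Rightarrow> bool" where
  "runs c s T Q \<longleftrightarrow> (\<exists>t s'. big_step c s t s' \<and> t \<le> T \<and> Q s')"

lemma runs_mono: "runs c s T Q \<Longrightarrow> T \<le> T' \<Longrightarrow> (\<And>s'. Q s' \<Longrightarrow> Q' s') \<Longrightarrow> runs c s T' Q'"
  unfolding runs_def by (meson le_trans)

lemma runs_Skip: "1 \<le> T \<Longrightarrow> Q s \<Longrightarrow> runs Skip s T Q"
  unfolding runs_def using big_step.Skip by blast

lemma runs_NAssign:
  "1 + sum_list (map ncost is) + ncost e \<le> T \<Longrightarrow>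
   Q (s\<lparr>nmem := (nmem s)((x, map (\<lambda>i. nval i s) is) := nval e s)\<rparr>) \<Longrightarrow> runs (NAssign x is e) s T Q"
  unfolding runs_def using big_step.NAssign by blast

lemma runs_FAssign:
  "1 + sum_list (map ncost is) + fcost e \<le> T \<Longrightarrow>
   Q (s\<lparr>fmem := (fmem s)((x, map (\<lambda>i. nval i s) is) := fval e s)\<rparr>) \<Longrightarrow> runs (FAssign x is e) s T Q"
  unfolding runs_def using big_step.FAssign by blast

lemma runs_RAssign:
  "1 + sum_list (map ncost is) + rcost e \<le> T \<Longrightarrow>
   Q (s\<lparr>rmem := (rmem s)((x, map (\<lambda>i. nval i s) is) := rval e s)\<rparr>) \<Longrightarrow> runs (RAssign x is e) s T Q"
  unfolding runs_def using big_step.RAssign by blast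

lemma runs_Seq:
  assumes "runs c s T Q" "\<And>s'. Q s' \<Longrightarrow> runs c' s' T' Q'" "T + T' \<le> U"
  shows "runs (Seq c c') s U Q'"
proof -
  obtain t s' where 1: "big_step c s t s'" "t \<le> T" "Q s'" using assms(1) by (auto simp: runs_def)
  obtain t' s'' where 2: "big_step c' s' t' s''" "t' \<le> T'" "Q' s''"
    using assms(2)[OF 1(3)] by (auto simp: runs_def)
  have "t + t' \<le> U" using 1(2) 2(2) assms(3) by simp
  then show ?thesis using big_step.Seq[OF 1(1) 2(1)] 2(3) by (auto simp: runs_def)
qed

lemma runs_Seq_NAssign:
  assumes "1 + sum_list (map ncost is) + ncost e \<le> T"
    "runs c (s\<lparr>nmem := (nmem s)((x, map (\<lambda>i. nval i s) is) := nval e s)\<rparr>)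
      (T - (1 + sum_list (map ncost is) + ncost e)) Q"
  shows "runs (Seq (NAssign x is e) c) s T Q"
  by (rule runs_Seq[OF runs_NAssign[OF order_refl, where Q = "\<lambda>s'. s' = s\<lparr>nmem := (nmem s)((x, map (\<lambda>i. nval i s) is) := nval e s)\<rparr>"]])
    (use assms in auto)

lemma runs_If:
  assumes "bcost b \<le> T" "bval b s \<Longrightarrow> runs c s (T - bcost b) Q"
    "\<not> bval b s \<Longrightarrow> runs c' s (T - bcost b) Q"
  shows "runs (IfThen b c c') s T Q"
proof (cases "bval b s")
  case True
  with assms(2) obtain t s' where "big_step c s t s'" "t \<le> T - bcost b" "Q s'"
    by (auto simp: runs_def)
  then show ?thesis using big_step.IfTrue[OF True] assms(1) unfolding runs_def
    by (metis add.commute le_diff_conv2)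
next
  case False
  with assms(3) obtain t s' where "big_step c' s t s'" "t \<le> T - bcost b" "Q s'"
    by (auto simp: runs_def)
  then show ?thesis using big_step.IfFalse[OF False] assms(1) unfolding runs_def
    by (metis add.commute le_diff_conv2)
qed

text \<open>The measure bounds the number of rounds; the summand outside the product pays for the
  final failing test.\<close>

lemma runs_While_measure:
  assumes "I s" "\<mu> s \<le> (n :: nat)"
    and step: "\<And>s. I s \<Longrightarrow> bval b s \<Longrightarrow> runs c s T (\<lambda>s'. I s' \<and> \<mu> s' < \<mu> s)"
  shows "runs (While b c) s (n * (bcost b + T) + bcost b) (\<lambda>s'. I s' \<and> \<not> bval b s')"
  using assms(1,2)
proof (induction n arbitrary: s)
  case 0
  \<comment> \<open>At measure 0 a further round would have to decrease the measure, so the guard is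
    false.\<close>
  have "\<not> bval b s" using step[OF 0(1)] 0(2) by (auto simp: runs_def)
  then show ?case using big_step.WhileFalse[of b s c] 0 by (auto simp: runs_def)
next
  case (Suc n)
  show ?case
  proof (cases "bval b s")
    case True
    from step[OF Suc.prems(1) True] obtain t s' where
      1: "big_step c s t s'" "t \<le> T" "I s'" "\<mu> s' < \<mu> s" by (auto simp: runs_def)
    from Suc.IH[OF 1(3)] 1(4) Suc.prems(2) obtain t' s'' where
      2: "big_step (While b c) s' t' s''" "t' \<le> n * (bcost b + T) + bcost b" "I s''" "\<not> bval b s''"
      by (auto simp: runs_def)
    have "bcost b + t + t' \<le> Suc n * (bcost b + T) + bcost b" using 1 2 by simp
    then show ?thesis using big_step.WhileTrue[OF True 1(1) 2(1)] 2(3,4) unfolding runs_def by blast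
  next
    case False
    have "bcost b \<le> Suc n * (bcost b + T) + bcost b" by simp
    then show ?thesis using big_step.WhileFalse[OF False, of c] Suc.prems(1) False
      unfolding runs_def by blast
  qed
qed

section \<open>Counting loops, iteration over the cells of a vector, frame conditions\<close>

definition setn :: "string \<Rightarrow> nat \<Rightarrow> 'a memory \<Rightarrow> 'a memory" where
  "setn x v s = s\<lparr>nmem := (nmem s)((x, []) := v)\<rparr>"

lemma setn_simps [simp]:
  "nmem (setn x v s) l = (if l = (x, []) then v else nmem s l)"
  "fmem (setn x v s) = fmem s" "rmem (setn x v s) = rmem s"
  by (simp_all add: setn_def)

definition For :: "string \<Rightarrow> nexp \<Rightarrow> com \<Rightarrow> com" where
  "For x e c = Seq (NAssign x [] (NConst 0))
     (While (NLess (NRef x []) e) (Seq c (NAssign x [] (NAdd (NRef x []) (NConst 1)))))"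

text \<open>The bound \<open>e\<close> is evaluated anew in every round, so the invariant must fix
  its value. The constants 10 cover the initial assignment, the tests and the increment, given
  \<open>ncost e \<le> 3\<close>.\<close>

lemma runs_For:
  assumes I0: "I 0 (setn x 0 s)"
    and e: "\<And>i s. I i s \<Longrightarrow> nval e s = n"
    and step: "\<And>i s. I i s \<Longrightarrow> i < n \<Longrightarrow> nmem s (x, []) = i \<Longrightarrow>
      runs c s T (\<lambda>s'. nmem s' (x, []) = i \<and> I (Suc i) (setn x (Suc i) s'))"
    and cost: "ncost e \<le> 3"
  shows "runs (For x e c) s (n * (T + 10) + 10) (I n)"
proof -
  let ?J = "\<lambda>s. nmem s (x, []) \<le> n \<and> I (nmem s (x, [])) s"
  let ?b = "NLess (NRef x []) e"
  have "runs (While ?b (Seq c (NAssign x [] (NAdd (NRef x []) (NConst 1))))) s'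
    (n * (bcost ?b + (T + 4)) + bcost ?b) (\<lambda>s'. ?J s' \<and> \<not> bval ?b s')"
    if "I 0 s'" "nmem s' (x, []) = 0" for s'
  proof (rule runs_While_measure[where \<mu> = "\<lambda>s. n - nmem s (x, [])"])
    show "?J s'" using that by simp
    show "n - nmem s' (x, []) \<le> n" by simp
    fix s assume J: "?J s" and b: "bval ?b s"
    then have lt: "nmem s (x, []) < n" using e[OF conjunct2[OF J]] by simp
    show "runs (Seq c (NAssign x [] (NAdd (NRef x []) (NConst 1)))) s (T + 4)
      (\<lambda>s'. ?J s' \<and> n - nmem s' (x, []) < n - nmem s (x, []))"
    proof (rule runs_Seq[OF step[OF conjunct2[OF J] lt refl]])
      fix s' assume s': "nmem s' (x, []) = nmem s (x, []) \<and>
        I (Suc (nmem s (x, []))) (setn x (Suc (nmem s (x, []))) s')"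
      show "runs (NAssign x [] (NAdd (NRef x []) (NConst 1))) s' 4
        (\<lambda>s'. ?J s' \<and> n - nmem s' (x, []) < n - nmem s (x, []))"
        by (rule runs_NAssign) (use s' lt in \<open>auto simp: setn_def\<close>)
    qed simp
  qed
  note loop = this
  have w: "runs (While ?b (Seq c (NAssign x [] (NAdd (NRef x []) (NConst 1))))) s'
    (n * (T + 10) + 8) (I n)" if "I 0 s'" "nmem s' (x, []) = 0" for s'
  proof (rule runs_mono[OF loop[OF that]])
    have "bcost ?b + (T + 4) \<le> T + 10" "bcost ?b \<le> 8" using cost by simp_all
    then show "n * (bcost ?b + (T + 4)) + bcost ?b \<le> n * (T + 10) + 8"
      by (rule add_mono[OF mult_le_mono2])
    show "I n s'" if s': "?J s' \<and> \<not> bval ?b s'" for s'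
    proof -
      have "nval e s' = n" using s' e by blast
      then have "nmem s' (x, []) = n" using s' by simp
      then show ?thesis using s' by simp
    qed
  qed
  show ?thesis unfolding For_def
  proof (rule runs_Seq[where Q = "\<lambda>s. I 0 s \<and> nmem s (x, []) = 0" and T = 2])
    show "runs (NAssign x [] (NConst 0)) s 2 (\<lambda>s. I 0 s \<and> nmem s (x, []) = 0)"
      by (rule runs_NAssign) (use I0 in \<open>auto simp: setn_def\<close>)
  qed (use w in auto)
qed

abbreviation var :: "string \<Rightarrow> nexp" where "var x \<equiv> NRef x []"

text \<open>A vector of the elimination is a pair \<open>(u, w)\<close> of elements of \<open>R^m\<close> of degree at most \<open>e\<close>, stored as one
  array with indices \<open>j < 2 * m\<close>, \<open>k \<le> e\<close>: the block \<open>j < m\<close> holds \<open>u\<close> and the block \<open>m \<le> j\<close> holds \<open>w\<close>. Pivots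
  are only taken in \<open>w\<close>; the part \<open>u\<close> records which combination of the \<open>z\<^sup>k b\<^sub>i\<close> is congruent to \<open>w\<close> modulo \<open>M\<close>.\<close>

definition JK :: "com \<Rightarrow> com" where
  "JK c = For ''j'' (NAdd (var ''m'') (var ''m'')) (For ''k'' (NAdd (var ''e'') (NConst 1)) c)"

definition JK_time :: "nat \<Rightarrow> nat \<Rightarrow> nat \<Rightarrow> nat" where
  "JK_time m e T = 2 * m * (Suc e * (T + 10) + 20) + 10"

text \<open>Indexing the invariant by the set of processed cells hides the two counters. The
  condition \<open>(j, k) \<notin> P\<close> tells an in-place update such as \<open>row_op\<close>
  that its cell still holds the old value.\<close>

lemma runs_JK:
  assumes I0: "I {} s"
    and j: "\<And>P s v. I P s \<Longrightarrow> I P (setn ''j'' v s)"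
    and k: "\<And>P s v. I P s \<Longrightarrow> I P (setn ''k'' v s)"
    and sz: "\<And>P s. I P s \<Longrightarrow> nmem s (''m'', []) = m \<and> nmem s (''e'', []) = e"
    and step: "\<And>P s j k. I P s \<Longrightarrow> j < 2 * m \<Longrightarrow> k \<le> e \<Longrightarrow> nmem s (''j'', []) = j \<Longrightarrow>
      nmem s (''k'', []) = k \<Longrightarrow> (j, k) \<notin> P \<Longrightarrow>
      runs c s T (\<lambda>s'. nmem s' (''j'', []) = j \<and> nmem s' (''k'', []) = k \<and> I (insert (j, k) P) s')"
  shows "runs (JK c) s (JK_time m e T) (I ({..<2 * m} \<times> {..e}))"
proof -
  have "runs (JK c) s (2 * m * ((Suc e * (T + 10) + 10) + 10) + 10) (I ({..<2 * m} \<times> {..e}))"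
    unfolding JK_def
  proof (rule runs_For)
    show "I ({..<0} \<times> {..e}) (setn ''j'' 0 s)" using I0 j by simp
    show "nval (NAdd (var ''m'') (var ''m'')) s = 2 * m" if "I ({..<i} \<times> {..e}) s" for i s
      using sz[OF that] by simp
    fix a s assume a: "I ({..<a} \<times> {..e}) s" "a < 2 * m" "nmem s (''j'', []) = a"
    show "runs (For ''k'' (NAdd (var ''e'') (NConst 1)) c) s (Suc e * (T + 10) + 10)
      (\<lambda>s'. nmem s' (''j'', []) = a \<and> I ({..<Suc a} \<times> {..e}) (setn ''j'' (Suc a) s'))"
    proof (rule runs_mono)
      show "runs (For ''k'' (NAdd (var ''e'') (NConst 1)) c) s (Suc e * (T + 10) + 10)
        (\<lambda>s'. nmem s' (''j'', []) = a \<and> I ({..<a} \<times> {..e} \<union> {a} \<times> {..<Suc e}) s')"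
      proof (rule runs_For)
        show "nmem (setn ''k'' 0 s) (''j'', []) = a \<and>
          I ({..<a} \<times> {..e} \<union> {a} \<times> {..<0}) (setn ''k'' 0 s)" using a k by simp
        show "nval (NAdd (var ''e'') (NConst 1)) s = Suc e"
          if "nmem s (''j'', []) = a \<and> I ({..<a} \<times> {..e} \<union> {a} \<times> {..<i}) s" for i s
          using sz that by force
        fix b s assume b: "nmem s (''j'', []) = a \<and> I ({..<a} \<times> {..e} \<union> {a} \<times> {..<b}) s"
          "b < Suc e" "nmem s (''k'', []) = b"
        have eq: "insert (a, b) ({..<a} \<times> {..e} \<union> {a} \<times> {..<b}) = {..<a} \<times> {..e} \<union> {a} \<times> {..<Suc b}"
          by auto
        show "runs c s T (\<lambda>s'. nmem s' (''k'', []) = b \<and> nmem (setn ''k'' (Suc b) s') (''j'', []) = a \<and>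
          I ({..<a} \<times> {..e} \<union> {a} \<times> {..<Suc b}) (setn ''k'' (Suc b) s'))"
          by (rule runs_mono, rule step[of "{..<a} \<times> {..e} \<union> {a} \<times> {..<b}" s a b])
            (use a b k eq in auto)
      qed simp
      have "{..<a} \<times> {..e} \<union> {a} \<times> {..<Suc e} = {..<Suc a} \<times> {..e}" by auto
      then show "nmem s' (''j'', []) = a \<and> I ({..<Suc a} \<times> {..e}) (setn ''j'' (Suc a) s')"
        if "nmem s' (''j'', []) = a \<and> I ({..<a} \<times> {..e} \<union> {a} \<times> {..<Suc e}) s'" for s'
        using that j by simp
    qed simp
  qed simp
  then show ?thesis by (simp add: JK_time_def)
qed

text \<open>Real cells are kept fixed altogether: they are written only by the
  \<open>RAssign\<close> in \<open>greedy_step\<close>, whose effect is described explicitly instead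
  of by \<open>frame\<close>.\<close>

definition frame :: "string set \<Rightarrow> string set \<Rightarrow> 'a memory \<Rightarrow> 'a memory \<Rightarrow> bool" where
  "frame X Y s s' \<longleftrightarrow> (\<forall>x is. x \<notin> X \<longrightarrow> nmem s' (x, is) = nmem s (x, is)) \<and>
     (\<forall>y is. y \<notin> Y \<longrightarrow> fmem s' (y, is) = fmem s (y, is)) \<and> rmem s' = rmem s"

lemma frame_trans:
  assumes "frame X Y s s'" "frame X' Y' s' s''" "X \<union> X' \<subseteq> X''" "Y \<union> Y' \<subseteq> Y''"
  shows "frame X'' Y'' s s''"
proof -
  have "x \<notin> X \<and> x \<notin> X'" if "x \<notin> X''" for x using that assms(3) by blast
  moreover have "y \<notin> Y \<and> y \<notin> Y'" if "y \<notin> Y''" for y using that assms(4) by blast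
  ultimately show ?thesis using assms(1,2) by (simp add: frame_def)
qed

text \<open>The test \<open>k < s\<close> is needed because subtraction truncates.\<close>

definition load :: "string \<Rightarrow> string \<Rightarrow> com" where
  "load y x = JK (IfThen (NLess (var ''k'') (var ''s''))
     (FAssign ''v'' [var ''j'', var ''k''] FZero)
     (IfThen (NLess (var ''j'') (var ''m''))
       (FAssign ''v'' [var ''j'', var ''k''] (FRef y [var ''i'', var ''j'', NSub (var ''k'') (var ''s'')]))
       (FAssign ''v'' [var ''j'', var ''k'']
         (FRef x [var ''i'', NSub (var ''j'') (var ''m''), NSub (var ''k'') (var ''s'')]))))"

lemma runs_load:
  assumes "x \<noteq> ''v''" "y \<noteq> ''v''" "nmem s (''m'', []) = m" "nmem s (''e'', []) = e"
    "nmem s (''s'', []) = d" "nmem s (''i'', []) = i"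
  shows "runs (load y x) s (JK_time m e 20) (\<lambda>s'. frame {''j'', ''k''} {''v''} s s' \<and>
    (\<forall>j<2*m. \<forall>k\<le>e. fmem s' (''v'', [j, k]) = (if k < d then 0
       else if j < m then fmem s (y, [i, j, k - d]) else fmem s (x, [i, j - m, k - d]))))"
proof -
  define val where "val = (\<lambda>(j, k). (if k < d then 0
       else if j < m then fmem s (y, [i, j, k - d]) else fmem s (x, [i, j - m, k - d])))"
  have "runs (load y x) s (JK_time m e 20) (\<lambda>s'. frame {''j'', ''k''} {''v''} s s' \<and>
    (\<forall>(j, k)\<in>{..<2*m} \<times> {..e}. fmem s' (''v'', [j, k]) = val (j, k)))"
    unfolding load_def
  proof (rule runs_JK)
    fix P s' j k
    assume I: "frame {''j'', ''k''} {''v''} s s' \<and> (\<forall>(j, k)\<in>P. fmem s' (''v'', [j, k]) = val (j, k))"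
      and jk: "nmem s' (''j'', []) = j" "nmem s' (''k'', []) = k"
    have n: "nmem s' (''m'', []) = m" "nmem s' (''s'', []) = d" "nmem s' (''i'', []) = i"
      using I assms by (auto simp: frame_def)
    have f: "fmem s' (y, l) = fmem s (y, l)" "fmem s' (x, l) = fmem s (x, l)" for l
      using I assms by (auto simp: frame_def)
    show "runs (IfThen (NLess (var ''k'') (var ''s''))
     (FAssign ''v'' [var ''j'', var ''k''] FZero)
     (IfThen (NLess (var ''j'') (var ''m''))
       (FAssign ''v'' [var ''j'', var ''k''] (FRef y [var ''i'', var ''j'', NSub (var ''k'') (var ''s'')]))
       (FAssign ''v'' [var ''j'', var ''k'']
         (FRef x [var ''i'', NSub (var ''j'') (var ''m''), NSub (var ''k'') (var ''s'')])))) s' 20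
      (\<lambda>s'. nmem s' (''j'', []) = j \<and> nmem s' (''k'', []) = k \<and> frame {''j'', ''k''} {''v''} s s' \<and>
        (\<forall>(j, k)\<in>insert (j, k) P. fmem s' (''v'', [j, k]) = val (j, k)))"
      by (intro runs_If runs_FAssign) (use I jk n f in \<open>auto simp: val_def frame_def\<close>)
  qed (use assms in \<open>auto simp: frame_def\<close>)
  then show ?thesis by (rule runs_mono) (auto simp: val_def)
qed

definition row_op :: com where
  "row_op = JK (FAssign ''v'' [var ''j'', var ''k'']
     (FSub (FRef ''v'' [var ''j'', var ''k''])
       (FMul (FRef ''x'' []) (FRef ''g'' [var ''r'', var ''j'', var ''k'']))))"

lemma runs_row_op:
  assumes "nmem s (''m'', []) = m" "nmem s (''e'', []) = e" "nmem s (''r'', []) = r"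
  shows "runs row_op s (JK_time m e 20) (\<lambda>s'. frame {''j'', ''k''} {''v''} s s' \<and>
    (\<forall>j<2*m. \<forall>k\<le>e. fmem s' (''v'', [j, k])
       = fmem s (''v'', [j, k]) - fmem s (''x'', []) * fmem s (''g'', [r, j, k])))"
proof -
  have "runs row_op s (JK_time m e 20) (\<lambda>s'. frame {''j'', ''k''} {''v''} s s' \<and>
    (\<forall>j k. fmem s' (''v'', [j, k]) = (if (j, k) \<in> {..<2*m} \<times> {..e}
       then fmem s (''v'', [j, k]) - fmem s (''x'', []) * fmem s (''g'', [r, j, k])
       else fmem s (''v'', [j, k]))))"
    unfolding row_op_def
  proof (rule runs_JK)
    fix P s' j k
    assume I: "frame {''j'', ''k''} {''v''} s s' \<and>
      (\<forall>j k. fmem s' (''v'', [j, k]) = (if (j, k) \<in> P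
        then fmem s (''v'', [j, k]) - fmem s (''x'', []) * fmem s (''g'', [r, j, k])
        else fmem s (''v'', [j, k])))"
      and jk: "nmem s' (''j'', []) = j" "nmem s' (''k'', []) = k" "(j, k) \<notin> P"
    have n: "nmem s' (''r'', []) = r" using I assms by (auto simp: frame_def)
    have f: "fmem s' (''x'', l) = fmem s (''x'', l)" "fmem s' (''g'', l) = fmem s (''g'', l)" for l
      using I by (auto simp: frame_def)
    show "runs (FAssign ''v'' [var ''j'', var ''k'']
     (FSub (FRef ''v'' [var ''j'', var ''k''])
       (FMul (FRef ''x'' []) (FRef ''g'' [var ''r'', var ''j'', var ''k''])))) s' 20
      (\<lambda>s'. nmem s' (''j'', []) = j \<and> nmem s' (''k'', []) = k \<and> frame {''j'', ''k''} {''v''} s s' \<and>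
        (\<forall>j' k'. fmem s' (''v'', [j', k']) = (if (j', k') \<in> insert (j, k) P
        then fmem s (''v'', [j', k']) - fmem s (''x'', []) * fmem s (''g'', [r, j', k'])
        else fmem s (''v'', [j', k']))))"
      by (rule runs_FAssign) (use I jk n f in \<open>auto simp: frame_def\<close>)
  qed (use assms in \<open>auto simp: frame_def\<close>)
  then show ?thesis by (rule runs_mono) auto
qed

section \<open>Gaussian elimination\<close>

abbreviation "cnt s \<equiv> nmem s (''c'', [])"
abbreviation "entry s r j k \<equiv> fmem s (''g'', [r, j, k])"
abbreviation "cur s j k \<equiv> fmem s (''v'', [j, k])"
abbreviation "pj s r \<equiv> nmem s (''pj'', [r])"
abbreviation "pk s r \<equiv> nmem s (''pk'', [r])"

text \<open>Triangular but not fully reduced: a row may be nonzero at the pivots of later rows. This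
  way an insertion never has to change the rows already stored.\<close>

definition echelon :: "nat \<Rightarrow> nat \<Rightarrow> 'a::field memory \<Rightarrow> bool" where
  "echelon m e s \<longleftrightarrow> (\<forall>r<cnt s. m \<le> pj s r \<and> pj s r < 2 * m \<and> pk s r \<le> e \<and>
     entry s r (pj s r) (pk s r) \<noteq> 0 \<and>
     (\<forall>r'<cnt s. r < r' \<longrightarrow> entry s r' (pj s r) (pk s r) = 0))"

text \<open>The quotient is saved in \<open>x\<close> first because \<open>row_op\<close> overwrites
  the pivot entry of \<open>v\<close> on its way.\<close>

definition reduce :: com where
  "reduce = For ''r'' (var ''c'')
     (Seq (FAssign ''x'' [] (FDiv (FRef ''v'' [NRef ''pj'' [var ''r''], NRef ''pk'' [var ''r'']])
        (FRef ''g'' [var ''r'', NRef ''pj'' [var ''r''], NRef ''pk'' [var ''r'']])))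
      row_op)"

definition reduce_time :: "nat \<Rightarrow> nat \<Rightarrow> nat \<Rightarrow> nat" where
  "reduce_time m e R = R * (JK_time m e 20 + 30) + 10"

text \<open>Rows are used in the order of their insertion. Each one vanishes at the pivots of its
  predecessors, so clearing its own pivot does not disturb the zeros already produced.\<close>

lemma runs_reduce:
  assumes m: "nmem s (''m'', []) = m" and e: "nmem s (''e'', []) = e" and ech: "echelon m e s"
    and R: "cnt s \<le> R"
  shows "runs reduce s (reduce_time m e R) (\<lambda>s'. frame {''j'', ''k'', ''r''} {''v'', ''x''} s s' \<and>
    (\<exists>c. \<forall>j<2*m. \<forall>k\<le>e. cur s' j k = cur s j k - (\<Sum>r<cnt s. c r * entry s r j k)) \<and>
    (\<forall>r<cnt s. cur s' (pj s r) (pk s r) = 0))"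
proof -
  let ?F = "frame {''j'', ''k'', ''r''} {''v'', ''x''} s"
  let ?I = "\<lambda>n s'. ?F s' \<and>
    (\<exists>c. \<forall>j<2*m. \<forall>k\<le>e. cur s' j k = cur s j k - (\<Sum>r<n. c r * entry s r j k)) \<and>
    (\<forall>r<n. cur s' (pj s r) (pk s r) = 0)"
  have "runs reduce s (cnt s * ((JK_time m e 20 + 20) + 10) + 10) (?I (cnt s))"
    unfolding reduce_def
  proof (rule runs_For)
    show "?I 0 (setn ''r'' 0 s)" by (auto simp: frame_def)
    show "nval (var ''c'') s' = cnt s" if "?I i s'" for i s' using that by (auto simp: frame_def)
    fix i s' assume I: "?I i s'" and i: "i < cnt s" and r: "nmem s' (''r'', []) = i"
    have fr: "?F s'" using I by blast
    have n: "nmem s' (''m'', []) = m" "nmem s' (''e'', []) = e" "pj s' i = pj s i" "pk s' i = pk s i"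
      "\<And>j k. entry s' i j k = entry s i j k"
      using fr m e by (auto simp: frame_def)
    have piv: "pj s i < 2 * m" "pk s i \<le> e" "entry s i (pj s i) (pk s i) \<noteq> 0"
      "\<And>r. r < i \<Longrightarrow> entry s i (pj s r) (pk s r) = 0"
      "\<And>r. r < i \<Longrightarrow> pj s r < 2 * m \<and> pk s r \<le> e"
      using ech i unfolding echelon_def by auto
    obtain c where c: "\<And>j k. j < 2*m \<Longrightarrow> k \<le> e \<Longrightarrow> cur s' j k = cur s j k - (\<Sum>r<i. c r * entry s r j k)"
      using I by blast
    define x where "x = cur s' (pj s i) (pk s i) / entry s i (pj s i) (pk s i)"
    show "runs (Seq (FAssign ''x'' [] (FDiv (FRef ''v'' [NRef ''pj'' [var ''r''], NRef ''pk'' [var ''r'']])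
        (FRef ''g'' [var ''r'', NRef ''pj'' [var ''r''], NRef ''pk'' [var ''r'']])))
      row_op) s' (JK_time m e 20 + 20)
      (\<lambda>s'. nmem s' (''r'', []) = i \<and> ?I (Suc i) (setn ''r'' (Suc i) s'))"
    proof (rule runs_Seq)
      show "runs (FAssign ''x'' [] (FDiv (FRef ''v'' [NRef ''pj'' [var ''r''], NRef ''pk'' [var ''r'']])
        (FRef ''g'' [var ''r'', NRef ''pj'' [var ''r''], NRef ''pk'' [var ''r'']]))) s' 20
        (\<lambda>s''. s'' = s'\<lparr>fmem := (fmem s')((''x'', []) := x)\<rparr>)"
        by (rule runs_FAssign) (simp_all add: r n x_def)
      fix s1 assume s1: "s1 = s'\<lparr>fmem := (fmem s')((''x'', []) := x)\<rparr>"
      show "runs row_op s1 (JK_time m e 20)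
        (\<lambda>s'. nmem s' (''r'', []) = i \<and> ?I (Suc i) (setn ''r'' (Suc i) s'))"
      proof (rule runs_mono[OF runs_row_op[of s1 m e i] order_refl])
        show "nmem s1 (''m'', []) = m" "nmem s1 (''e'', []) = e" "nmem s1 (''r'', []) = i"
          using n r s1 by simp_all
        fix s2 assume s2: "frame {''j'', ''k''} {''v''} s1 s2 \<and>
          (\<forall>j<2*m. \<forall>k\<le>e. cur s2 j k = cur s1 j k - fmem s1 (''x'', []) * entry s1 i j k)"
        have fr1: "frame {} {''x''} s' s1" using s1 by (auto simp: frame_def)
        have fr2: "?F s2"
          by (rule frame_trans[OF frame_trans[OF fr fr1 order_refl order_refl] conjunct1[OF s2]]) auto
        have cur2: "cur s2 j k = cur s' j k - x * entry s i j k" if "j < 2*m" "k \<le> e" for j k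
          using s2 that s1 n by simp
        have "\<forall>j<2*m. \<forall>k\<le>e. cur s2 j k = cur s j k - (\<Sum>r<Suc i. (c(i := x)) r * entry s r j k)"
          by (auto simp: cur2 c)
        then have "\<exists>c. \<forall>j<2*m. \<forall>k\<le>e. cur s2 j k = cur s j k - (\<Sum>r<Suc i. c r * entry s r j k)"
          by blast
        moreover have "cur s2 (pj s r) (pk s r) = 0" if "r < Suc i" for r
        proof (cases "r = i")
          case True
          then show ?thesis using piv cur2 by (simp add: x_def)
        next
          case False
          then have "r < i" using that by simp
          then show ?thesis using piv cur2 I by simp
        qed
        moreover have "nmem s2 (''r'', []) = i" using s2 s1 r by (auto simp: frame_def)
        moreover have "?F (setn ''r'' (Suc i) s2)" using fr2 by (auto simp: frame_def)
        ultimately show "nmem s2 (''r'', []) = i \<and> ?I (Suc i) (setn ''r'' (Suc i) s2)"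
          by simp
      qed
    qed simp
  qed simp
  then show ?thesis
  proof (rule runs_mono)
    show "cnt s * ((JK_time m e 20 + 20) + 10) + 10 \<le> reduce_time m e R"
      using R by (simp add: reduce_time_def add.commute)
  qed
qed

text \<open>Row \<open>c\<close> is always written, but it only counts if \<open>w \<noteq> 0\<close>, that is, \<open>f = 1\<close>.\<close>

definition commit :: com where
  "commit = Seq (NAssign ''f'' [] (NConst 0))
    (Seq (JK (Seq (FAssign ''g'' [var ''c'', var ''j'', var ''k''] (FRef ''v'' [var ''j'', var ''k'']))
       (IfThen (BAnd (BNot (NLess (var ''j'') (var ''m''))) (BNot (FEq (FRef ''v'' [var ''j'', var ''k'']) FZero)))
         (Seq (NAssign ''f'' [] (NConst 1))
           (Seq (NAssign ''pj'' [var ''c''] (var ''j'')) (NAssign ''pk'' [var ''c''] (var ''k''))))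
         Skip)))
     (NAssign ''c'' [] (NAdd (var ''c'') (var ''f''))))"

definition commit_time :: "nat \<Rightarrow> nat \<Rightarrow> nat" where
  "commit_time m e = JK_time m e 40 + 10"

text \<open>Every nonzero cell of w overwrites the pivot, so the last one scanned is kept; any
  nonzero cell would do.\<close>

lemma runs_commit:
  assumes m: "nmem s (''m'', []) = m" and e: "nmem s (''e'', []) = e"
  shows "runs commit s (commit_time m e)
    (\<lambda>s'. frame {''j'', ''k'', ''f'', ''pj'', ''pk'', ''c''} {''g''} s s' \<and>
      (\<forall>r. r \<noteq> cnt s \<longrightarrow> pj s' r = pj s r \<and> pk s' r = pk s r \<and> (\<forall>j k. entry s' r j k = entry s r j k)) \<and>
      (\<forall>j<2*m. \<forall>k\<le>e. entry s' (cnt s) j k = cur s j k) \<and>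
      (nmem s' (''f'', []) = 0 \<and> cnt s' = cnt s \<and> (\<forall>j<2*m. \<forall>k\<le>e. m \<le> j \<longrightarrow> cur s j k = 0) \<or>
       nmem s' (''f'', []) = 1 \<and> cnt s' = Suc (cnt s) \<and> m \<le> pj s' (cnt s) \<and> pj s' (cnt s) < 2 * m \<and>
         pk s' (cnt s) \<le> e \<and> cur s (pj s' (cnt s)) (pk s' (cnt s)) \<noteq> 0))" (is "runs _ _ _ ?Q")
proof -
  let ?n = "cnt s"
  let ?F = "frame {''j'', ''k'', ''f'', ''pj'', ''pk''} {''g''} s"
  let ?I = "\<lambda>P s'. ?F s' \<and>
      (\<forall>r. r \<noteq> ?n \<longrightarrow> pj s' r = pj s r \<and> pk s' r = pk s r \<and> (\<forall>j k. entry s' r j k = entry s r j k)) \<and>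
      (\<forall>(j, k)\<in>P. entry s' ?n j k = cur s j k) \<and>
      (nmem s' (''f'', []) = 0 \<and> (\<forall>(j, k)\<in>P. m \<le> j \<longrightarrow> cur s j k = 0) \<or>
       nmem s' (''f'', []) = 1 \<and> m \<le> pj s' ?n \<and> pj s' ?n < 2 * m \<and>
         pk s' ?n \<le> e \<and> cur s (pj s' ?n) (pk s' ?n) \<noteq> 0)"
  let ?b = "BAnd (BNot (NLess (var ''j'') (var ''m''))) (BNot (FEq (FRef ''v'' [var ''j'', var ''k'']) FZero))"
  let ?c = "IfThen ?b
         (Seq (NAssign ''f'' [] (NConst 1))
           (Seq (NAssign ''pj'' [var ''c''] (var ''j'')) (NAssign ''pk'' [var ''c''] (var ''k''))))
         Skip"
  have step: "runs (Seq (FAssign ''g'' [var ''c'', var ''j'', var ''k''] (FRef ''v'' [var ''j'', var ''k''])) ?c) s' 40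
    (\<lambda>s'. nmem s' (''j'', []) = j \<and> nmem s' (''k'', []) = k \<and> ?I (insert (j, k) P) s')"
    if I: "?I P s'" and jk: "j < 2 * m" "k \<le> e" "nmem s' (''j'', []) = j" "nmem s' (''k'', []) = k"
    for P s' j k
  proof (rule runs_Seq)
    have iF: "?F s'" and
      iR: "\<And>r j k. r \<noteq> ?n \<Longrightarrow> pj s' r = pj s r" "\<And>r j k. r \<noteq> ?n \<Longrightarrow> pk s' r = pk s r"
        "\<And>r j k. r \<noteq> ?n \<Longrightarrow> entry s' r j k = entry s r j k" and
      iP: "\<And>j k. (j, k) \<in> P \<Longrightarrow> entry s' ?n j k = cur s j k" and
      iD: "nmem s' (''f'', []) = 0 \<and> (\<forall>(j, k)\<in>P. m \<le> j \<longrightarrow> cur s j k = 0) \<or>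
       nmem s' (''f'', []) = 1 \<and> m \<le> pj s' ?n \<and> pj s' ?n < 2 * m \<and>
         pk s' ?n \<le> e \<and> cur s (pj s' ?n) (pk s' ?n) \<noteq> 0"
      using I by (blast, simp, simp, simp, blast, blast)
    have n: "nmem s' (''m'', []) = m" "nmem s' (''c'', []) = ?n" "\<And>j k. cur s' j k = cur s j k"
      using iF m by (auto simp: frame_def)
    show "runs (FAssign ''g'' [var ''c'', var ''j'', var ''k''] (FRef ''v'' [var ''j'', var ''k''])) s' 10
      (\<lambda>s''. s'' = s'\<lparr>fmem := (fmem s')((''g'', [?n, j, k]) := cur s j k)\<rparr>)"
      by (rule runs_FAssign) (simp_all add: jk n)
    fix s1 assume s1: "s1 = s'\<lparr>fmem := (fmem s')((''g'', [?n, j, k]) := cur s j k)\<rparr>"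
    have n1: "nmem s1 = nmem s'" "\<And>j k. cur s1 j k = cur s j k" using s1 n by auto
    have I1: "?F s1"
      "\<forall>r. r \<noteq> ?n \<longrightarrow> pj s1 r = pj s r \<and> pk s1 r = pk s r \<and> (\<forall>j k. entry s1 r j k = entry s r j k)"
      "\<forall>(j, k)\<in>insert (j, k) P. entry s1 ?n j k = cur s j k"
      using iF iR iP unfolding s1 by (simp add: frame_def, simp, auto)
    show "runs ?c s1 30 (\<lambda>s'. nmem s' (''j'', []) = j \<and> nmem s' (''k'', []) = k \<and> ?I (insert (j, k) P) s')"
    proof (rule runs_If)
      assume b: "bval ?b s1"
      then have b: "m \<le> j" "cur s j k \<noteq> 0" using n n1 jk by auto
      define s2 where "s2 = s1\<lparr>nmem := (nmem s1)((''f'', []) := 1, (''pj'', [?n]) := j, (''pk'', [?n]) := k)\<rparr>"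
      have "runs (Seq (NAssign ''f'' [] (NConst 1))
           (Seq (NAssign ''pj'' [var ''c''] (var ''j'')) (NAssign ''pk'' [var ''c''] (var ''k'')))) s1 11
           (\<lambda>s'. s' = s2)"
        by (intro runs_Seq_NAssign runs_NAssign) (simp_all add: n1 n jk s2_def)
      then show "runs (Seq (NAssign ''f'' [] (NConst 1))
           (Seq (NAssign ''pj'' [var ''c''] (var ''j'')) (NAssign ''pk'' [var ''c''] (var ''k'')))) s1 (30 - bcost ?b)
         (\<lambda>s'. nmem s' (''j'', []) = j \<and> nmem s' (''k'', []) = k \<and> ?I (insert (j, k) P) s')"
      proof (rule runs_mono)
        fix s' assume "s' = s2"
        moreover have "?F s2" using I1(1) by (auto simp: s2_def frame_def)
        moreover have "nmem s2 (''j'', []) = j" "nmem s2 (''k'', []) = k" using n1 jk by (auto simp: s2_def)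
        moreover have "?I (insert (j, k) P) s2"
          using I1 b jk calculation(2) by (auto simp: s2_def)
        ultimately show "nmem s' (''j'', []) = j \<and> nmem s' (''k'', []) = k \<and> ?I (insert (j, k) P) s'" by simp
      qed simp
    next
      assume "\<not> bval ?b s1"
      then have b: "m \<le> j \<longrightarrow> cur s j k = 0" using n n1 jk by auto
      show "runs Skip s1 (30 - bcost ?b)
         (\<lambda>s'. nmem s' (''j'', []) = j \<and> nmem s' (''k'', []) = k \<and> ?I (insert (j, k) P) s')"
        by (rule runs_Skip) (use I1 iD b jk n1 in auto)
    qed simp
  qed simp
  show ?thesis unfolding commit_def
  proof (rule runs_Seq)
    show "runs (NAssign ''f'' [] (NConst 0)) s 2 (\<lambda>s'. s' = setn ''f'' 0 s)"
      by (rule runs_NAssign) (simp_all add: setn_def)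
    fix s0 assume s0: "s0 = setn ''f'' 0 s"
    show "runs (Seq (JK (Seq (FAssign ''g'' [var ''c'', var ''j'', var ''k''] (FRef ''v'' [var ''j'', var ''k''])) ?c))
      (NAssign ''c'' [] (NAdd (var ''c'') (var ''f'')))) s0 (JK_time m e 40 + 4) ?Q"
    proof (rule runs_Seq[OF runs_JK[where I = ?I, OF _ _ _ _ step]])
      show "?I {} s0" using s0 by (auto simp: frame_def)
      fix P s' v assume "?I P s'"
      then show "?I P (setn ''j'' v s')" "?I P (setn ''k'' v s')" by (auto simp: frame_def)
    next
      fix P s' assume "?I P s'"
      then show "nmem s' (''m'', []) = m \<and> nmem s' (''e'', []) = e" using m e by (auto simp: frame_def)
    next
      fix s' assume I: "?I ({..<2 * m} \<times> {..e}) s'"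
      have c: "cnt s' = cnt s" using I by (auto simp: frame_def)
      have F: "frame {''j'', ''k'', ''f'', ''pj'', ''pk'', ''c''} {''g''} s (setn ''c'' x s')" for x
        using I by (auto simp: frame_def)
      show "runs (NAssign ''c'' [] (NAdd (var ''c'') (var ''f''))) s' 4 ?Q"
      proof (rule runs_mono[OF runs_NAssign[OF order_refl, where Q = "\<lambda>s''. s'' = setn ''c'' (cnt s + nmem s' (''f'', [])) s'"]])
        fix s'' assume "s'' = setn ''c'' (cnt s + nmem s' (''f'', [])) s'"
        then show "?Q s''"
          using I F by auto
      qed (simp_all add: c setn_def)
    qed auto
  qed (simp add: commit_time_def)
qed


definition insert_row :: com where "insert_row = Seq reduce commit"

text \<open>Interface of the elimination: the later arguments use only this relation between the
  memories before and after, not the code.\<close>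

definition inserted :: "nat \<Rightarrow> nat \<Rightarrow> 'a::field memory \<Rightarrow> 'a memory \<Rightarrow> bool" where
  "inserted m e s s' \<longleftrightarrow>
     frame {''j'', ''k'', ''r'', ''f'', ''pj'', ''pk'', ''c''} {''v'', ''x'', ''g''} s s' \<and>
     echelon m e s' \<and> (\<forall>r<cnt s. \<forall>j k. entry s' r j k = entry s r j k) \<and>
     (\<exists>c. \<forall>j<2*m. \<forall>k\<le>e. cur s' j k = cur s j k - (\<Sum>r<cnt s. c r * entry s r j k)) \<and>
     (\<forall>r<cnt s. cur s' (pj s r) (pk s r) = 0) \<and>
     (nmem s' (''f'', []) = 0 \<and> cnt s' = cnt s \<and> (\<forall>j<2*m. \<forall>k\<le>e. m \<le> j \<longrightarrow> cur s' j k = 0) \<or>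
      nmem s' (''f'', []) = 1 \<and> cnt s' = Suc (cnt s) \<and>
        (\<forall>j<2*m. \<forall>k\<le>e. entry s' (cnt s) j k = cur s' j k) \<and>
        (\<exists>j<2*m. \<exists>k\<le>e. m \<le> j \<and> cur s' j k \<noteq> 0))"

definition insert_time :: "nat \<Rightarrow> nat \<Rightarrow> nat \<Rightarrow> nat" where
  "insert_time m e R = reduce_time m e R + commit_time m e"

lemma runs_insert_row:
  assumes m: "nmem s (''m'', []) = m" and e: "nmem s (''e'', []) = e" and ech: "echelon m e s"
    and R: "cnt s \<le> R"
  shows "runs insert_row s (insert_time m e R) (inserted m e s)"
  unfolding insert_row_def
proof (rule runs_Seq[OF runs_reduce[OF assms]])
  fix s1 assume s1: "frame {''j'', ''k'', ''r''} {''v'', ''x''} s s1 \<and>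
    (\<exists>c. \<forall>j<2*m. \<forall>k\<le>e. cur s1 j k = cur s j k - (\<Sum>r<cnt s. c r * entry s r j k)) \<and>
    (\<forall>r<cnt s. cur s1 (pj s r) (pk s r) = 0)"
  have fr1: "frame {''j'', ''k'', ''r''} {''v'', ''x''} s s1" using s1 by blast
  have n1: "nmem s1 (''m'', []) = m" "nmem s1 (''e'', []) = e" "cnt s1 = cnt s"
    "\<And>r. pj s1 r = pj s r" "\<And>r. pk s1 r = pk s r" "\<And>r j k. entry s1 r j k = entry s r j k"
    using fr1 m e by (auto simp: frame_def)
  show "runs commit s1 (commit_time m e) (inserted m e s)"
  proof (rule runs_mono[OF runs_commit[OF n1(1,2)] order_refl])
    fix s2 assume "frame {''j'', ''k'', ''f'', ''pj'', ''pk'', ''c''} {''g''} s1 s2 \<and>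
      (\<forall>r. r \<noteq> cnt s1 \<longrightarrow> pj s2 r = pj s1 r \<and> pk s2 r = pk s1 r \<and> (\<forall>j k. entry s2 r j k = entry s1 r j k)) \<and>
      (\<forall>j<2*m. \<forall>k\<le>e. entry s2 (cnt s1) j k = cur s1 j k) \<and>
      (nmem s2 (''f'', []) = 0 \<and> cnt s2 = cnt s1 \<and> (\<forall>j<2*m. \<forall>k\<le>e. m \<le> j \<longrightarrow> cur s1 j k = 0) \<or>
       nmem s2 (''f'', []) = 1 \<and> cnt s2 = Suc (cnt s1) \<and> m \<le> pj s2 (cnt s1) \<and> pj s2 (cnt s1) < 2 * m \<and>
         pk s2 (cnt s1) \<le> e \<and> cur s1 (pj s2 (cnt s1)) (pk s2 (cnt s1)) \<noteq> 0)"
    then have fr2: "frame {''j'', ''k'', ''f'', ''pj'', ''pk'', ''c''} {''g''} s1 s2"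
      and old: "\<And>r. r \<noteq> cnt s \<Longrightarrow> pj s2 r = pj s r \<and> pk s2 r = pk s r \<and> (\<forall>j k. entry s2 r j k = entry s r j k)"
      and new: "\<And>j k. j < 2 * m \<Longrightarrow> k \<le> e \<Longrightarrow> entry s2 (cnt s) j k = cur s1 j k"
      and alt: "nmem s2 (''f'', []) = 0 \<and> cnt s2 = cnt s \<and> (\<forall>j<2*m. \<forall>k\<le>e. m \<le> j \<longrightarrow> cur s1 j k = 0) \<or>
       nmem s2 (''f'', []) = 1 \<and> cnt s2 = Suc (cnt s) \<and> m \<le> pj s2 (cnt s) \<and> pj s2 (cnt s) < 2 * m \<and>
         pk s2 (cnt s) \<le> e \<and> cur s1 (pj s2 (cnt s)) (pk s2 (cnt s)) \<noteq> 0"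
      by (simp_all add: n1)
    have v: "cur s2 j k = cur s1 j k" for j k using fr2 by (auto simp: frame_def)
    have fr: "frame {''j'', ''k'', ''r'', ''f'', ''pj'', ''pk'', ''c''} {''v'', ''x'', ''g''} s s2"
      by (rule frame_trans[OF fr1 fr2]) auto
    have piv: "\<And>r. r < cnt s \<Longrightarrow> m \<le> pj s r \<and> pj s r < 2 * m \<and> pk s r \<le> e \<and>
       entry s r (pj s r) (pk s r) \<noteq> 0"
      "\<And>r r'. r < r' \<Longrightarrow> r' < cnt s \<Longrightarrow> entry s r' (pj s r) (pk s r) = 0"
      using ech by (auto simp: echelon_def)
    have ech2: "echelon m e s2"
      using alt
    proof
      assume "nmem s2 (''f'', []) = 0 \<and> cnt s2 = cnt s \<and> (\<forall>j<2*m. \<forall>k\<le>e. m \<le> j \<longrightarrow> cur s1 j k = 0)"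
      then show ?thesis using piv old by (simp add: echelon_def)
    next
      assume *: "nmem s2 (''f'', []) = 1 \<and> cnt s2 = Suc (cnt s) \<and> m \<le> pj s2 (cnt s) \<and> pj s2 (cnt s) < 2 * m \<and>
         pk s2 (cnt s) \<le> e \<and> cur s1 (pj s2 (cnt s)) (pk s2 (cnt s)) \<noteq> 0"
      have "m \<le> pj s2 r \<and> pj s2 r < 2 * m \<and> pk s2 r \<le> e \<and> entry s2 r (pj s2 r) (pk s2 r) \<noteq> 0"
        if "r \<le> cnt s" for r
        using that * piv(1)[of r] old[of r] new by (cases "r = cnt s") auto
      \<comment> \<open>The new row vanishes at the earlier pivots because it was reduced before
        being stored.\<close>
      moreover have "entry s2 r' (pj s2 r) (pk s2 r) = 0" if "r < r'" "r' \<le> cnt s" for r r'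
        using that piv old[of r] old[of r'] new s1 by (cases "r' = cnt s") auto
      ultimately show ?thesis using * by (simp add: echelon_def less_Suc_eq_le)
    qed
    have "\<exists>c. \<forall>j<2*m. \<forall>k\<le>e. cur s2 j k = cur s j k - (\<Sum>r<cnt s. c r * entry s r j k)"
      "\<forall>r<cnt s. cur s2 (pj s r) (pk s r) = 0"
      using s1 unfolding v by blast+
    moreover have "nmem s2 (''f'', []) = 0 \<and> cnt s2 = cnt s \<and> (\<forall>j<2*m. \<forall>k\<le>e. m \<le> j \<longrightarrow> cur s2 j k = 0) \<or>
      nmem s2 (''f'', []) = 1 \<and> cnt s2 = Suc (cnt s) \<and>
        (\<forall>j<2*m. \<forall>k\<le>e. entry s2 (cnt s) j k = cur s2 j k) \<and>
        (\<exists>j<2*m. \<exists>k\<le>e. m \<le> j \<and> cur s2 j k \<noteq> 0)"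
      using alt new unfolding v by blast
    ultimately show "inserted m e s s2"
      using fr ech2 old unfolding inserted_def by simp
  qed
qed (simp add: insert_time_def)

text \<open>At the pivot of row r the later rows vanish by the echelon form and the earlier ones
  have coefficient 0 by induction, so \<open>d r\<close> is the only survivor. It is enough that
  \<open>h\<close> vanishes at the pivots.\<close>

lemma echelon_independent:
  assumes ech: "echelon m e s"
    and h: "\<And>j k. m \<le> j \<Longrightarrow> j < 2 * m \<Longrightarrow> k \<le> e \<Longrightarrow> h j k = (\<Sum>r<cnt s. d r * entry s r j k)"
    and piv: "\<And>r. r < cnt s \<Longrightarrow> h (pj s r) (pk s r) = 0"
    and r: "r < cnt s"
  shows "d r = 0"
  using r
proof (induction r rule: less_induct)
  case (less r)
  have p: "m \<le> pj s r" "pj s r < 2 * m" "pk s r \<le> e" "entry s r (pj s r) (pk s r) \<noteq> 0"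
    "\<And>r'. r' < cnt s \<Longrightarrow> r < r' \<Longrightarrow> entry s r' (pj s r) (pk s r) = 0"
    using ech less.prems by (auto simp: echelon_def)
  have "0 = (\<Sum>r'<cnt s. d r' * entry s r' (pj s r) (pk s r))"
    using h[OF p(1-3)] piv less.prems by simp
  also have "\<dots> = (\<Sum>r'\<in>{r}. d r' * entry s r' (pj s r) (pk s r))"
  proof (rule sum.mono_neutral_right)
    show "\<forall>r'\<in>{..<cnt s} - {r}. d r' * entry s r' (pj s r) (pk s r) = 0"
      using less.IH p(5) by (metis DiffE insertCI lessThan_iff linorder_neqE_nat mult_zero_left mult_zero_right)
  qed (use less.prems in auto)
  finally show ?case using p(4) by simp
qed

section \<open>Polynomial vectors stored in arrays, and the span of the rows\<close>

definition dense :: "nat \<Rightarrow> nat \<Rightarrow> (nat \<Rightarrow> nat \<Rightarrow> 'a::field) \<Rightarrow> 'a poly vec" where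
  "dense m e H = vec m (\<lambda>j. \<Sum>k\<le>e. monom (H j k) k)"

lemma dense_carrier [simp]: "dense m e H \<in> carrier_vec m"
  by (simp add: dense_def)

lemma coeff_dense:
  assumes "j < m" shows "coeff (dense m e H $ j) k = (if k \<le> e then H j k else 0)"
  using assms by (simp add: dense_def coeff_sum coeff_monom)

lemma dense_eqI:
  assumes "v \<in> carrier_vec m" "\<And>j k. j < m \<Longrightarrow> k \<le> e \<Longrightarrow> H j k = coeff (v $ j) k"
    "\<And>j. j < m \<Longrightarrow> degree (v $ j) \<le> e"
  shows "dense m e H = v"
proof (rule eq_vecI)
  fix j assume "j < dim_vec v"
  then have j: "j < m" using assms(1) by simp
  show "dense m e H $ j = v $ j"
  proof (rule poly_eqI)
    fix k show "coeff (dense m e H $ j) k = coeff (v $ j) k"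
      using assms(2,3)[OF j] by (auto simp: coeff_dense[OF j] coeff_eq_0)
  qed
qed (use assms(1) in \<open>simp add: dense_def\<close>)

lemma dense_cong:
  assumes "\<And>j k. j < m \<Longrightarrow> k \<le> e \<Longrightarrow> H j k = G j k" shows "dense m e H = dense m e G"
  using assms by (auto simp: dense_def intro!: eq_vecI sum.cong)

lemma dense_add: "dense m e (\<lambda>j k. H j k + G j k) = dense m e H + dense m e G"
  by (rule eq_vecI) (auto simp: dense_def sum.distrib add_monom[symmetric])

lemma dense_diff: "dense m e (\<lambda>j k. H j k - G j k) = dense m e H - dense m e G"
  by (rule eq_vecI) (auto simp: dense_def sum_subtractf diff_monom[symmetric])

lemma sum_smult: "Polynomial.smult c (\<Sum>i\<in>I. f i) = (\<Sum>i\<in>I. Polynomial.smult c (f i))"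
  by (induction I rule: infinite_finite_induct) (auto simp: smult_add_right)

lemma dense_smult: "dense m e (\<lambda>j k. c * H j k) = [:c:] \<cdot>\<^sub>v dense m e H"
  by (rule eq_vecI) (auto simp: dense_def smult_monom sum_smult)

lemma dense_zero: "dense m e (\<lambda>j k. 0) = 0\<^sub>v m"
  by (rule eq_vecI) (auto simp: dense_def)

text \<open>Coordinates of the single vector z^d x_i with respect to a list x_0, x_1, ...\<close>

definition unit_monom :: "nat \<Rightarrow> nat \<Rightarrow> nat \<Rightarrow> 'a::field poly" where
  "unit_monom i d = (\<lambda>i'. if i' = i then monom 1 d else 0)"

lemma comb_unit_monom_index: "i < m \<Longrightarrow> j < m \<Longrightarrow> comb m xs (unit_monom i d) $ j = monom 1 d * xs ! i $ j"
  by (simp add: unit_monom_def if_distrib[of "\<lambda>x. x * _"] cong: if_cong)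

lemma degs_below_unit_monom: "degs_below m (K(i := Suc (K i))) (unit_monom i (K i))"
  by (auto simp: degs_below_def unit_monom_def)

text \<open>Removes the one coefficient that the larger bound admits in addition; so each insertion
  extends the covered range by one monomial.\<close>

lemma degs_below_split:
  assumes "degs_below m (K(i := Suc (K i))) x"
  shows "degs_below m K (\<lambda>i'. x i' - [:coeff (x i) (K i):] * unit_monom i (K i) i')"
  using assms by (auto simp: degs_below_def unit_monom_def coeff_monom)

lemma degs_below_weaken:
  "degs_below m K x \<Longrightarrow> (\<And>i. i < m \<Longrightarrow> K i \<le> K' i) \<Longrightarrow> degs_below m K' x"
  unfolding degs_below_def by (meson le_trans)

lemma degs_below_zero: "degs_below m K (\<lambda>_. 0)"
  by (simp add: degs_below_def)

lemma comb_add_smult: "comb m xs (\<lambda>i. x i + r * y i) = comb m xs x + r \<cdot>\<^sub>v comb m xs y"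
  by (simp add: comb_add comb_smult)

text \<open>The F-span of the w-blocks of the stored rows, as far as the coefficients up to
  \<open>e\<close> can tell.\<close>

definition in_rows :: "nat \<Rightarrow> nat \<Rightarrow> 'a::field memory \<Rightarrow> 'a poly vec \<Rightarrow> bool" where
  "in_rows m e s v \<longleftrightarrow> (\<exists>d. \<forall>j<m. \<forall>k\<le>e. coeff (v $ j) k = (\<Sum>r<cnt s. d r * entry s r (m + j) k))"

lemma in_rows_zero: "in_rows m e s (0\<^sub>v m)"
  unfolding in_rows_def by (rule exI[of _ "\<lambda>_. 0"]) simp

lemma in_rows_add_smult:
  assumes "v \<in> carrier_vec m" "w \<in> carrier_vec m" "in_rows m e s v" "in_rows m e s w"
  shows "in_rows m e s (v + [:c:] \<cdot>\<^sub>v w)"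
proof -
  obtain d d' where "\<And>j k. j < m \<Longrightarrow> k \<le> e \<Longrightarrow> coeff (v $ j) k = (\<Sum>r<cnt s. d r * entry s r (m + j) k)"
    "\<And>j k. j < m \<Longrightarrow> k \<le> e \<Longrightarrow> coeff (w $ j) k = (\<Sum>r<cnt s. d' r * entry s r (m + j) k)"
    using assms(3,4) unfolding in_rows_def by blast
  then have "coeff ((v + [:c:] \<cdot>\<^sub>v w) $ j) k = (\<Sum>r<cnt s. (d r + c * d' r) * entry s r (m + j) k)"
    if "j < m" "k \<le> e" for j k
    using assms(1,2) that by (simp add: distrib_right sum.distrib sum_distrib_left mult.assoc)
  then show ?thesis unfolding in_rows_def by (intro exI[of _ "\<lambda>r. d r + c * d' r"]) simp
qed

lemma inserted_in_rows_mono: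
  assumes ins: "inserted m e s s'" and "in_rows m e s v"
  shows "in_rows m e s' v"
proof -
  obtain d where d: "\<And>j k. j < m \<Longrightarrow> k \<le> e \<Longrightarrow> coeff (v $ j) k = (\<Sum>r<cnt s. d r * entry s r (m + j) k)"
    using assms(2) unfolding in_rows_def by blast
  have c: "cnt s \<le> cnt s'" using ins by (auto simp: inserted_def)
  have "(\<Sum>r<cnt s. d r * entry s r j k) = (\<Sum>r<cnt s'. (if r < cnt s then d r else 0) * entry s' r j k)" for j k
  proof -
    have "(\<Sum>r<cnt s'. (if r < cnt s then d r else 0) * entry s' r j k)
      = (\<Sum>r<cnt s. (if r < cnt s then d r else 0) * entry s' r j k)"
      using c by (intro sum.mono_neutral_right) auto
    also have "\<dots> = (\<Sum>r<cnt s. d r * entry s r j k)"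
      using ins by (intro sum.cong) (auto simp: inserted_def)
    finally show ?thesis by simp
  qed
  then show ?thesis unfolding in_rows_def
    using d by (intro exI[of _ "\<lambda>r. if r < cnt s then d r else 0"]) simp
qed

text \<open>The loaded vector is its remainder plus a combination of old rows, and the remainder is
  either zero in the w-block or the new row, taken with coefficient 1.\<close>

lemma inserted_in_rows_cur:
  assumes ins: "inserted m e s s'" and w: "\<And>j k. j < m \<Longrightarrow> k \<le> e \<Longrightarrow> coeff (w $ j) k = cur s (m + j) k"
  shows "in_rows m e s' w"
proof -
  obtain c where c: "\<And>j k. j < 2*m \<Longrightarrow> k \<le> e \<Longrightarrow> cur s' j k = cur s j k - (\<Sum>r<cnt s. c r * entry s r j k)"
    using ins unfolding inserted_def by blast
  have old: "entry s' r j k = entry s r j k" if "r < cnt s" for r j k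
    using ins that by (simp add: inserted_def)
  have eq: "coeff (w $ j) k = cur s' (m + j) k + (\<Sum>r<cnt s. c r * entry s' r (m + j) k)" if "j < m" "k \<le> e" for j k
    using that c w old by simp
  consider "cnt s' = cnt s" "\<forall>j<2*m. \<forall>k\<le>e. m \<le> j \<longrightarrow> cur s' j k = 0"
    | "cnt s' = Suc (cnt s)" "\<forall>j<2*m. \<forall>k\<le>e. entry s' (cnt s) j k = cur s' j k"
    using ins unfolding inserted_def by blast
  then show ?thesis
  proof cases
    case 1
    then show ?thesis unfolding in_rows_def using eq by (intro exI[of _ c]) auto
  next
    case 2
    then show ?thesis unfolding in_rows_def using eq
      by (intro exI[of _ "c(cnt s := 1)"]) auto
  qed
qed

text \<open>Completeness of the elimination: in the w-block the remainder of a dependent vector is a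
  combination of old rows, and it vanishes at all old pivots, so \<open>echelon_independent\<close>
  makes it zero.\<close>

lemma inserted_dependent:
  assumes ins: "inserted m e s s'" and ech: "echelon m e s"
    and w: "\<And>j k. j < m \<Longrightarrow> k \<le> e \<Longrightarrow> coeff (w $ j) k = cur s (m + j) k" and dep: "in_rows m e s w"
  shows "nmem s' (''f'', []) = 0"
proof -
  obtain c where c: "\<And>j k. j < 2*m \<Longrightarrow> k \<le> e \<Longrightarrow> cur s' j k = cur s j k - (\<Sum>r<cnt s. c r * entry s r j k)"
    using ins unfolding inserted_def by blast
  obtain d where d: "\<And>j k. j < m \<Longrightarrow> k \<le> e \<Longrightarrow> coeff (w $ j) k = (\<Sum>r<cnt s. d r * entry s r (m + j) k)"
    using dep unfolding in_rows_def by blast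
  have eq: "cur s' j k = (\<Sum>r<cnt s. (d r - c r) * entry s r j k)" if "m \<le> j" "j < 2 * m" "k \<le> e" for j k
  proof -
    have "j - m < m" "m + (j - m) = j" using that by auto
    then have "cur s j k = (\<Sum>r<cnt s. d r * entry s r j k)"
      using w[of "j - m" k] d[of "j - m" k] that by simp
    then show ?thesis using c that by (simp add: left_diff_distrib sum_subtractf)
  qed
  have piv: "cur s' (pj s r) (pk s r) = 0" if "r < cnt s" for r
    using ins that by (simp add: inserted_def)
  have "d r - c r = 0" if "r < cnt s" for r
    using echelon_independent[OF ech, of "cur s'" "\<lambda>r. d r - c r", OF eq piv that] by blast
  then have "cur s' j k = 0" if "m \<le> j" "j < 2 * m" "k \<le> e" for j k
    using eq[OF that] by simp
  then show ?thesis using ins unfolding inserted_def by blast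
qed

section \<open>Invariants of the elimination modulo \<open>M\<close>\<close>

context lattice
begin

text \<open>Congruence of u and w modulo \<open>M\<close>. The coordinates \<open>x\<close> are
  bounded because they decide the norm of the output; the coordinates \<open>y\<close> only witness
  membership in \<open>M\<close> and carry no bound.\<close>

definition good :: "nat \<Rightarrow> (nat \<Rightarrow> nat) \<Rightarrow> (nat \<Rightarrow> nat \<Rightarrow> 'a) \<Rightarrow> bool" where
  "good e K H \<longleftrightarrow> (\<exists>x y. degs_below m K x \<and> dense m e H = comb m bs x \<and>
     dense m e (\<lambda>j. H (m + j)) = comb m bs x + comb m as y)"

lemma good_zero: "good e K (\<lambda>_ _. 0)"
  unfolding good_def by (intro exI[of _ "\<lambda>_. 0"]) (simp add: degs_below_zero dense_zero comb_zero)

lemma good_add_smult: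
  assumes "good e K H" "good e K G" shows "good e K (\<lambda>j k. H j k + c * G j k)"
proof -
  obtain x y where 1: "degs_below m K x" "dense m e H = comb m bs x"
     "dense m e (\<lambda>j. H (m + j)) = comb m bs x + comb m as y" using assms(1) unfolding good_def by blast
  obtain x' y' where 2: "degs_below m K x'" "dense m e G = comb m bs x'"
     "dense m e (\<lambda>j. G (m + j)) = comb m bs x' + comb m as y'" using assms(2) unfolding good_def by blast
  show ?thesis unfolding good_def
  proof (rule exI[of _ "\<lambda>i. x i + [:c:] * x' i"], rule exI[of _ "\<lambda>i. y i + [:c:] * y' i"], intro conjI)
    show "degs_below m K (\<lambda>i. x i + [:c:] * x' i)" using 1 2 by (simp add: degs_below_def)
    show "dense m e (\<lambda>j k. H j k + c * G j k) = comb m bs (\<lambda>i. x i + [:c:] * x' i)"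
      unfolding dense_add dense_smult 1 2 comb_add_smult ..
    show "dense m e (\<lambda>j k. H (m + j) k + c * G (m + j) k)
      = comb m bs (\<lambda>i. x i + [:c:] * x' i) + comb m as (\<lambda>i. y i + [:c:] * y' i)"
      unfolding dense_add dense_smult 1 2 comb_add_smult
      by (rule eq_vecI) (auto simp: comb_def algebra_simps smult_add_right)
  qed
qed

lemma good_sum:
  "(\<And>r. r < n \<Longrightarrow> good e K (G r)) \<Longrightarrow> good e K (\<lambda>j k. \<Sum>r<n. c r * G r j k)" for n :: nat
proof (induction n)
  case (Suc n)
  then show ?case using good_add_smult[of e K "\<lambda>j k. \<Sum>r<n. c r * G r j k" "G n" "c n"] by simp
qed (simp add: good_zero)

lemma good_weaken:
  "good e K H \<Longrightarrow> (\<And>i. i < m \<Longrightarrow> K i \<le> K' i) \<Longrightarrow> good e K' H"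
  unfolding good_def using degs_below_weaken by blast

lemma good_cong:
  assumes "good e K H" "\<And>j k. j < 2 * m \<Longrightarrow> k \<le> e \<Longrightarrow> H j k = G j k" shows "good e K G"
proof -
  have "dense m e G = dense m e H" "dense m e (\<lambda>j. G (m + j)) = dense m e (\<lambda>j. H (m + j))"
    using assms(2) by (auto intro!: dense_cong)
  then show ?thesis using assms(1) unfolding good_def by simp
qed

text \<open>Soundness and completeness together: every row is a congruent pair, and the w-blocks
  span all combinations of z^k a_i with k < \<open>J i\<close> and z^k b_i with k <
  \<open>K i\<close>, up to degree \<open>e\<close>.\<close>

definition rows_inv :: "nat \<Rightarrow> (nat \<Rightarrow> nat) \<Rightarrow> (nat \<Rightarrow> nat) \<Rightarrow> 'a memory \<Rightarrow> bool" where
  "rows_inv e J K s \<longleftrightarrow> echelon m e s \<and> (\<forall>r<cnt s. good e K (entry s r)) \<and>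
     (\<forall>x y. degs_below m J y \<longrightarrow> degs_below m K x \<longrightarrow> in_rows m e s (comb m as y + comb m bs x))"

text \<open>Serves both kinds of insertion: \<open>x0\<close> and \<open>y0\<close> describe the
  loaded pair, and \<open>gen\<close> says that the old range together with multiples of the loaded
  w covers the new one. In the second conclusion only coordinates below the old bound
  \<open>K\<close> are subtracted from \<open>x0\<close>, which is why a new monomial in
  \<open>x0\<close> survives in the output.\<close>

lemma rows_inv_inserted:
  assumes inv: "rows_inv e J K s" and ins: "inserted m e s s'"
    and K: "\<And>i. i < m \<Longrightarrow> K i \<le> K' i" and x0: "degs_below m K' x0"
    and u: "dense m e (cur s) = comb m bs x0"
    and w: "dense m e (\<lambda>j. cur s (m + j)) = comb m bs x0 + comb m as y0"
    and gen: "\<And>x y. degs_below m J' y \<Longrightarrow> degs_below m K' x \<Longrightarrow>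
      \<exists>x' y' c. degs_below m J y' \<and> degs_below m K x' \<and>
        comb m as y + comb m bs x = (comb m as y' + comb m bs x') + [:c:] \<cdot>\<^sub>v (comb m bs x0 + comb m as y0)"
  shows "rows_inv e J' K' s'"
    and "\<exists>x' y'. degs_below m K x' \<and> dense m e (cur s') = comb m bs (\<lambda>i. x0 i - x' i) \<and>
       dense m e (\<lambda>j. cur s' (m + j)) = comb m bs (\<lambda>i. x0 i - x' i) + comb m as y'"
    and "in_rows m e s (comb m bs x0 + comb m as y0) \<Longrightarrow> nmem s' (''f'', []) = 0"
proof -
  let ?w = "comb m bs x0 + comb m as y0"
  have cw: "coeff (?w $ j) k = cur s (m + j) k" if "j < m" "k \<le> e" for j k
    using w that coeff_dense[of j m e "\<lambda>j. cur s (m + j)" k] by simp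
  have ech: "echelon m e s" using inv by (simp add: rows_inv_def)
  show dep: "in_rows m e s ?w \<Longrightarrow> nmem s' (''f'', []) = 0"
    by (rule inserted_dependent[OF ins ech cw])
  obtain c where c: "\<And>j k. j < 2*m \<Longrightarrow> k \<le> e \<Longrightarrow> cur s' j k = cur s j k - (\<Sum>r<cnt s. c r * entry s r j k)"
    using ins unfolding inserted_def by blast
  have "good e K (\<lambda>j k. \<Sum>r<cnt s. c r * entry s r j k)"
    using inv by (intro good_sum) (simp add: rows_inv_def)
  then obtain x' y' where xy: "degs_below m K x'"
    "dense m e (\<lambda>j k. \<Sum>r<cnt s. c r * entry s r j k) = comb m bs x'"
    "dense m e (\<lambda>j k. \<Sum>r<cnt s. c r * entry s r (m + j) k) = comb m bs x' + comb m as y'"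
    unfolding good_def by blast
  have u': "dense m e (cur s') = comb m bs (\<lambda>i. x0 i - x' i)"
  proof -
    have "dense m e (cur s') = dense m e (\<lambda>j k. cur s j k - (\<Sum>r<cnt s. c r * entry s r j k))"
      using c by (intro dense_cong) simp
    then show ?thesis by (simp add: dense_diff u xy comb_diff)
  qed
  have w': "dense m e (\<lambda>j. cur s' (m + j)) = comb m bs (\<lambda>i. x0 i - x' i) + comb m as (\<lambda>i. y0 i - y' i)"
  proof -
    have "dense m e (\<lambda>j. cur s' (m + j))
      = dense m e (\<lambda>j k. cur s (m + j) k - (\<Sum>r<cnt s. c r * entry s r (m + j) k))"
      using c by (intro dense_cong) simp
    also have "\<dots> = ?w - (comb m bs x' + comb m as y')" unfolding dense_diff w xy ..
    also have "\<dots> = comb m bs (\<lambda>i. x0 i - x' i) + comb m as (\<lambda>i. y0 i - y' i)"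
      unfolding comb_diff by (rule eq_vecI) (auto simp: comb_def)
    finally show ?thesis .
  qed
  show "\<exists>x' y'. degs_below m K x' \<and> dense m e (cur s') = comb m bs (\<lambda>i. x0 i - x' i) \<and>
       dense m e (\<lambda>j. cur s' (m + j)) = comb m bs (\<lambda>i. x0 i - x' i) + comb m as y'"
    using xy u' w' by blast
  have gc: "good e K' (cur s')" unfolding good_def
  proof (intro exI conjI)
    show "degs_below m K' (\<lambda>i. x0 i - x' i)"
      using degs_below_weaken[OF xy(1) K] x0 by (auto simp: degs_below_def)
  qed (use u' w' in auto)
  have old: "entry s' r = entry s r" if "r < cnt s" for r
    using ins that by (intro ext) (simp add: inserted_def)
  have "good e K' (entry s' r)" if r: "r < cnt s'" for r
  proof (cases "r < cnt s")
    case True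
    then show ?thesis using inv old good_weaken[OF _ K] by (simp add: rows_inv_def)
  next
    case False
    then have "r = cnt s" "\<forall>j<2*m. \<forall>k\<le>e. entry s' (cnt s) j k = cur s' j k"
      using ins r unfolding inserted_def by auto
    then show ?thesis using good_cong[OF gc] by auto
  qed
  moreover have "in_rows m e s' (comb m as y + comb m bs x)"
    if y: "degs_below m J' y" and x: "degs_below m K' x" for x y
  proof -
    obtain x' y' c where xyc: "degs_below m J y'" "degs_below m K x'"
      "comb m as y + comb m bs x = (comb m as y' + comb m bs x') + [:c:] \<cdot>\<^sub>v ?w"
      using gen[OF y x] by blast
    have "in_rows m e s (comb m as y' + comb m bs x')" using inv xyc by (simp add: rows_inv_def)
    then have "in_rows m e s' (comb m as y' + comb m bs x')" by (rule inserted_in_rows_mono[OF ins])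
    moreover have "in_rows m e s' ?w" by (rule inserted_in_rows_cur[OF ins cw])
    ultimately show ?thesis unfolding xyc(3) by (intro in_rows_add_smult) auto
  qed
  ultimately show "rows_inv e J' K' s'"
    using ins unfolding rows_inv_def inserted_def by blast
qed

section \<open>Inserting the vectors z^k a_i and z^k b_i\<close>

definition input_mem :: "'a memory \<Rightarrow> bool" where
  "input_mem s \<longleftrightarrow> nmem s (''m'', []) = m \<and> (\<forall>l. fmem s (''o'', l) = 0) \<and>
     (\<forall>i<m. \<forall>j<m. \<forall>k. fmem s (''b'', [i, j, k]) = coeff (bs ! i $ j) k \<and>
        fmem s (''a'', [i, j, k]) = coeff (as ! i $ j) k)"

abbreviation "insert_nvars \<equiv> {''j'', ''k'', ''r'', ''f'', ''pj'', ''pk'', ''c''}"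
abbreviation "insert_fvars \<equiv> {''v'', ''x'', ''g''}"

lemma input_mem_frame:
  "input_mem s \<Longrightarrow> frame X Y s s' \<Longrightarrow> ''m'' \<notin> X \<Longrightarrow> {''o'', ''a'', ''b''} \<inter> Y = {} \<Longrightarrow> input_mem s'"
  unfolding input_mem_def frame_def by simp

lemma rows_inv_frame:
  assumes "rows_inv e J K s" "frame X Y s s'" "{''c'', ''pj'', ''pk''} \<inter> X = {}" "''g'' \<notin> Y"
  shows "rows_inv e J K s'"
proof -
  have "cnt s' = cnt s" "\<And>r. pj s' r = pj s r" "\<And>r. pk s' r = pk s r"
    "\<And>r j k. entry s' r j k = entry s r j k"
    using assms(2-) by (auto simp: frame_def)
  then show ?thesis using assms(1) unfolding rows_inv_def echelon_def in_rows_def by simp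
qed

text \<open>The assumption \<open>d + D \<le> e\<close> makes the shifted polynomials fit into the
  array, so nothing is cut off.\<close>

lemma dense_shift:
  assumes i: "i < m" and d: "d + D \<le> e"
    and xs: "\<And>j. j < m \<Longrightarrow> degree (xs ! i $ j) \<le> D"
    and H: "\<And>j k. j < m \<Longrightarrow> k \<le> e \<Longrightarrow> H j k = (if k < d then 0 else coeff (xs ! i $ j) (k - d))"
  shows "dense m e H = comb m xs (unit_monom i d)"
proof (rule dense_eqI)
  fix j assume j: "j < m"
  show "H j k = coeff (comb m xs (unit_monom i d) $ j) k" if "k \<le> e" for k
    unfolding comb_unit_monom_index[OF i j] using H[OF j that] by (simp add: coeff_monom_mult)
  have "degree (monom 1 d * xs ! i $ j) \<le> d + D"
    using xs[OF j] by (meson add_mono degree_monom_le degree_mult_le le_trans)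
  then show "degree (comb m xs (unit_monom i d) $ j) \<le> e"
    using d unfolding comb_unit_monom_index[OF i j] by simp
qed simp

lemma comb_split:
  "comb m xs x = comb m xs (\<lambda>i. x i - [:c:] * z i) + [:c:] \<cdot>\<^sub>v comb m xs z"
  unfolding comb_diff comb_smult by (rule eq_vecI) (auto simp: comb_def)

text \<open>An element of \<open>M\<close> is congruent to 0, so u = 0 is a correct record for it.
  The range of coordinates grows by the monomial that \<open>degs_below_split\<close>
  removes.\<close>

lemma runs_insert_a:
  assumes s: "input_mem s" "nmem s (''e'', []) = e" "rows_inv e J K s" "cnt s \<le> R"
    and i: "i < m" "nmem s (''i'', []) = i" "nmem s (''s'', []) = J i" "J i + D \<le> e"
  shows "runs (Seq (load ''o'' ''a'') insert_row) s (JK_time m e 20 + insert_time m e R)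
    (\<lambda>s'. frame insert_nvars insert_fvars s s' \<and> rows_inv e (J(i := Suc (J i))) K s' \<and> cnt s' \<le> Suc (cnt s))"
proof (rule runs_Seq[OF runs_load])
  show "nmem s (''m'', []) = m" using s by (simp add: input_mem_def)
  fix s1 assume s1: "frame {''j'', ''k''} {''v''} s s1 \<and>
    (\<forall>j<2*m. \<forall>k\<le>e. cur s1 j k = (if k < J i then 0
       else if j < m then fmem s (''o'', [i, j, k - J i]) else fmem s (''a'', [i, j - m, k - J i])))"
  have fr: "frame {''j'', ''k''} {''v''} s s1" using s1 by blast
  have inv1: "rows_inv e J K s1" by (rule rows_inv_frame[OF s(3) fr]) auto
  have n1: "nmem s1 (''m'', []) = m" "nmem s1 (''e'', []) = e" "cnt s1 = cnt s"
    using fr s by (auto simp: frame_def input_mem_def)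
  have ech: "echelon m e s1" using inv1 by (simp add: rows_inv_def)
  have u: "dense m e (cur s1) = comb m bs (\<lambda>_. 0)"
  proof -
    have "dense m e (cur s1) = dense m e (\<lambda>_ _. 0)"
      using s1 s(1) by (intro dense_cong) (auto simp: input_mem_def)
    then show ?thesis by (simp add: dense_zero comb_zero)
  qed
  have "dense m e (\<lambda>j. cur s1 (m + j)) = comb m as (unit_monom i (J i))"
    using s1 s(1) i degree_le_D(2)[OF i(1)] by (intro dense_shift) (auto simp: input_mem_def)
  then have w: "dense m e (\<lambda>j. cur s1 (m + j)) = comb m bs (\<lambda>_. 0) + comb m as (unit_monom i (J i))"
    by (simp add: comb_zero)
  show "runs insert_row s1 (insert_time m e R)
    (\<lambda>s'. frame insert_nvars insert_fvars s s' \<and> rows_inv e (J(i := Suc (J i))) K s' \<and> cnt s' \<le> Suc (cnt s))"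
  proof (rule runs_mono[OF runs_insert_row[OF n1(1,2) ech] order_refl])
    show "cnt s1 \<le> R" using s(4) n1 by simp
    fix s2 assume ins: "inserted m e s1 s2"
    have "frame insert_nvars insert_fvars s1 s2" using ins by (simp add: inserted_def)
    from frame_trans[OF fr this] have "frame insert_nvars insert_fvars s s2" by auto
    moreover have "rows_inv e (J(i := Suc (J i))) K s2"
    proof (rule rows_inv_inserted(1)[OF inv1 ins order_refl degs_below_zero u w])
      fix x y :: "nat \<Rightarrow> 'a poly" assume y: "degs_below m (J(i := Suc (J i))) y" and x: "degs_below m K x"
      let ?c = "coeff (y i) (J i)"
      let ?y = "\<lambda>i'. y i' - [:?c:] * unit_monom i (J i) i'"
      have split: "comb m as y = comb m as ?y + [:?c:] \<cdot>\<^sub>v comb m as (unit_monom i (J i))" by (rule comb_split)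
      have "comb m as y + comb m bs x
        = (comb m as ?y + comb m bs x) + [:?c:] \<cdot>\<^sub>v (comb m bs (\<lambda>_. 0) + comb m as (unit_monom i (J i)))"
        unfolding split by (rule eq_vecI) (auto simp: comb_def)
      then show "\<exists>x' y' c. degs_below m J y' \<and> degs_below m K x' \<and>
        comb m as y + comb m bs x = (comb m as y' + comb m bs x') + [:c:] \<cdot>\<^sub>v (comb m bs (\<lambda>_. 0) + comb m as (unit_monom i (J i)))"
        using degs_below_split[OF y] x by blast
    qed
    moreover have "cnt s2 \<le> Suc (cnt s)" using ins n1 unfolding inserted_def by auto
    ultimately show "frame insert_nvars insert_fvars s s2 \<and> rows_inv e (J(i := Suc (J i))) K s2 \<and> cnt s2 \<le> Suc (cnt s)"
      by blast
  qed
qed (use s i in auto)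

text \<open>Initially u = w. If w reduces to 0, then u is congruent to 0 modulo \<open>M\<close>: it
  is an element of \<open>M\<close> that equals z^(K i) b_i minus a combination of monomials used
  before. Otherwise the contrapositive of \<open>inserted_dependent\<close> places the candidate
  outside the old span.\<close>

lemma runs_insert_b:
  assumes s: "input_mem s" "nmem s (''e'', []) = e" "rows_inv e J K s" "cnt s \<le> R"
    and i: "i < m" "nmem s (''i'', []) = i" "nmem s (''s'', []) = K i" "K i + D \<le> e"
  shows "runs (Seq (load ''b'' ''b'') insert_row) s (JK_time m e 20 + insert_time m e R)
    (\<lambda>s'. frame insert_nvars insert_fvars s s' \<and> rows_inv e J (K(i := Suc (K i))) s' \<and>
       cnt s' \<le> Suc (cnt s) \<and>
       (nmem s' (''f'', []) = 0 \<and>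
         (\<exists>x y. degs_below m K x \<and> dense m e (cur s') = comb m bs (\<lambda>i'. unit_monom i (K i) i' - x i') \<and>
            dense m e (cur s') = comb m as y) \<or>
        nmem s' (''f'', []) = 1 \<and> \<not> in_rows m e s (comb m bs (unit_monom i (K i)))))"
proof (rule runs_Seq[OF runs_load])
  let ?mo = "unit_monom i (K i)"
  show "nmem s (''m'', []) = m" using s by (simp add: input_mem_def)
  fix s1 assume s1: "frame {''j'', ''k''} {''v''} s s1 \<and>
    (\<forall>j<2*m. \<forall>k\<le>e. cur s1 j k = (if k < K i then 0
       else if j < m then fmem s (''b'', [i, j, k - K i]) else fmem s (''b'', [i, j - m, k - K i])))"
  have fr: "frame {''j'', ''k''} {''v''} s s1" using s1 by blast
  have inv1: "rows_inv e J K s1" by (rule rows_inv_frame[OF s(3) fr]) auto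
  have n1: "nmem s1 (''m'', []) = m" "nmem s1 (''e'', []) = e" "cnt s1 = cnt s"
    "\<And>r j k. entry s1 r j k = entry s r j k"
    using fr s by (auto simp: frame_def input_mem_def)
  have ech: "echelon m e s1" using inv1 by (simp add: rows_inv_def)
  have u: "dense m e (cur s1) = comb m bs ?mo"
    using s1 s(1) i degree_le_D(1)[OF i(1)] by (intro dense_shift) (auto simp: input_mem_def)
  have "dense m e (\<lambda>j. cur s1 (m + j)) = comb m bs ?mo"
    using s1 s(1) i degree_le_D(1)[OF i(1)] by (intro dense_shift) (auto simp: input_mem_def)
  then have w: "dense m e (\<lambda>j. cur s1 (m + j)) = comb m bs ?mo + comb m as (\<lambda>_. 0)"
    by (simp add: comb_zero)
  let ?Q = "\<lambda>s'. frame insert_nvars insert_fvars s s' \<and> rows_inv e J (K(i := Suc (K i))) s' \<and>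
       cnt s' \<le> Suc (cnt s) \<and>
       (nmem s' (''f'', []) = 0 \<and>
         (\<exists>x y. degs_below m K x \<and> dense m e (cur s') = comb m bs (\<lambda>i'. ?mo i' - x i') \<and>
            dense m e (cur s') = comb m as y) \<or>
        nmem s' (''f'', []) = 1 \<and> \<not> in_rows m e s (comb m bs ?mo))"
  show "runs insert_row s1 (insert_time m e R) ?Q"
  proof (rule runs_mono[OF runs_insert_row[OF n1(1,2) ech] order_refl])
    show "cnt s1 \<le> R" using s(4) n1 by simp
    fix s2 assume ins: "inserted m e s1 s2"
    have "frame insert_nvars insert_fvars s1 s2" using ins by (simp add: inserted_def)
    from frame_trans[OF fr this] have fr2: "frame insert_nvars insert_fvars s s2" by auto
    have gen: "\<exists>x' y' c. degs_below m J y' \<and> degs_below m K x' \<and>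
        comb m as y + comb m bs x = (comb m as y' + comb m bs x') + [:c:] \<cdot>\<^sub>v (comb m bs ?mo + comb m as (\<lambda>_. 0))"
      if y: "degs_below m J y" and x: "degs_below m (K(i := Suc (K i))) x" for x y
    proof -
      let ?c = "coeff (x i) (K i)"
      let ?x = "\<lambda>i'. x i' - [:?c:] * unit_monom i (K i) i'"
      have split: "comb m bs x = comb m bs ?x + [:?c:] \<cdot>\<^sub>v comb m bs ?mo" by (rule comb_split)
      have "comb m as y + comb m bs x
        = (comb m as y + comb m bs ?x) + [:?c:] \<cdot>\<^sub>v (comb m bs ?mo + comb m as (\<lambda>_. 0))"
        unfolding split by (rule eq_vecI) (auto simp: comb_def)
      then show ?thesis using degs_below_split[OF x] y by blast
    qed
    have K: "K i' \<le> (K(i := Suc (K i))) i'" for i' by simp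
    have inv2: "rows_inv e J (K(i := Suc (K i))) s2"
      by (rule rows_inv_inserted(1)[OF inv1 ins K degs_below_unit_monom u w gen])
    have dep: "nmem s2 (''f'', []) = 0" if "in_rows m e s1 (comb m bs ?mo + comb m as (\<lambda>_. 0))"
      using that by (rule rows_inv_inserted(3)[where J' = J, OF inv1 ins K degs_below_unit_monom u w gen, rotated -1])
    obtain x y where xy: "degs_below m K x" "dense m e (cur s2) = comb m bs (\<lambda>i. ?mo i - x i)"
       "dense m e (\<lambda>j. cur s2 (m + j)) = comb m bs (\<lambda>i. ?mo i - x i) + comb m as y"
      using rows_inv_inserted(2)[where J' = J, OF inv1 ins K degs_below_unit_monom u w gen] by blast
    have rin: "in_rows m e s1 v = in_rows m e s v" for v
      unfolding in_rows_def n1 ..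
    have "nmem s2 (''f'', []) = 0 \<and>
         (\<exists>x y. degs_below m K x \<and> dense m e (cur s2) = comb m bs (\<lambda>i'. ?mo i' - x i') \<and>
            dense m e (cur s2) = comb m as y) \<or>
        nmem s2 (''f'', []) = 1 \<and> \<not> in_rows m e s (comb m bs ?mo)"
    proof (cases "nmem s2 (''f'', []) = 0")
      case True
      then have "\<forall>j<2*m. \<forall>k\<le>e. m \<le> j \<longrightarrow> cur s2 j k = 0" using ins unfolding inserted_def by auto
      then have "dense m e (\<lambda>j. cur s2 (m + j)) = dense m e (\<lambda>_ _. 0)" by (intro dense_cong) auto
      then have z: "comb m bs (\<lambda>i. ?mo i - x i) + comb m as y = 0\<^sub>v m" using xy(3) dense_zero by metis
      have "comb m bs (\<lambda>i. ?mo i - x i) = comb m as (\<lambda>i. (-1) * y i)"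
        unfolding comb_smult
      proof (rule eq_vecI)
        fix j assume "j < dim_vec ((-1) \<cdot>\<^sub>v comb m as y)"
        then have j: "j < m" by (simp add: comb_def)
        have "(comb m bs (\<lambda>i. ?mo i - x i) + comb m as y) $ j = 0" using z j by simp
        then show "comb m bs (\<lambda>i. ?mo i - x i) $ j = ((-1) \<cdot>\<^sub>v comb m as y) $ j"
          using j by (simp add: comb_def eq_neg_iff_add_eq_0)
      qed (simp add: comb_def)
      then show ?thesis using True xy(1,2) by metis
    next
      case False
      then have "nmem s2 (''f'', []) = 1" using ins unfolding inserted_def by auto
      moreover have "\<not> in_rows m e s (comb m bs ?mo)"
        using False dep by (auto simp: rin comb_zero)
      ultimately show ?thesis by blast
    qed
    moreover have "cnt s2 \<le> Suc (cnt s)" using ins n1 unfolding inserted_def by auto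
    ultimately show "?Q s2" using fr2 inv2 by blast
  qed
qed (use s i in auto)

text \<open>In terms of the quotient: the monomials z^k b_i with k < \<open>K i\<close> are linearly
  independent over F modulo \<open>M\<close>.\<close>

definition independent :: "(nat \<Rightarrow> nat) \<Rightarrow> bool" where
  "independent K \<longleftrightarrow> (\<forall>x. degs_below m K x \<longrightarrow> comb m bs x \<in> M \<longrightarrow> (\<forall>i<m. x i = 0))"

lemma independent_sum_le: "independent K \<Longrightarrow> (\<Sum>i<m. K i) \<le> quot_dim m M"
  unfolding independent_def by (rule sum_le_quot_dim) blast

text \<open>A relation in \<open>M\<close> in which the new monomial has a nonzero coefficient
  \<open>c\<close> can be solved for that monomial. The coordinates with respect to
  \<open>as\<close> have degree below \<open>q\<close>, so the monomial would lie in the span of the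
  rows, contrary to \<open>new\<close>.\<close>

lemma independent_Suc:
  assumes K: "independent K" and i: "i < m" and inv: "rows_inv e (\<lambda>_. q) K s"
    and new: "\<not> in_rows m e s (comb m bs (unit_monom i (K i)))"
    and q: "m * D + m * (m * D) + D + 1 \<le> q"
  shows "independent (K(i := Suc (K i)))"
  unfolding independent_def
proof (intro allI impI)
  fix x i' assume x: "degs_below m (K(i := Suc (K i))) x" and xM: "comb m bs x \<in> M" and i': "i' < m"
  define c where "c = coeff (x i) (K i)"
  define x' where "x' = (\<lambda>i'. x i' - [:c:] * unit_monom i (K i) i')"
  have x': "degs_below m K x'" using degs_below_split[OF x] by (simp add: x'_def c_def)
  show "x i' = 0"
  proof (cases "c = 0")
    case True
    then have "x' = x" by (simp add: x'_def)
    then show ?thesis using K x' xM i' unfolding independent_def by blast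
  next
    case False
    obtain y where y: "comb m bs x = comb m as y" using xM M_eq by auto
    \<comment> \<open>The old exponents sum to at most d, hence to at most m^2 D. With this bound
      \<open>comb_eq_degs_below\<close> yields exactly the lower bound assumed for
      \<open>q\<close>.\<close>
    have "(K(i := Suc (K i))) k \<le> m * (m * D) + 1" if "k < m" for k
    proof -
      have "K k \<le> (\<Sum>k<m. K k)" using that by (intro member_le_sum) auto
      then show ?thesis using independent_sum_le[OF K] quot_dim_bounds(2) by auto
    qed
    from comb_eq_degs_below[OF x this y[symmetric]]
    have "degs_below m (\<lambda>_. q) y" using q by (rule_tac degs_below_weaken) auto
    then have 1: "degs_below m (\<lambda>_. q) (\<lambda>i. [:inverse c:] * y i)" by (simp add: degs_below_def)
    have 2: "degs_below m K (\<lambda>i. [:- inverse c:] * x' i)" using x' by (simp add: degs_below_def)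
    have "comb m bs x = comb m bs x' + [:c:] \<cdot>\<^sub>v comb m bs (unit_monom i (K i))"
      unfolding x'_def by (rule comb_split)
    then have yx: "comb m as y = comb m bs x' + [:c:] \<cdot>\<^sub>v comb m bs (unit_monom i (K i))" using y by simp
    have "comb m as (\<lambda>i. [:inverse c:] * y i) + comb m bs (\<lambda>i. [:- inverse c:] * x' i)
      = comb m bs (unit_monom i (K i))"
      unfolding comb_smult yx
      by (rule eq_vecI) (use False in \<open>auto simp: comb_def smult_add_right\<close>)
    moreover have "in_rows m e s (comb m as (\<lambda>i. [:inverse c:] * y i) + comb m bs (\<lambda>i. [:- inverse c:] * x' i))"
      using inv 1 2 unfolding rows_inv_def by blast
    ultimately show ?thesis using new by simp
  qed
qed

definition short_vector :: "'a poly vec \<Rightarrow> bool" where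
  "short_vector v \<longleftrightarrow> v \<in> M \<and> v \<noteq> 0\<^sub>v m \<and>
     N v \<le> root m (\<Prod>i<m. N (bs ! i)) * C powr (real (quot_dim m M) / real m)"

text \<open>Let t be the norm of the candidate. \<open>ord\<close> bounds all monomials used before
  by t and so gives N v at most t; \<open>min\<close> bounds t by the next monomial of every b_h,
  which is what \<open>threshold_le\<close> multiplies up.\<close>

lemma short_vectorI:
  assumes K: "independent K" and i: "i < m"
    and min: "\<And>h. h < m \<Longrightarrow> C ^ K i * N (bs ! i) \<le> C ^ K h * N (bs ! h)"
    and ord: "\<And>h. h < m \<Longrightarrow> K h > 0 \<Longrightarrow> C ^ (K h - 1) * N (bs ! h) \<le> C ^ K i * N (bs ! i)"
    and x: "degs_below m K x" and v: "v = comb m bs (\<lambda>i'. unit_monom i (K i) i' - x i')" "v = comb m as y"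
  shows "short_vector v"
  unfolding short_vector_def
proof (intro conjI)
  show "v \<in> M" using v(2) M_eq by auto
  show "v \<noteq> 0\<^sub>v m"
  proof
    assume "v = 0\<^sub>v m"
    then have "\<forall>i'<m. unit_monom i (K i) i' - x i' = 0" using bs_indep[OF v(1)[symmetric, THEN trans]] by simp
    then have "unit_monom i (K i) i - x i = 0" using i by blast
    \<comment> \<open>At exponent \<open>K i\<close> the new monomial contributes 1, while
      \<open>x i\<close> has only smaller exponents, so nothing can cancel.\<close>
    then have "coeff (monom (1::'a) (K i)) (K i) = coeff (x i) (K i)" by (simp add: unit_monom_def)
    then show False using x i by (simp add: degs_below_def)
  qed
  let ?t = "C ^ K i * N (bs ! i)"
  have t: "?t \<ge> 0" using C norm_nonneg[OF bs_carrier[OF i]] by simp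
  have "N v \<le> ?t"
    unfolding v(1)
  \<comment> \<open>The exponent \<open>K i\<close> now occurs, so the bound for b_i becomes
    \<open>Suc (K i)\<close>, whose predecessor gives exactly \<open>?t\<close>.\<close>
  proof (rule norm_comb_le[where K = "K(i := Suc (K i))"])
    have "degs_below m (K(i := Suc (K i))) x" using x by (rule degs_below_weaken) simp
    then show "degs_below m (K(i := Suc (K i))) (\<lambda>i'. unit_monom i (K i) i' - x i')"
      using degs_below_unit_monom[of m K i] unfolding degs_below_def by simp
    show "C ^ ((K(i := Suc (K i))) h - 1) * N (bs ! h) \<le> ?t" if "h < m" "(K(i := Suc (K i))) h > 0" for h
      using that ord by (cases "h = i") auto
  qed (rule t)
  also have "?t \<le> root m (\<Prod>i<m. N (bs ! i)) * C powr (real (quot_dim m M) / real m)"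
    by (rule threshold_le[OF t min independent_sum_le[OF K]])
  finally show "N v \<le> root m (\<Prod>i<m. N (bs ! i)) * C powr (real (quot_dim m M) / real m)" .
qed

end

section \<open>The greedy algorithm\<close>

lemma frame_setn: "frame {x} {} s (setn x v s)"
  by (simp add: frame_def)

text \<open>Nested loops replace the multiplication that natural numbers lack. The value q = 3 m^2
  (D + 1) majorizes m D + m^2 D + D + 1, and e = 2 q leaves room for z^k a_i with k < q as well as
  for z^k b_i with k at most d.\<close>

definition sizes :: com where
  "sizes = Seq (For ''i'' (var ''m'') (For ''j'' (var ''m'') (NAssign ''q'' []
       (NAdd (var ''q'') (NAdd (NAdd (var ''D'') (NConst 1))
          (NAdd (NAdd (var ''D'') (NConst 1)) (NAdd (var ''D'') (NConst 1))))))))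
     (NAssign ''e'' [] (NAdd (var ''q'') (var ''q'')))"

lemma runs_sizes:
  assumes m: "nmem s (''m'', []) = m" and D: "nmem s (''D'', []) = D" and q: "nmem s (''q'', []) = 0"
  shows "runs sizes s (m * (m * 30 + 20) + 20) (\<lambda>s'. frame {''i'', ''j'', ''q'', ''e''} {} s s' \<and>
    nmem s' (''q'', []) = m * (m * (3 * (D + 1))) \<and> nmem s' (''e'', []) = 2 * (m * (m * (3 * (D + 1)))))"
  unfolding sizes_def
proof (rule runs_Seq)
  let ?F = "frame {''i'', ''j'', ''q''} {} s"
  let ?c = "NAssign ''q'' [] (NAdd (var ''q'') (NAdd (NAdd (var ''D'') (NConst 1))
          (NAdd (NAdd (var ''D'') (NConst 1)) (NAdd (var ''D'') (NConst 1)))))"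
  show "runs (For ''i'' (var ''m'') (For ''j'' (var ''m'') ?c)) s (m * ((m * (20 + 10) + 10) + 10) + 10)
    (\<lambda>s'. ?F s' \<and> nmem s' (''q'', []) = m * (m * (3 * (D + 1))))"
  proof (rule runs_For[where I = "\<lambda>a s'. ?F s' \<and> nmem s' (''q'', []) = a * (m * (3 * (D + 1)))"])
    show "?F (setn ''i'' 0 s) \<and> nmem (setn ''i'' 0 s) (''q'', []) = 0 * (m * (3 * (D + 1)))"
      using q by (auto simp: frame_def)
    show "nval (var ''m'') s' = m" if "?F s' \<and> nmem s' (''q'', []) = a * (m * (3 * (D + 1)))" for a s'
      using that m by (auto simp: frame_def)
    fix a s' assume a: "?F s' \<and> nmem s' (''q'', []) = a * (m * (3 * (D + 1)))" "nmem s' (''i'', []) = a"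
    have "runs (For ''j'' (var ''m'') ?c) s' (m * (20 + 10) + 10)
      (\<lambda>s'. ?F s' \<and> nmem s' (''i'', []) = a \<and> nmem s' (''q'', []) = a * (m * (3 * (D + 1))) + m * (3 * (D + 1)))"
    proof (rule runs_For[where I = "\<lambda>b s'. ?F s' \<and> nmem s' (''i'', []) = a \<and> nmem s' (''q'', []) = a * (m * (3 * (D + 1))) + b * (3 * (D + 1))"])
      show "?F (setn ''j'' 0 s') \<and> nmem (setn ''j'' 0 s') (''i'', []) = a \<and>
        nmem (setn ''j'' 0 s') (''q'', []) = a * (m * (3 * (D + 1))) + 0 * (3 * (D + 1))"
        using a by (auto simp: frame_def)
      show "nval (var ''m'') s' = m"
        if "?F s' \<and> nmem s' (''i'', []) = a \<and> nmem s' (''q'', []) = a * (m * (3 * (D + 1))) + b * (3 * (D + 1))"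
        for b s'
        using that m by (auto simp: frame_def)
      fix b s' assume b: "?F s' \<and> nmem s' (''i'', []) = a \<and>
        nmem s' (''q'', []) = a * (m * (3 * (D + 1))) + b * (3 * (D + 1))" "nmem s' (''j'', []) = b"
      have "nmem s' (''D'', []) = D" using b D by (auto simp: frame_def)
      then show "runs ?c s' 20 (\<lambda>s'. nmem s' (''j'', []) = b \<and> ?F (setn ''j'' (Suc b) s') \<and>
        nmem (setn ''j'' (Suc b) s') (''i'', []) = a \<and>
        nmem (setn ''j'' (Suc b) s') (''q'', []) = a * (m * (3 * (D + 1))) + Suc b * (3 * (D + 1)))"
        by (intro runs_NAssign) (use b in \<open>auto simp: frame_def\<close>)
    qed simp
    then show "runs (For ''j'' (var ''m'') ?c) s' (m * (20 + 10) + 10)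
      (\<lambda>s'. nmem s' (''i'', []) = a \<and> ?F (setn ''i'' (Suc a) s') \<and>
        nmem (setn ''i'' (Suc a) s') (''q'', []) = Suc a * (m * (3 * (D + 1))))"
      by (rule runs_mono) (auto simp: frame_def)
  qed simp
  fix s' assume s': "?F s' \<and> nmem s' (''q'', []) = m * (m * (3 * (D + 1)))"
  show "runs (NAssign ''e'' [] (NAdd (var ''q'') (var ''q''))) s' 10 (\<lambda>s'. frame {''i'', ''j'', ''q'', ''e''} {} s s' \<and>
    nmem s' (''q'', []) = m * (m * (3 * (D + 1))) \<and> nmem s' (''e'', []) = 2 * (m * (m * (3 * (D + 1)))))"
    by (rule runs_NAssign) (use s' in \<open>auto simp: frame_def\<close>)
qed simp

definition argmin :: com where
  "argmin = Seq (NAssign ''i'' [] (NConst 0)) (For ''h'' (var ''m'')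
     (IfThen (RLe (RRef ''norm'' [var ''h'']) (RRef ''norm'' [var ''i''])) (NAssign ''i'' [] (var ''h'')) Skip))"

lemma runs_argmin:
  assumes m: "nmem s (''m'', []) = m" "m \<ge> 1"
  shows "runs argmin s (m * 20 + 20) (\<lambda>s'. frame {''i'', ''h''} {} s s' \<and> nmem s' (''i'', []) < m \<and>
    (\<forall>h<m. rmem s (''norm'', [nmem s' (''i'', [])]) \<le> rmem s (''norm'', [h])))"
  unfolding argmin_def
proof (rule runs_Seq_NAssign)
  let ?I = "\<lambda>a s'. frame {''i'', ''h''} {} s s' \<and> nmem s' (''i'', []) < m \<and>
    (\<forall>h<a. rmem s (''norm'', [nmem s' (''i'', [])]) \<le> rmem s (''norm'', [h]))"
  let ?s = "s\<lparr>nmem := (nmem s)((''i'', map (\<lambda>i. nval i s) []) := nval (NConst 0) s)\<rparr>"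
  have "runs (For ''h'' (var ''m'')
     (IfThen (RLe (RRef ''norm'' [var ''h'']) (RRef ''norm'' [var ''i''])) (NAssign ''i'' [] (var ''h'')) Skip))
     ?s (m * (10 + 10) + 10) (?I m)"
  proof (rule runs_For[where I = ?I])
    show "?I 0 (setn ''h'' 0 ?s)" using m by (auto simp: frame_def)
    show "nval (var ''m'') s' = m" if "?I a s'" for a s' using that m by (auto simp: frame_def)
    fix a s' assume I: "?I a s'" and a: "a < m" "nmem s' (''h'', []) = a"
    have r: "rmem s' = rmem s" using I by (auto simp: frame_def)
    have trans: "rmem s (''norm'', [a]) \<le> rmem s (''norm'', [h])"
      if "rmem s (''norm'', [a]) \<le> rmem s (''norm'', [nmem s' (''i'', [])])" "h < Suc a" for h
      using that I by (cases "h = a") (auto intro: order_trans)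
    have F: "frame {''i'', ''h''} {} s (s'\<lparr>nmem := (nmem s')((''i'', []) := a)\<rparr>)"
      "frame {''i'', ''h''} {} s (setn ''h'' (Suc a) (s'\<lparr>nmem := (nmem s')((''i'', []) := a)\<rparr>))"
      "frame {''i'', ''h''} {} s (setn ''h'' (Suc a) s')"
      using I by (auto simp: frame_def)
    show "runs (IfThen (RLe (RRef ''norm'' [var ''h'']) (RRef ''norm'' [var ''i''])) (NAssign ''i'' [] (var ''h'')) Skip)
      s' 10 (\<lambda>s'. nmem s' (''h'', []) = a \<and> ?I (Suc a) (setn ''h'' (Suc a) s'))"
    proof (intro runs_If runs_NAssign runs_Skip)
      assume "bval (RLe (RRef ''norm'' [var ''h'']) (RRef ''norm'' [var ''i''])) s'"
      then have "rmem s (''norm'', [a]) \<le> rmem s (''norm'', [nmem s' (''i'', [])])" using r a by simp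
      then show "nmem (s'\<lparr>nmem := (nmem s')((''i'', map (\<lambda>i. nval i s') []) := nval (var ''h'') s')\<rparr>) (''h'', []) = a \<and>
        ?I (Suc a) (setn ''h'' (Suc a) (s'\<lparr>nmem := (nmem s')((''i'', map (\<lambda>i. nval i s') []) := nval (var ''h'') s')\<rparr>))"
        using trans F a by simp
    next
      assume "\<not> bval (RLe (RRef ''norm'' [var ''h'']) (RRef ''norm'' [var ''i''])) s'"
      then have "rmem s (''norm'', [nmem s' (''i'', [])]) \<le> rmem s (''norm'', [a])" using r a by simp
      then show "nmem s' (''h'', []) = a \<and> ?I (Suc a) (setn ''h'' (Suc a) s')"
        using I F a by (auto simp: less_Suc_eq)
    qed simp_all
  qed simp
  then show "runs (For ''h'' (var ''m'')
     (IfThen (RLe (RRef ''norm'' [var ''h'']) (RRef ''norm'' [var ''i''])) (NAssign ''i'' [] (var ''h'')) Skip))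
     ?s (m * 20 + 20 - (1 + sum_list (map ncost []) + ncost (NConst 0))) (?I m)"
    by (rule runs_mono) auto
qed simp

text \<open>The array \<open>o\<close> is never written and therefore zero: the vectors \<open>z\<^sup>s a\<^sub>i\<close> are inserted with \<open>u = 0\<close>.\<close>

definition module_phase :: com where
  "module_phase = For ''s'' (var ''q'') (For ''i'' (var ''m'') (Seq (load ''o'' ''a'') insert_row))"

text \<open>The cell \<open>norm i\<close> is kept equal to the norm of the next candidate \<open>z^K\<^sub>i b\<^sub>i\<close>. When the new vector reduces to
  \<open>w = 0\<close>, its \<open>u\<close> part is already in place as the output.\<close>

definition greedy_step :: com where
  "greedy_step = Seq argmin (Seq (NAssign ''s'' [] (NRef ''K'' [var ''i'']))
     (Seq (Seq (load ''b'' ''b'') insert_row)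
     (Seq (RAssign ''norm'' [var ''i''] (RMul (RRef ''norm'' [var ''i'']) (RRef ''C'' [])))
       (NAssign ''K'' [var ''i''] (NAdd (NRef ''K'' [var ''i'']) (NConst 1))))))"

text \<open>The cell \<open>f\<close> is set to 1 before the loop because the insertions of the
  module phase leave their own verdict in it.\<close>

definition short_vector_prog :: com where
  "short_vector_prog = Seq sizes (Seq module_phase (Seq (NAssign ''f'' [] (NConst 1))
     (While (NLess (NConst 0) (var ''f'')) greedy_step)))"

context lattice
begin

lemma rows_inv_init: "cnt s = 0 \<Longrightarrow> rows_inv e (\<lambda>_. 0) (\<lambda>_. 0) s"
proof -
  assume c: "cnt s = 0"
  have "comb m xs x = 0\<^sub>v m" if "degs_below m (\<lambda>_. 0) x" for x and xs :: "'a poly vec list"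
  proof -
    have "x i = 0" if "i < m" for i
      using \<open>degs_below m (\<lambda>_. 0) x\<close> that by (simp add: degs_below_def poly_eq_iff)
    then show ?thesis by (intro eq_vecI) (auto simp: comb_def)
  qed
  then show ?thesis using c in_rows_zero[of m e s] by (auto simp: rows_inv_def echelon_def)
qed

lemma runs_module_phase:
  assumes s: "input_mem s" "nmem s (''e'', []) = e" "nmem s (''q'', []) = q" "cnt s = 0"
    and e: "q + D \<le> e" and R: "q * m \<le> R"
  shows "runs module_phase s (q * (m * (JK_time m e 20 + insert_time m e R + 10) + 20) + 10)
    (\<lambda>s'. frame (insert_nvars \<union> {''i'', ''s''}) insert_fvars s s' \<and>
       rows_inv e (\<lambda>_. q) (\<lambda>_. 0) s' \<and> cnt s' \<le> q * m)"
proof -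
  let ?F = "frame (insert_nvars \<union> {''i'', ''s''}) insert_fvars s"
  let ?I = "\<lambda>a s'. ?F s' \<and> rows_inv e (\<lambda>_. a) (\<lambda>_. 0) s' \<and> cnt s' \<le> a * m"
  let ?T = "JK_time m e 20 + insert_time m e R"
  have m': "nmem s (''m'', []) = m" using s by (simp add: input_mem_def)
  have rs: "rows_inv e J K (setn x v s')"
    if "rows_inv e J K s'" "x \<in> {''i'', ''s''}" for J K x v s'
    using that(2) by (intro rows_inv_frame[OF that(1) frame_setn]) auto
  have "runs module_phase s (q * ((m * (?T + 10) + 10) + 10) + 10) (?I q)"
    unfolding module_phase_def
  proof (rule runs_For[where I = ?I])
    show "?I 0 (setn ''s'' 0 s)"
      using rs[OF rows_inv_init[OF s(4)]] s(4) by (auto simp: frame_def)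
    show "nval (var ''q'') s' = q" if "?I a s'" for a s' using that s by (auto simp: frame_def)
    fix a s' assume I: "?I a s'" and a: "a < q" "nmem s' (''s'', []) = a"
    \<comment> \<open>In the middle of round \<open>a\<close> the first \<open>b\<close> basis
      vectors have been inserted with exponents up to \<open>a\<close>, the others with smaller ones
      only.\<close>
    let ?J = "\<lambda>b i. if i < b then Suc a else a"
    let ?I' = "\<lambda>b s'. ?F s' \<and> nmem s' (''s'', []) = a \<and> rows_inv e (?J b) (\<lambda>_. 0) s' \<and> cnt s' \<le> a * m + b"
    have "runs (For ''i'' (var ''m'') (Seq (load ''o'' ''a'') insert_row)) s' (m * (?T + 10) + 10) (?I' m)"
    proof (rule runs_For[where I = ?I'])
      show "?I' 0 (setn ''i'' 0 s')" using I a rs by (auto simp: frame_def)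
      show "nval (var ''m'') s' = m" if "?I' b s'" for b s' using that m' by (auto simp: frame_def)
      fix b s' assume I': "?I' b s'" and b: "b < m" "nmem s' (''i'', []) = b"
      have F: "?F s'" using I' by blast
      have in': "input_mem s'" by (rule input_mem_frame[OF s(1) F]) auto
      have e': "nmem s' (''e'', []) = e" using F s by (auto simp: frame_def)
      have "a * m + b \<le> q * m"
      proof -
        have "a * m + b \<le> Suc a * m" using b by simp
        also have "\<dots> \<le> q * m" using a by (intro mult_le_mono1) simp
        finally show ?thesis .
      qed
      then have c: "cnt s' \<le> R" using I' R by linarith
      have J: "(?J b)(b := Suc (?J b b)) = ?J (Suc b)" by auto
      have "runs (Seq (load ''o'' ''a'') insert_row) s' ?T
        (\<lambda>s''. frame insert_nvars insert_fvars s' s'' \<and> rows_inv e ((?J b)(b := Suc (?J b b))) (\<lambda>_. 0) s'' \<and>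
           cnt s'' \<le> Suc (cnt s'))"
        using I' b a e by (intro runs_insert_a in' e' c) auto
      then show "runs (Seq (load ''o'' ''a'') insert_row) s' ?T
        (\<lambda>s'. nmem s' (''i'', []) = b \<and> ?I' (Suc b) (setn ''i'' (Suc b) s'))"
      proof (rule runs_mono[OF _ order_refl])
        fix s'' assume s'': "frame insert_nvars insert_fvars s' s'' \<and>
          rows_inv e ((?J b)(b := Suc (?J b b))) (\<lambda>_. 0) s'' \<and> cnt s'' \<le> Suc (cnt s')"
        have "?F s''" by (rule frame_trans[OF F conjunct1[OF s'']]) auto
        then have "?F (setn ''i'' (Suc b) s'')" by (auto simp: frame_def)
        moreover have "nmem s'' (''i'', []) = b" "nmem s'' (''s'', []) = a"
          using s'' I' b by (auto simp: frame_def)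
        moreover have "rows_inv e (?J (Suc b)) (\<lambda>_. 0) (setn ''i'' (Suc b) s'')"
          using s'' rs unfolding J by blast
        moreover have "cnt s'' \<le> a * m + Suc b" using s'' I' by linarith
        ultimately show "nmem s'' (''i'', []) = b \<and> ?I' (Suc b) (setn ''i'' (Suc b) s'')" by simp
      qed
    qed simp
    then show "runs (For ''i'' (var ''m'') (Seq (load ''o'' ''a'') insert_row)) s' (m * (?T + 10) + 10)
      (\<lambda>s'. nmem s' (''s'', []) = a \<and> ?I (Suc a) (setn ''s'' (Suc a) s'))"
    proof (rule runs_mono[OF _ order_refl])
      fix s' assume I': "?I' m s'"
      have "rows_inv e (\<lambda>_. Suc a) (\<lambda>_. 0) s'"
      proof -
        \<comment> \<open>After the last basis vector \<open>?J m\<close> agrees with the constant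
          \<open>Suc a\<close> on the indices below \<open>m\<close>, the only ones that
          \<open>degs_below\<close> inspects.\<close>
        have "degs_below m (?J m) y" if "degs_below m (\<lambda>_. Suc a) y" for y :: "nat \<Rightarrow> 'a poly"
          using that by (auto simp: degs_below_def)
        then show ?thesis using I' unfolding rows_inv_def by blast
      qed
      then have "rows_inv e (\<lambda>_. Suc a) (\<lambda>_. 0) (setn ''s'' (Suc a) s')" using rs by blast
      moreover have "?F (setn ''s'' (Suc a) s')" using I' by (auto simp: frame_def)
      ultimately show "nmem s' (''s'', []) = a \<and> ?I (Suc a) (setn ''s'' (Suc a) s')" using I' by simp
    qed
  qed simp
  then show ?thesis by (rule runs_mono) simp_all
qed

abbreviation "exps s \<equiv> \<lambda>i. nmem s (''K'', [i])"

definition ordered :: "(nat \<Rightarrow> nat) \<Rightarrow> bool" where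
  "ordered K \<longleftrightarrow> (\<forall>i<m. \<forall>h<m. K i > 0 \<longrightarrow> C ^ (K i - 1) * N (bs ! i) \<le> C ^ K h * N (bs ! h))"

text \<open>The monomial just consumed was the smallest candidate, and since C > 1 its successor is
  only larger; so no consumed monomial can exceed a candidate.\<close>

lemma ordered_Suc:
  assumes "ordered K" "i < m" and min: "\<And>h. h < m \<Longrightarrow> C ^ K i * N (bs ! i) \<le> C ^ K h * N (bs ! h)"
  shows "ordered (K(i := Suc (K i)))"
  unfolding ordered_def
proof (intro allI impI)
  fix a h assume a: "a < m" and h: "h < m" and pos: "(K(i := Suc (K i))) a > 0"
  have "C ^ K h * N (bs ! h) \<le> C ^ (K(i := Suc (K i))) h * N (bs ! h)"
    using C norm_nonneg[OF bs_carrier[OF h]] by (intro mult_right_mono power_increasing) auto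
  moreover have "C ^ ((K(i := Suc (K i))) a - 1) * N (bs ! a) \<le> C ^ K h * N (bs ! h)"
    using assms a h pos by (cases "a = i") (auto simp: ordered_def)
  ultimately show "C ^ ((K(i := Suc (K i))) a - 1) * N (bs ! a) \<le> C ^ (K(i := Suc (K i))) h * N (bs ! h)"
    by simp
qed

text \<open>\<open>K\<close> is advanced in the final round as well, where the monomial was
  dependent; hence independence is claimed only while \<open>f\<close> is 1. The norms are tracked
  here and not in \<open>input_mem\<close> because the program rescales them.\<close>

definition greedy_inv :: "nat \<Rightarrow> nat \<Rightarrow> 'a memory \<Rightarrow> bool" where
  "greedy_inv e q s \<longleftrightarrow> input_mem s \<and> nmem s (''e'', []) = e \<and> rmem s (''C'', []) = C \<and>
     (\<forall>i<m. rmem s (''norm'', [i]) = C ^ exps s i * N (bs ! i)) \<and>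
     rows_inv e (\<lambda>_. q) (exps s) s \<and> cnt s \<le> q * m + (\<Sum>i<m. exps s i) \<and>
     (nmem s (''f'', []) = 1 \<and> independent (exps s) \<and> ordered (exps s) \<or>
      nmem s (''f'', []) = 0 \<and> short_vector (dense m e (cur s)))"

text \<open>While \<open>f\<close> is 1, independence keeps the sum of the exponents at most d, so
  \<open>Suc\<close> makes the measure positive and the final round, which sets it to 0, decreases
  it too.\<close>

definition greedy_measure :: "'a memory \<Rightarrow> nat" where
  "greedy_measure s = (if nmem s (''f'', []) = 0 then 0 else Suc (quot_dim m M) - (\<Sum>i<m. exps s i))"

definition greedy_time :: "nat \<Rightarrow> nat \<Rightarrow> nat" where
  "greedy_time e R = m * 20 + JK_time m e 20 + insert_time m e R + 50"

text \<open>The assumption on \<open>R\<close> reflects the number of rows: at most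
  \<open>q * m\<close> from the module phase and one for each monomial consumed, of which there are
  at most d, hence at most m^2 D.\<close>

lemma runs_greedy_step:
  assumes inv: "greedy_inv e q s" and f: "nmem s (''f'', []) \<noteq> 0"
    and q: "m * D + m * (m * D) + D + 1 \<le> q" and e: "m * (m * D) + D \<le> e"
    and R: "q * m + m * (m * D) \<le> R"
  shows "runs greedy_step s (greedy_time e R) (\<lambda>s'. greedy_inv e q s' \<and> greedy_measure s' < greedy_measure s)"
proof -
  let ?K = "exps s"
  have ind: "independent ?K" and ord: "ordered ?K" and f1: "nmem s (''f'', []) = 1"
    using inv f by (auto simp: greedy_inv_def)
  have ms: "nmem s (''m'', []) = m" using inv by (simp add: greedy_inv_def input_mem_def)
  have sum: "(\<Sum>i<m. ?K i) \<le> quot_dim m M" by (rule independent_sum_le[OF ind])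
  have sum': "(\<Sum>i<m. ?K i) \<le> m * (m * D)" using sum quot_dim_bounds(2) by simp
  show ?thesis unfolding greedy_step_def
  proof (rule runs_Seq[OF runs_argmin[OF ms m]])
    fix s1 assume s1: "frame {''i'', ''h''} {} s s1 \<and> nmem s1 (''i'', []) < m \<and>
      (\<forall>h<m. rmem s (''norm'', [nmem s1 (''i'', [])]) \<le> rmem s (''norm'', [h]))"
    define i where "i = nmem s1 (''i'', [])"
    have i: "i < m" using s1 by (simp add: i_def)
    have rC: "rmem s (''C'', []) = C" and rn: "\<And>h. h < m \<Longrightarrow> rmem s (''norm'', [h]) = C ^ ?K h * N (bs ! h)"
      using inv by (auto simp: greedy_inv_def)
    have "rmem s (''norm'', [i]) \<le> rmem s (''norm'', [h])" if "h < m" for h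
      using s1 that by (simp add: i_def)
    then have min: "C ^ ?K i * N (bs ! i) \<le> C ^ ?K h * N (bs ! h)" if "h < m" for h
      using that rn i by simp
    define s2 where "s2 = setn ''s'' (?K i) s1"
    have fr2: "frame {''i'', ''h'', ''s''} {} s s2"
      by (rule frame_trans[OF conjunct1[OF s1] frame_setn[of "''s''" s1 "?K i", folded s2_def]]) auto
    have k1: "exps s1 i = ?K i" using s1 by (simp add: frame_def)
    have in2: "input_mem s2"
      by (rule input_mem_frame[OF _ fr2]) (use inv in \<open>auto simp: greedy_inv_def\<close>)
    have rows2: "rows_inv e (\<lambda>_. q) ?K s2"
      by (rule rows_inv_frame[OF _ fr2]) (use inv in \<open>auto simp: greedy_inv_def\<close>)
    have n2: "nmem s2 (''e'', []) = e" "nmem s2 (''i'', []) = i" "nmem s2 (''s'', []) = ?K i" "cnt s2 = cnt s"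
      "\<And>h. exps s2 h = ?K h" "rmem s2 = rmem s"
      using fr2 inv by (auto simp: frame_def greedy_inv_def s2_def i_def)
    have c2: "cnt s2 \<le> R" using inv n2 sum' R by (simp add: greedy_inv_def)
    have "?K i \<le> (\<Sum>i<m. ?K i)" using i by (intro member_le_sum) auto
    then have Ki: "?K i + D \<le> e" using sum' e by linarith
    have ins: "runs (Seq (load ''b'' ''b'') insert_row) s2 (JK_time m e 20 + insert_time m e R)
      (\<lambda>s'. frame insert_nvars insert_fvars s2 s' \<and> rows_inv e (\<lambda>_. q) (?K(i := Suc (?K i))) s' \<and>
       cnt s' \<le> Suc (cnt s2) \<and>
       (nmem s' (''f'', []) = 0 \<and>
         (\<exists>x y. degs_below m ?K x \<and> dense m e (cur s') = comb m bs (\<lambda>i'. unit_monom i (?K i) i' - x i') \<and>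
            dense m e (cur s') = comb m as y) \<or>
        nmem s' (''f'', []) = 1 \<and> \<not> in_rows m e s2 (comb m bs (unit_monom i (?K i)))))"
      by (rule runs_insert_b[OF in2 n2(1) rows2 c2 i n2(2,3) Ki])
    let ?tail = "Seq (RAssign ''norm'' [var ''i''] (RMul (RRef ''norm'' [var ''i'']) (RRef ''C'' [])))
       (NAssign ''K'' [var ''i''] (NAdd (NRef ''K'' [var ''i'']) (NConst 1)))"
    have tail: "runs ?tail s3 20 (\<lambda>s'. greedy_inv e q s' \<and> greedy_measure s' < greedy_measure s)"
      if s3: "frame insert_nvars insert_fvars s2 s3" "rows_inv e (\<lambda>_. q) (?K(i := Suc (?K i))) s3"
       "cnt s3 \<le> Suc (cnt s2)"
       "nmem s3 (''f'', []) = 0 \<and>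
         (\<exists>x y. degs_below m ?K x \<and> dense m e (cur s3) = comb m bs (\<lambda>i'. unit_monom i (?K i) i' - x i') \<and>
            dense m e (cur s3) = comb m as y) \<or>
        nmem s3 (''f'', []) = 1 \<and> \<not> in_rows m e s2 (comb m bs (unit_monom i (?K i)))" for s3
    proof -
      have n3: "nmem s3 (''e'', []) = e" "nmem s3 (''i'', []) = i" "\<And>h. exps s3 h = ?K h" "rmem s3 = rmem s"
        using s3(1) n2 by (auto simp: frame_def)
      have in3: "input_mem s3" by (rule input_mem_frame[OF in2 s3(1)]) auto
      define s4 where "s4 = s3\<lparr>rmem := (rmem s3)((''norm'', [i]) := rmem s (''norm'', [i]) * C)\<rparr>"
      define s5 where "s5 = s4\<lparr>nmem := (nmem s4)((''K'', [i]) := Suc (?K i))\<rparr>"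
      have K5: "exps s5 = ?K(i := Suc (?K i))" using n3 by (auto simp: s5_def s4_def)
      have sum5: "(\<Sum>h<m. exps s5 h) = Suc (\<Sum>h<m. ?K h)"
        unfolding K5 using i by (simp add: sum.remove[of "{..<m}" i])
      have "greedy_inv e q s5" unfolding greedy_inv_def
      proof (intro conjI allI impI)
        show "input_mem s5" using in3 by (simp add: input_mem_def s5_def s4_def)
        show "nmem s5 (''e'', []) = e" using n3 by (simp add: s5_def s4_def)
        show "rmem s5 (''C'', []) = C" using n3 rC by (simp add: s5_def s4_def)
        show "rmem s5 (''norm'', [h]) = C ^ exps s5 h * N (bs ! h)" if "h < m" for h
          unfolding K5 using that rn n3 by (auto simp: s5_def s4_def)
        show "rows_inv e (\<lambda>_. q) (exps s5) s5"
          unfolding K5 using s3(2) unfolding rows_inv_def echelon_def in_rows_def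
          by (simp add: s5_def s4_def)
        have "cnt s5 = cnt s3" by (simp add: s5_def s4_def)
        then show "cnt s5 \<le> q * m + (\<Sum>i<m. exps s5 i)"
          using s3(3) n2 sum5 inv by (simp add: greedy_inv_def)
        have f5: "nmem s5 (''f'', []) = nmem s3 (''f'', [])" "cur s5 = cur s3"
          by (simp_all add: s5_def s4_def)
        show "nmem s5 (''f'', []) = 1 \<and> independent (exps s5) \<and> ordered (exps s5) \<or>
          nmem s5 (''f'', []) = 0 \<and> short_vector (dense m e (cur s5))"
          using s3(4)
        proof
          assume *: "nmem s3 (''f'', []) = 0 \<and>
            (\<exists>x y. degs_below m ?K x \<and> dense m e (cur s3) = comb m bs (\<lambda>i'. unit_monom i (?K i) i' - x i') \<and>
            dense m e (cur s3) = comb m as y)"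
          then obtain x y where xy: "degs_below m ?K x"
            "dense m e (cur s3) = comb m bs (\<lambda>i'. unit_monom i (?K i) i' - x i')" "dense m e (cur s3) = comb m as y"
            by blast
          have "C ^ (?K h - 1) * N (bs ! h) \<le> C ^ ?K i * N (bs ! i)" if "h < m" "?K h > 0" for h
            using ord i that by (simp add: ordered_def)
          from short_vectorI[OF ind i min this xy] have "short_vector (dense m e (cur s3))" .
          then show ?thesis unfolding f5 using * by blast
        next
          assume *: "nmem s3 (''f'', []) = 1 \<and> \<not> in_rows m e s2 (comb m bs (unit_monom i (?K i)))"
          have "independent (exps s5)"
            unfolding K5 by (rule independent_Suc[OF ind i rows2 conjunct2[OF *] q])
          moreover have "ordered (exps s5)" unfolding K5 by (rule ordered_Suc[OF ord i min])
          ultimately show ?thesis unfolding f5 using * by blast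
        qed
      qed
      moreover have "greedy_measure s5 < greedy_measure s"
        using f1 sum unfolding greedy_measure_def sum5 by auto
      ultimately have post: "greedy_inv e q s5 \<and> greedy_measure s5 < greedy_measure s" by blast
      show ?thesis
      proof (rule runs_Seq[where Q = "\<lambda>s'. s' = s4"])
        show "runs (RAssign ''norm'' [var ''i''] (RMul (RRef ''norm'' [var ''i'']) (RRef ''C'' []))) s3 10 (\<lambda>s'. s' = s4)"
          by (rule runs_RAssign) (simp_all add: s4_def n3 rC)
        show "runs (NAssign ''K'' [var ''i''] (NAdd (NRef ''K'' [var ''i'']) (NConst 1))) s' 10
          (\<lambda>s'. greedy_inv e q s' \<and> greedy_measure s' < greedy_measure s)" if "s' = s4" for s'
        proof (rule runs_mono[OF runs_NAssign[OF order_refl, where Q = "\<lambda>s'. s' = s5"]])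
          show "s'\<lparr>nmem := (nmem s')((''K'', map (\<lambda>i. nval i s') [var ''i'']) :=
            nval (NAdd (NRef ''K'' [var ''i'']) (NConst 1)) s')\<rparr> = s5"
            using n3 by (simp add: that s5_def s4_def)
        qed (use post in auto)
      qed simp
    qed
    show "runs (Seq (NAssign ''s'' [] (NRef ''K'' [var ''i''])) (Seq (Seq (load ''b'' ''b'') insert_row) ?tail)) s1
      (JK_time m e 20 + insert_time m e R + 30) (\<lambda>s'. greedy_inv e q s' \<and> greedy_measure s' < greedy_measure s)"
    proof (rule runs_Seq[where Q = "\<lambda>s'. s' = s2" and T = 5])
      show "runs (NAssign ''s'' [] (NRef ''K'' [var ''i''])) s1 5 (\<lambda>s'. s' = s2)"
        by (rule runs_NAssign) (use k1 in \<open>simp_all add: s2_def setn_def i_def\<close>)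
      show "runs (Seq (Seq (load ''b'' ''b'') insert_row) ?tail) s' (JK_time m e 20 + insert_time m e R + 20)
        (\<lambda>s'. greedy_inv e q s' \<and> greedy_measure s' < greedy_measure s)" if "s' = s2" for s'
        unfolding that by (rule runs_Seq[OF ins]) (use tail in auto)
    qed simp
  qed (simp add: greedy_time_def)
qed

lemma input_mem_init: "input_mem (init_memory C m N bs as)"
  by (simp add: input_mem_def init_memory_def split: list.split)

definition total_time :: "nat \<Rightarrow> nat \<Rightarrow> nat \<Rightarrow> nat" where
  "total_time q e R = (m * (m * 30 + 20) + 20) +
     (q * (m * (JK_time m e 20 + insert_time m e R + 10) + 20) + 10) + 2 +
     (Suc (quot_dim m M) * (3 + greedy_time e R) + 3)"

lemma runs_short_vector_prog:
  defines "q \<equiv> m * (m * (3 * (D + 1)))"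
  assumes R: "q * m + m * (m * D) \<le> R"
  shows "runs short_vector_prog (init_memory C m N bs as) (total_time q (2 * q) R)
    (\<lambda>s. nmem s (''e'', []) = 2 * q \<and> short_vector (output_vec m s))"
proof -
  let ?s = "init_memory C m N bs as"
  let ?e = "2 * q"
  \<comment> \<open>After expansion the requirements on \<open>q\<close> and \<open>e\<close> are
    linear in these products; they come down to m being at least 1.\<close>
  have mm: "1 \<le> m * m" "D \<le> m * (m * D)" "m * D \<le> m * (m * D)" using m by auto
  have q3: "q = 3 * (m * (m * D)) + 3 * (m * m)" by (simp add: q_def algebra_simps)
  have q: "m * D + m * (m * D) + D + 1 \<le> q" using mm unfolding q3 by linarith
  then have e: "m * (m * D) + D \<le> ?e" and e': "q + D \<le> ?e" by simp_all
  have init: "nmem ?s (''m'', []) = m" "nmem ?s (''D'', []) = D" "nmem ?s (''q'', []) = 0" "cnt ?s = 0"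
    "\<And>i. exps ?s i = 0" "rmem ?s (''C'', []) = C" "\<And>i. i < m \<Longrightarrow> rmem ?s (''norm'', [i]) = N (bs ! i)"
    by (simp_all add: init_memory_def)
  show ?thesis unfolding short_vector_prog_def
  proof (rule runs_Seq[OF runs_sizes[OF init(1-3)]])
    fix s1 assume "frame {''i'', ''j'', ''q'', ''e''} {} ?s s1 \<and>
      nmem s1 (''q'', []) = m * (m * (3 * (D + 1))) \<and> nmem s1 (''e'', []) = 2 * (m * (m * (3 * (D + 1))))"
    then have s1: "frame {''i'', ''j'', ''q'', ''e''} {} ?s s1" "nmem s1 (''q'', []) = q" "nmem s1 (''e'', []) = ?e"
      by (auto simp: q_def)
    have in1: "input_mem s1" by (rule input_mem_frame[OF input_mem_init s1(1)]) auto
    have c1: "cnt s1 = 0" using s1(1) init by (simp add: frame_def)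
    have R1: "q * m \<le> R" using R by linarith
    show "runs (Seq module_phase (Seq (NAssign ''f'' [] (NConst 1))
      (While (NLess (NConst 0) (var ''f'')) greedy_step))) s1
      ((q * (m * (JK_time m ?e 20 + insert_time m ?e R + 10) + 20) + 10) +
        (2 + (Suc (quot_dim m M) * (3 + greedy_time ?e R) + 3)))
      (\<lambda>s. nmem s (''e'', []) = ?e \<and> short_vector (output_vec m s))"
    proof (rule runs_Seq[OF runs_module_phase[OF in1 s1(3,2) c1 e' R1]])
      fix s2 assume s2: "frame (insert_nvars \<union> {''i'', ''s''}) insert_fvars s1 s2 \<and>
        rows_inv ?e (\<lambda>_. q) (\<lambda>_. 0) s2 \<and> cnt s2 \<le> q * m"
      define s3 where "s3 = setn ''f'' 1 s2"
      have fr2: "frame (insert_nvars \<union> {''i'', ''s''}) insert_fvars s1 s2" using s2 by blast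
      have in2: "input_mem s2" by (rule input_mem_frame[OF in1 fr2]) auto
      have n2: "nmem s2 (''e'', []) = ?e" "\<And>i. exps s2 i = 0" "rmem s2 = rmem ?s"
        using fr2 s1 init by (auto simp: frame_def)
      have "rows_inv ?e (\<lambda>_. q) (\<lambda>_. 0) s3"
        unfolding s3_def by (rule rows_inv_frame[OF _ frame_setn]) (use s2 in auto)
      moreover have "input_mem s3"
        unfolding s3_def by (rule input_mem_frame[OF in2 frame_setn]) auto
      moreover have "independent (\<lambda>_. 0)"
        by (auto simp: independent_def degs_below_def poly_eq_iff)
      moreover have "ordered (\<lambda>_. 0)" by (simp add: ordered_def)
      moreover have "exps s3 = (\<lambda>_. 0)" using n2 by (auto simp: s3_def)
      ultimately have inv3: "greedy_inv ?e q s3"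
        using n2 init s2 by (simp add: greedy_inv_def s3_def)
      show "runs (Seq (NAssign ''f'' [] (NConst 1)) (While (NLess (NConst 0) (var ''f'')) greedy_step)) s2
        (2 + (Suc (quot_dim m M) * (3 + greedy_time ?e R) + 3))
        (\<lambda>s. nmem s (''e'', []) = ?e \<and> short_vector (output_vec m s))"
      proof (rule runs_Seq[where Q = "\<lambda>s'. s' = s3" and T = 2])
        show "runs (NAssign ''f'' [] (NConst 1)) s2 2 (\<lambda>s'. s' = s3)"
          by (rule runs_NAssign) (simp_all add: s3_def setn_def)
        fix s' assume s': "s' = s3"
        have "runs (While (NLess (NConst 0) (var ''f'')) greedy_step) s3
          (Suc (quot_dim m M) * (bcost (NLess (NConst 0) (var ''f'')) + greedy_time ?e R) + bcost (NLess (NConst 0) (var ''f'')))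
          (\<lambda>s. greedy_inv ?e q s \<and> \<not> bval (NLess (NConst 0) (var ''f'')) s)"
        proof (rule runs_While_measure[where \<mu> = greedy_measure])
          show "greedy_measure s3 \<le> Suc (quot_dim m M)" by (simp add: greedy_measure_def)
          show "runs greedy_step s (greedy_time ?e R) (\<lambda>s'. greedy_inv ?e q s' \<and> greedy_measure s' < greedy_measure s)"
            if "greedy_inv ?e q s" "bval (NLess (NConst 0) (var ''f'')) s" for s
            using that by (intro runs_greedy_step[OF _ _ q e R]) auto
        qed (rule inv3)
        then show "runs (While (NLess (NConst 0) (var ''f'')) greedy_step) s'
          (Suc (quot_dim m M) * (3 + greedy_time ?e R) + 3)
          (\<lambda>s. nmem s (''e'', []) = ?e \<and> short_vector (output_vec m s))"
          unfolding s'
        proof (rule runs_mono)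
          fix s assume "greedy_inv ?e q s \<and> \<not> bval (NLess (NConst 0) (var ''f'')) s"
          then have "nmem s (''e'', []) = ?e" "short_vector (dense m ?e (cur s))"
            by (auto simp: greedy_inv_def)
          then show "nmem s (''e'', []) = ?e \<and> short_vector (output_vec m s)"
            by (simp add: output_vec_def dense_def)
        qed (simp add: eval_nat_numeral)
      qed simp
    qed simp
  qed (simp add: total_time_def)
qed

end

section \<open>Polynomial bound on the running time\<close>

lemma JK_time_mono: "m \<le> m' \<Longrightarrow> e \<le> e' \<Longrightarrow> JK_time m e T \<le> JK_time m' e' T"
  unfolding JK_time_def by (intro add_mono mult_le_mono) auto

lemma insert_time_mono:
  "m \<le> m' \<Longrightarrow> e \<le> e' \<Longrightarrow> R \<le> R' \<Longrightarrow> insert_time m e R \<le> insert_time m' e' R'"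
  unfolding insert_time_def reduce_time_def commit_time_def
  by (intro add_mono mult_le_mono JK_time_mono) auto

text \<open>This is \<open>total_time\<close> with every parameter replaced by a bound in the input
  size n: n for m and d, 2 n for q, 4 n for e, and 2 n^2 + n for R. The last summand pays for the
  output size.\<close>

definition time_bound :: "nat \<Rightarrow> nat" where
  "time_bound n = (n * (n * 30 + 20) + 20) +
     (2 * n * (n * (JK_time n (4 * n) 20 + insert_time n (4 * n) (2 * n * n + n) + 10) + 20) + 10) + 2 +
     ((n + 1) * (3 + (n * 20 + JK_time n (4 * n) 20 + insert_time n (4 * n) (2 * n * n + n) + 50)) + 3) +
     n * (4 * n + 1)"

text \<open>Closed under sums and products, which suffices for \<open>time_bound\<close> because its
  expression contains no subtraction.\<close>

definition is_poly :: "(nat \<Rightarrow> nat) \<Rightarrow> bool" where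
  "is_poly f \<longleftrightarrow> (\<exists>p. \<forall>n. poly p n = f n)"

lemma is_poly_const: "is_poly (\<lambda>_. c)"
  unfolding is_poly_def by (rule exI[of _ "[:c:]"]) simp

lemma is_poly_id: "is_poly (\<lambda>n. n)"
  unfolding is_poly_def by (rule exI[of _ "[:0, 1:]"]) simp

lemma is_poly_add: "is_poly f \<Longrightarrow> is_poly g \<Longrightarrow> is_poly (\<lambda>n. f n + g n)"
  unfolding is_poly_def by (metis poly_add)

lemma is_poly_mult: "is_poly f \<Longrightarrow> is_poly g \<Longrightarrow> is_poly (\<lambda>n. f n * g n)"
  unfolding is_poly_def by (metis poly_mult)

lemma is_poly_time_bound: "is_poly time_bound"
  unfolding time_bound_def JK_time_def insert_time_def reduce_time_def commit_time_def Suc_eq_plus1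
  by (intro is_poly_add is_poly_mult is_poly_id is_poly_const)

context lattice
begin

lemma total_time_le:
  defines "q \<equiv> m * (m * (3 * (D + 1)))"
  shows "total_time q (2 * q) (q * m + m * (m * D)) + m * (2 * q + 1) \<le> time_bound (input_size m bs as)"
proof -
  define n where "n = input_size m bs as"
  have n: "n = 2 * (m * (m * (D + 1))) + m" by (simp add: n_def input_size_def algebra_simps)
  have mn: "m \<le> n" by (simp add: n)
  have "q = 3 * (m * (m * (D + 1)))" by (simp add: q_def algebra_simps)
  \<comment> \<open>Here w stands for m^2 (D + 1), so that q is 3 w and the input size is 2 w +
    m.\<close>
  moreover have "3 * w \<le> 2 * (2 * w + m)" for w :: nat by simp
  ultimately have qn: "q \<le> 2 * n" unfolding n by (simp only:)
  then have en: "2 * q \<le> 4 * n" by simp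
  have dn: "m * (m * D) \<le> n" by (simp add: n algebra_simps)
  then have dim: "quot_dim m M \<le> n" using quot_dim_bounds(2) by linarith
  have Rn: "q * m + m * (m * D) \<le> 2 * n * n + n" by (intro add_mono mult_le_mono qn mn dn)
  show ?thesis unfolding n_def[symmetric] total_time_def time_bound_def greedy_time_def
    by (intro add_mono mult_le_mono JK_time_mono insert_time_mono order_refl mn qn en Rn)
      (use dim in simp)
qed

lemma short_vector_computable:
  "\<exists>t s. big_step short_vector_prog (init_memory C m N bs as) t s \<and>
     t + output_size m s \<le> time_bound (input_size m bs as) \<and> short_vector (output_vec m s)"
proof -
  define q where "q = m * (m * (3 * (D + 1)))"
  have "runs short_vector_prog (init_memory C m N bs as) (total_time q (2 * q) (q * m + m * (m * D)))
    (\<lambda>s. nmem s (''e'', []) = 2 * q \<and> short_vector (output_vec m s))"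
    unfolding q_def by (rule runs_short_vector_prog) simp
  then obtain t s where "big_step short_vector_prog (init_memory C m N bs as) t s"
    "t \<le> total_time q (2 * q) (q * m + m * (m * D))" "nmem s (''e'', []) = 2 * q"
    "short_vector (output_vec m s)"
    by (auto simp: runs_def)
  moreover from this have "t + output_size m s \<le> time_bound (input_size m bs as)"
    using total_time_le by (simp add: output_size_def q_def)
  ultimately show ?thesis by blast
qed

end

theorem lemma2p3:
  fixes C :: real
  assumes "C > 1"
  shows "\<exists>(P :: com) (p :: nat poly).
    \<forall>(m :: nat) (N :: 'a::field poly vec \<Rightarrow> real) (M :: 'a poly vec set) bs as.
      m \<ge> 1 \<longrightarrow>
      is_norm C m N \<longrightarrow>
      is_submodule m M \<longrightarrow> has_rank m M m \<longrightarrow>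
      length bs = m \<longrightarrow> is_basis m (carrier_vec m) bs \<longrightarrow>
      length as = m \<longrightarrow> is_basis m M as \<longrightarrow>
      (\<exists>t s. big_step P (init_memory C m N bs as) t s \<and>
        t + output_size m s \<le> poly p (input_size m bs as) \<and>
        output_vec m s \<in> M \<and> output_vec m s \<noteq> 0\<^sub>v m \<and>
        N (output_vec m s)
          \<le> root m (\<Prod>i<m. N (bs ! i)) * pabs C ([:0, 1:] :: 'a poly) powr (real (quot_dim m M) / real m))"
proof -
  obtain p where p: "\<And>n. poly p n = time_bound n" using is_poly_time_bound unfolding is_poly_def by blast
  have z: "pabs C ([:0, 1:] :: 'a poly) = C" by (simp add: pabs_def)
  show ?thesis
  \<comment> \<open>Program and polynomial are chosen before \<open>m\<close>, the norm and the
    bases, so one algorithm serves all inputs; neither of them depends on \<open>C\<close>.\<close>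
  proof (intro exI[of _ short_vector_prog] exI[of _ p] allI impI)
    fix m :: nat and N :: "'a poly vec \<Rightarrow> real" and M :: "'a poly vec set" and bs as :: "'a poly vec list"
    assume "m \<ge> 1" "is_norm C m N" "is_submodule m M" "length bs = m" "is_basis m (carrier_vec m) bs"
      "length as = m" "is_basis m M as"
    then interpret lattice C m N M bs as using assms by unfold_locales
    show "\<exists>t s. big_step short_vector_prog (init_memory C m N bs as) t s \<and>
        t + output_size m s \<le> poly p (input_size m bs as) \<and>
        output_vec m s \<in> M \<and> output_vec m s \<noteq> 0\<^sub>v m \<and>
        N (output_vec m s)
          \<le> root m (\<Prod>i<m. N (bs ! i)) * pabs C ([:0, 1:] :: 'a poly) powr (real (quot_dim m M) / real m)"
      using short_vector_computable unfolding short_vector_def p z by blast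
  qed
qed

end
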